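(* Let $p$ be a rational prime and let $\mathbb{F}/\mathbb{Q}$ be a (possibly infinite) Galois extension, $\mathbb{F}\subseteq\overline{\mathbb{Q}}$, which is unramified at $p$ and has property (B). Then $\mathbb{F}(\boldsymbol{\mu}_{p^\infty})$ has property (B), where $\boldsymbol{\mu}_{p^\infty}$ is the set of roots of unity in $\overline{\mathbb{Q}}$ of $p$-power order.
   Context: $h$ denotes the absolute logarithmic Weil height on $\overline{\mathbb{Q}}$; a subfield $\mathbb{L}\subseteq\overline{\mathbb{Q}}$ has property (B) if there exists $c>0$ with $h(\alpha)\ge c$ for every $\alpha\in\mathbb{L}^\times$ that is not a root of unity. *)

theory Defs
  imports
    Complex_Main
    "HOL-Computational_Algebra.Computational_Algebra"
    "HOL-Algebra.Algebra"
    "HOL-Algebra.Algebraic_Closure_Type"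
begin

text \<open>
  The algebraic closure of the rationals is taken inside the complex numbers: it is the set
  \<open>{x :: complex. algebraic x}\<close>. The names \<open>irreducible\<close> and \<open>prime\<close> are qualified below because
  \<open>HOL-Algebra\<close> has constants of the same name.
\<close>

abbreviation complex_ring :: "complex ring" where
  "complex_ring \<equiv> ring_of_type_algebra"


subsection \<open>Weil height and property (B)\<close>

text \<open>
  The minimal polynomial over the integers: an irreducible element of \<open>\<int>[X]\<close> of positive degree is
  primitive, so together with the sign condition this determines the polynomial.
\<close>
definition int_min_poly :: "complex \<Rightarrow> int poly" where
  "int_min_poly \<alpha> = (THE f. Factorial_Ring.irreducible f \<and> Polynomial.lead_coeff f > 0 \<and>
     poly (map_poly of_int f) \<alpha> = 0)"

text \<open>
  For algebraic \<open>\<alpha>\<close> with minimal polynomial \<open>f = a (X - \<alpha>\<^sub>1) \<dots> (X - \<alpha>\<^sub>d)\<close> over the integers, the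
  absolute logarithmic Weil height is \<open>(log |a| + \<Sum>\<^sub>i log max(1, |\<alpha>\<^sub>i|)) / d\<close>.
  The sum accounts for the archimedean places and \<open>log |a|\<close> for the nonarchimedean ones.
  The \<open>\<alpha>\<^sub>i\<close> are pairwise distinct since \<open>f\<close> is separable, so summing over the set of
  roots loses no multiplicities. The value is meaningless for transcendental \<open>\<alpha>\<close>.
\<close>
definition weil_height :: "complex \<Rightarrow> real" where
  "weil_height \<alpha> =
     (let f = int_min_poly \<alpha>
      in (ln (real_of_int \<bar>Polynomial.lead_coeff f\<bar>) +
          (\<Sum>\<beta> | poly (map_poly of_int f) \<beta> = 0. ln (max 1 (cmod \<beta>)))) /
         real (Polynomial.degree f))"

definition root_of_unity :: "complex \<Rightarrow> bool" where
  "root_of_unity z \<longleftrightarrow> (\<exists>n>0. z ^ n = 1)"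

definition property_B :: "complex set \<Rightarrow> bool" where
  "property_B L \<longleftrightarrow>
     (\<exists>c>0. \<forall>\<alpha>\<in>L. \<alpha> \<noteq> 0 \<and> \<not> root_of_unity \<alpha> \<longrightarrow> c \<le> weil_height \<alpha>)"


subsection \<open>Galois extensions of the rationals\<close>

text \<open>
  An extension of the rationals is Galois iff it is algebraic and normal, separability being
  automatic. As the complex numbers are algebraically closed, a polynomial splits over \<open>F\<close> iff
  all its complex roots lie in \<open>F\<close>.
\<close>
definition galois_over_rats :: "complex set \<Rightarrow> bool" where
  "galois_over_rats F \<longleftrightarrow>
     subfield F complex_ring \<and>
     (\<forall>x\<in>F. algebraic x) \<and>
     (\<forall>f :: rat poly. Factorial_Ring.irreducible f \<and> (\<exists>x\<in>F. poly (map_poly of_rat f) x = 0)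
        \<longrightarrow> {x. poly (map_poly of_rat f) x = 0} \<subseteq> F)"


subsection \<open>Ramification\<close>

definition number_field :: "complex set \<Rightarrow> bool" where
  "number_field K \<longleftrightarrow> subfield K complex_ring \<and> ring.finite_dimension complex_ring \<rat> K"

definition ring_of_integers :: "complex set \<Rightarrow> complex ring" where
  "ring_of_integers K = complex_ring \<lparr> carrier := {x \<in> K. algebraic_int x} \<rparr>"

text \<open>
  In a number field, \<open>p\<close> is unramified iff the ideal generated by \<open>p\<close> is a product of pairwise
  distinct prime ideals (all exponents in its prime factorisation are 1). Residue fields are
  finite, so residue field extensions impose no separability condition. The ring \<open>ideals_set R\<close>
  has the ideals of \<open>R\<close> as elements and ideal multiplication as its product.
\<close>
definition unramified_in_number_field :: "complex set \<Rightarrow> nat \<Rightarrow> bool" where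
  "unramified_in_number_field K p \<longleftrightarrow>
     (let R = ring_of_integers K
      in \<exists>S. finite S \<and> (\<forall>P\<in>S. primeideal P R) \<and>
           PIdl\<^bsub>R\<^esub> (of_nat p) = (\<Otimes>\<^bsub>ideals_set R\<^esub> P \<in> S. P))"

text \<open>A possibly infinite algebraic extension is unramified at \<open>p\<close> iff all its finite
  subextensions are.\<close>
definition unramified_at :: "complex set \<Rightarrow> nat \<Rightarrow> bool" where
  "unramified_at F p \<longleftrightarrow>
     (\<forall>K. number_field K \<and> K \<subseteq> F \<longrightarrow> unramified_in_number_field K p)"


subsection \<open>Adjoining roots of unity\<close>

definition prime_power_roots_of_unity :: "nat \<Rightarrow> complex set" where
  "prime_power_roots_of_unity p = {z. \<exists>k. z ^ (p ^ k) = 1}"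

definition adjoin :: "complex set \<Rightarrow> complex set \<Rightarrow> complex set" where
  "adjoin F S = generate_field complex_ring (F \<union> S)"

end

theory Submission
  imports Defs
begin

text \<open>
  Let \<open>z\<close> be a primitive \<open>p\<^sup>n\<close>-th root of unity and \<open>x \<in> F(z)\<close>. Since \<open>F\<close> is unramified at \<open>p\<close>, the
  extension \<open>F(z) / F\<close> is totally ramified above \<open>p\<close>, and its elements that are integral at a place
  above \<open>p\<close> are polynomials in \<open>z\<close> with coefficients in \<open>F\<close> integral at that place. Raising to the
  power \<open>p\<^sup>k\<close> is additive modulo \<open>p\<close>, hence for \<open>\<sigma> : z \<mapsto> z\<^sup>s\<close> fixing \<open>z\<close> to the power \<open>p\<^sup>k\<close>
  and \<open>q = p\<^sup>k\<^sup>+\<^sup>1\<close> the numbers \<open>x\<^sup>q\<close> and \<open>\<sigma>(x)\<^sup>q\<close> are congruent modulo \<open>p\<^sup>2\<close> at all places above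
  \<open>p\<close>. If they are distinct, the product formula gives \<open>h(x) \<ge> (2 ln p - ln 2) / (2 q)\<close>.
  Otherwise \<open>\<sigma>(x) / x\<close> is a root of unity. For \<open>n \<ge> 3\<close> and the \<open>\<sigma>\<close> fixing \<open>z\<^sup>p\<close>, this implies that
  \<open>z\<^sup>r x \<in> F(z\<^sup>p)\<close> for some \<open>r\<close>, which has the same height, so one descends to \<open>n = 2\<close>. There, if
  the second case occurs for all \<open>\<sigma>\<close>, then \<open>x\<^sup>q \<in> F\<close>, and property (B) of \<open>F\<close> applies.

  Embeddings of number fields are replaced by the evaluation of rational polynomials at the conjugates
  of a primitive element, and the places above a prime \<open>l\<close> by the subrings of the complex numbers
  that are maximal among those not containing \<open>1 / l\<close>.
\<close>

subsection \<open>Subrings of the complex numbers and polynomials over them\<close>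

text \<open>The level \<open>n\<close> is unbounded, while the exponent \<open>q\<close> has to stay
  bounded. For \<open>n \<ge> 3\<close> only automorphisms fixing \<open>z^p\<close> are used, so
  \<open>k = 1\<close> and \<open>q = p^2\<close>; at level 2 every automorphism fixes
  \<open>z^(p^2) = 1\<close>, so \<open>k = 2\<close> and \<open>q = p^3\<close>, which is the
  origin of the \<open>p^3\<close> in the final constant. The modulus \<open>p^2\<close> is chosen
  because of the archimedean places: a difference of two powers costs a factor 2, and a congruence
  modulo \<open>p\<close> alone would leave \<open>ln p - ln 2\<close>, which vanishes for
  \<open>p = 2\<close>. The descent stops at level 2 because the factor
  \<open>\<sigma>(x) / x\<close> is a root of unity of order dividing \<open>p^2\<close>. It is
  fixed by \<open>\<sigma>\<close> as soon as it is a power of \<open>z^p\<close>, and that requires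
  \<open>n \<ge> 3\<close>. Normality makes the local argument available at all conjugates:
  conjugating the coefficients of a polynomial over \<open>F\<close> keeps them in \<open>F\<close>.
  Unramifiedness enters only in the form that each nonzero element of \<open>F\<close> is, at every
  place above \<open>p\<close>, a unit times a power of \<open>p\<close>.\<close>

definition is_subring :: "complex set \<Rightarrow> bool" where
  "is_subring R \<longleftrightarrow> 1 \<in> R \<and> (\<forall>x\<in>R. \<forall>y\<in>R. x - y \<in> R \<and> x * y \<in> R)"

definition is_subfield :: "complex set \<Rightarrow> bool" where
  "is_subfield K \<longleftrightarrow> is_subring K \<and> (\<forall>x\<in>K. inverse x \<in> K)"

text \<open>Coefficient rings are tracked as sets inside one type, so that the same polynomial can
  be read over the integers, \<open>F\<close>, \<open>V\<close> or \<open>F \<inter> V\<close>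
  without coercions.\<close>

definition polys_over :: "complex set \<Rightarrow> complex poly set" where
  "polys_over R = {P. \<forall>i. coeff P i \<in> R}"

lemma is_subfield_imp_subring [dest]: "is_subfield K \<Longrightarrow> is_subring K"
  by (simp add: is_subfield_def)

lemma subring_one: "is_subring R \<Longrightarrow> 1 \<in> R"
  and subring_diff: "is_subring R \<Longrightarrow> x \<in> R \<Longrightarrow> y \<in> R \<Longrightarrow> x - y \<in> R"
  and subring_mult: "is_subring R \<Longrightarrow> x \<in> R \<Longrightarrow> y \<in> R \<Longrightarrow> x * y \<in> R"
  by (auto simp: is_subring_def)

lemma subring_zero: "is_subring R \<Longrightarrow> 0 \<in> R"
  using subring_diff[of R 1 1] subring_one by auto

lemma subring_uminus: "is_subring R \<Longrightarrow> x \<in> R \<Longrightarrow> - x \<in> R"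
  using subring_diff[of R 0 x] subring_zero by auto

lemma subring_add: "is_subring R \<Longrightarrow> x \<in> R \<Longrightarrow> y \<in> R \<Longrightarrow> x + y \<in> R"
  using subring_diff[of R x "- y"] subring_uminus by auto

lemma subring_power: "is_subring R \<Longrightarrow> x \<in> R \<Longrightarrow> x ^ n \<in> R"
  by (induction n) (auto intro: subring_one subring_mult)

lemma subring_sum: "is_subring R \<Longrightarrow> (\<And>i. i \<in> I \<Longrightarrow> f i \<in> R) \<Longrightarrow> sum f I \<in> R"
  by (induction I rule: infinite_finite_induct) (auto intro: subring_zero subring_add)

lemma subring_prod: "is_subring R \<Longrightarrow> (\<And>i. i \<in> I \<Longrightarrow> f i \<in> R) \<Longrightarrow> prod f I \<in> R"
  by (induction I rule: infinite_finite_induct) (auto intro: subring_one subring_mult)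

lemma subring_of_nat: "is_subring R \<Longrightarrow> of_nat n \<in> R"
  by (induction n) (auto intro: subring_zero subring_one subring_add)

lemma subring_of_int: "is_subring R \<Longrightarrow> of_int n \<in> R"
  by (cases n) (auto intro!: subring_of_nat subring_uminus subring_add subring_one subring_diff)

lemma subring_Ints: "is_subring R \<Longrightarrow> x \<in> \<int> \<Longrightarrow> x \<in> R"
  by (auto elim!: Ints_cases intro: subring_of_int)

lemmas subring_intros = subring_zero subring_one subring_diff subring_mult subring_uminus
  subring_add subring_power subring_sum subring_prod subring_of_nat subring_of_int

lemma subfield_inverse: "is_subfield K \<Longrightarrow> x \<in> K \<Longrightarrow> inverse x \<in> K"
  by (auto simp: is_subfield_def)

lemma subfield_divide: "is_subfield K \<Longrightarrow> x \<in> K \<Longrightarrow> y \<in> K \<Longrightarrow> x / y \<in> K"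
  unfolding divide_inverse by (intro subring_mult subfield_inverse) auto

lemma subfield_Rats: "is_subfield K \<Longrightarrow> x \<in> \<rat> \<Longrightarrow> x \<in> K"
  by (erule Rats_cases') (auto intro!: subfield_divide subring_of_int)

lemma is_subring_Ints: "is_subring \<int>" and is_subfield_Rats: "is_subfield \<rat>"
  by (auto simp: is_subring_def is_subfield_def)

lemma polys_overI: "(\<And>i. coeff P i \<in> R) \<Longrightarrow> P \<in> polys_over R"
  and polys_overD: "P \<in> polys_over R \<Longrightarrow> coeff P i \<in> R"
  by (auto simp: polys_over_def)

lemma polys_over_mono: "R \<subseteq> S \<Longrightarrow> P \<in> polys_over R \<Longrightarrow> P \<in> polys_over S"
  by (auto simp: polys_over_def)

context
  fixes R assumes R: "is_subring R"
begin

lemma polys_over_zero: "0 \<in> polys_over R"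
  and polys_over_one: "1 \<in> polys_over R"
  and polys_over_const: "c \<in> R \<Longrightarrow> [:c:] \<in> polys_over R"
  and polys_over_pCons: "c \<in> R \<Longrightarrow> P \<in> polys_over R \<Longrightarrow> pCons c P \<in> polys_over R"
  and polys_over_monom: "c \<in> R \<Longrightarrow> Polynomial.monom c n \<in> polys_over R"
  and polys_over_smult: "c \<in> R \<Longrightarrow> P \<in> polys_over R \<Longrightarrow> Polynomial.smult c P \<in> polys_over R"
  and polys_over_uminus: "P \<in> polys_over R \<Longrightarrow> - P \<in> polys_over R"
  using R by (auto simp: polys_over_def coeff_pCons subring_intros split: nat.splits)

lemma polys_over_add: "P \<in> polys_over R \<Longrightarrow> Q \<in> polys_over R \<Longrightarrow> P + Q \<in> polys_over R"
  and polys_over_diff: "P \<in> polys_over R \<Longrightarrow> Q \<in> polys_over R \<Longrightarrow> P - Q \<in> polys_over R"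
  and polys_over_mult: "P \<in> polys_over R \<Longrightarrow> Q \<in> polys_over R \<Longrightarrow> P * Q \<in> polys_over R"
  using R by (auto simp: polys_over_def coeff_mult intro!: subring_intros)

lemma polys_over_power: "P \<in> polys_over R \<Longrightarrow> P ^ n \<in> polys_over R"
  by (induction n) (auto intro: polys_over_one polys_over_mult)

lemma polys_over_sum: "(\<And>i. i \<in> I \<Longrightarrow> f i \<in> polys_over R) \<Longrightarrow> sum f I \<in> polys_over R"
  by (induction I rule: infinite_finite_induct) (auto intro: polys_over_zero polys_over_add)

lemma polys_over_prod: "(\<And>i. i \<in> I \<Longrightarrow> f i \<in> polys_over R) \<Longrightarrow> prod f I \<in> polys_over R"
  by (induction I rule: infinite_finite_induct) (auto intro: polys_over_one polys_over_mult)

lemma polys_over_pderiv: "P \<in> polys_over R \<Longrightarrow> pderiv P \<in> polys_over R"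
  using subring_mult[OF R subring_of_nat[OF R]]
  by (auto simp: polys_over_def coeff_pderiv simp flip: of_nat_Suc)

lemma polys_over_pcompose:
  "P \<in> polys_over R \<Longrightarrow> Q \<in> polys_over R \<Longrightarrow> P \<circ>\<^sub>p Q \<in> polys_over R"
proof (induction P)
  case (pCons a P)
  have "a \<in> R" using polys_overD[OF pCons.prems(1), of 0] by simp
  moreover have "P \<in> polys_over R"
    using polys_overD[OF pCons.prems(1), of "Suc _"] by (auto intro!: polys_overI)
  ultimately show ?case using pCons
    by (simp add: pcompose_pCons polys_over_add polys_over_mult polys_over_const)
qed (simp add: polys_over_zero)

lemma poly_in_subring: "P \<in> polys_over R \<Longrightarrow> x \<in> R \<Longrightarrow> poly P x \<in> R"
  unfolding poly_altdef using R by (auto intro!: subring_intros polys_overD)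

end

lemmas polys_over_intros = polys_over_zero polys_over_one polys_over_const polys_over_pCons
  polys_over_monom polys_over_smult polys_over_uminus polys_over_add polys_over_diff
  polys_over_mult polys_over_power polys_over_sum polys_over_prod polys_over_pderiv
  polys_over_pcompose

lemma polys_over_map_of_int: "map_poly of_int f \<in> polys_over \<int>"
  by (auto simp: polys_over_def coeff_map_poly)

lemma polys_over_reflect_iff:
  assumes "0 \<in> R"
  shows "reflect_poly P \<in> polys_over R \<longleftrightarrow> P \<in> polys_over R"
proof
  assume *: "P \<in> polys_over R"
  show "reflect_poly P \<in> polys_over R"
    using * assms by (auto simp: polys_over_def coeff_reflect_poly)
next
  assume *: "reflect_poly P \<in> polys_over R"
  show "P \<in> polys_over R"
  proof (rule polys_overI)
    fix i
    show "coeff P i \<in> R"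
    proof (cases "i \<le> degree P")
      case True
      then show ?thesis using polys_overD[OF *, of "degree P - i"]
        by (simp add: coeff_reflect_poly split: if_splits)
    qed (use assms in \<open>simp add: coeff_eq_0\<close>)
  qed
qed

subsection \<open>Newton's identities\<close>

text \<open>Logarithmic derivative, written without division: for the product \<open>E\<close>, the
  quotient \<open>E' / E\<close> is the sum of the \<open>- r i / (1 - r i X)\<close>, and the
  geometric series turn this into power sums.\<close>

lemma fps_deriv_prod_roots:
  fixes r :: "'a \<Rightarrow> complex"
  assumes "finite I"
  shows "fps_deriv (\<Prod>i\<in>I. 1 - fps_const (r i) * fps_X) =
    - (\<Prod>i\<in>I. 1 - fps_const (r i) * fps_X) * Abs_fps (\<lambda>k. \<Sum>i\<in>I. r i ^ Suc k)"
  using assms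
proof (induction I rule: finite_induct)
  case empty
  have "Abs_fps (\<lambda>k. 0::complex) = 0" by (simp add: fps_eq_iff)
  then show ?case by simp
next
  case (insert x I)
  define E where "E = (\<Prod>i\<in>I. 1 - fps_const (r i) * fps_X)"
  define S where "S = Abs_fps (\<lambda>k. \<Sum>i\<in>I. r i ^ Suc k)"
  define T where "T = Abs_fps (\<lambda>k. r x ^ Suc k)"
  have T: "T * (1 - fps_const (r x) * fps_X) = fps_const (r x)"
  proof (rule fps_ext)
    fix n
    have "T * (1 - fps_const (r x) * fps_X) = T - fps_const (r x) * (T * fps_X)"
      by (simp add: algebra_simps)
    then show "fps_nth (T * (1 - fps_const (r x) * fps_X)) n = fps_nth (fps_const (r x)) n"
      by (cases n) (auto simp: T_def)
  qed
  have sum: "Abs_fps (\<lambda>k. \<Sum>i\<in>insert x I. r i ^ Suc k) = S + T"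
    using insert by (simp add: fps_eq_iff S_def T_def)
  have prod: "(\<Prod>i\<in>insert x I. 1 - fps_const (r i) * fps_X) = (1 - fps_const (r x) * fps_X) * E"
    using insert by (simp add: E_def)
  have deriv: "fps_deriv ((1 - fps_const (r x) * fps_X) * E) =
    - ((1 - fps_const (r x) * fps_X) * E) * S - T * (1 - fps_const (r x) * fps_X) * E"
  proof -
    have "fps_deriv E = - E * S" using insert.IH by (simp only: E_def S_def)
    then have "fps_deriv ((1 - fps_const (r x) * fps_X) * E) =
      - ((1 - fps_const (r x) * fps_X) * E) * S - fps_const (r x) * E"
      by (simp add: algebra_simps)
    then show ?thesis by (simp only: T)
  qed
  have "- (a * E) * S - T * a * E = - (a * E) * (S + T)" for a
    by (simp add: algebra_simps)
  then show ?case by (simp only: sum prod deriv)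
qed

lemma fps_prod_roots_eq_poly:
  "(\<Prod>i\<in>I. 1 - fps_const (r i) * fps_X) = fps_of_poly (reflect_poly (\<Prod>i\<in>I. [:- r i, 1:]))"
  for r :: "'a \<Rightarrow> complex"
proof -
  have "reflect_poly [:- c, 1:] = [:1, - c:]" for c :: complex
    by (cases "c = 0") (auto simp: reflect_poly_def)
  then show ?thesis
    by (simp add: reflect_poly_prod fps_of_poly_prod fps_of_poly_pCons algebra_simps
        fps_const_neg[symmetric] del: fps_const_neg)
qed

lemma newton_identity:
  fixes r :: "'a \<Rightarrow> complex"
  assumes "finite I"
  defines "E \<equiv> reflect_poly (\<Prod>i\<in>I. [:- r i, 1:])"
  shows "of_nat (Suc n) * coeff E (Suc n) = - (\<Sum>j\<le>n. coeff E j * (\<Sum>i\<in>I. r i ^ Suc (n - j)))"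
proof -
  have "fps_nth (fps_deriv (fps_of_poly E)) n =
      fps_nth (- fps_of_poly E * Abs_fps (\<lambda>k. \<Sum>i\<in>I. r i ^ Suc k)) n"
    using fps_deriv_prod_roots[OF assms(1), of r] by (simp add: fps_prod_roots_eq_poly E_def)
  then show ?thesis by (simp add: fps_mult_nth sum_negf atLeast0AtMost)
qed

text \<open>In characteristic 0 Newton's identities can be solved in both directions. This takes the
  place of the fundamental theorem on symmetric polynomials: rationality of a product of linear
  factors is later checked on power sums.\<close>

lemma prod_roots_over_subfield_iff:
  fixes r :: "'a \<Rightarrow> complex"
  assumes K: "is_subfield K" and I: "finite I"
  shows "(\<Prod>i\<in>I. [:- r i, 1:]) \<in> polys_over K \<longleftrightarrow> (\<forall>k. (\<Sum>i\<in>I. r i ^ k) \<in> K)"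
proof -
  define E where "E = reflect_poly (\<Prod>i\<in>I. [:- r i, 1:])"
  define S where "S = (\<lambda>k. \<Sum>i\<in>I. r i ^ Suc k)"
  have R: "is_subring K" using K by auto
  have newton: "of_nat (Suc n) * coeff E (Suc n) = - (\<Sum>j\<le>n. coeff E j * S (n - j))" for n
    using newton_identity[OF I, of n r] by (simp add: E_def S_def)
  have E0: "coeff E 0 = 1" by (simp add: E_def lead_coeff_prod)
  have "E \<in> polys_over K \<longleftrightarrow> (\<forall>k. S k \<in> K)"
  proof safe
    fix k assume S: "\<forall>k. S k \<in> K"
    show "E \<in> polys_over K"
    proof (rule polys_overI)
      fix n show "coeff E n \<in> K"
      proof (induction n rule: less_induct)
        case (less n)
        show ?case
        proof (cases n)
          case 0 then show ?thesis using E0 subring_one[OF R] by simp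
        next
          case (Suc m)
          have "- (\<Sum>j\<le>m. coeff E j * S (m - j)) \<in> K"
            using less S R Suc by (auto intro!: subring_intros)
          then have "of_nat (Suc m) * coeff E (Suc m) \<in> K" by (simp only: newton)
          then have "of_nat (Suc m) * coeff E (Suc m) / of_nat (Suc m) \<in> K"
            by (intro subfield_divide K subring_of_nat R)
          then show ?thesis unfolding Suc by (simp del: of_nat_Suc)
        qed
      qed
    qed
  next
    fix k assume E: "E \<in> polys_over K"
    show "S k \<in> K"
    proof (induction k rule: less_induct)
      case (less k)
      have "(\<Sum>j\<le>k. coeff E j * S (k - j)) = S k + (\<Sum>j\<in>{1..k}. coeff E j * S (k - j))"
        using E0 by (simp add: atMost_atLeast0 sum.atLeast_Suc_atMost)
      then have "S k = - (of_nat (Suc k) * coeff E (Suc k)) - (\<Sum>j\<in>{1..k}. coeff E j * S (k - j))"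
        using newton[of k] by (simp del: of_nat_Suc)
      also have "\<dots> \<in> K" using less R E by (intro subring_intros polys_overD) auto
      finally show ?case .
    qed
  qed
  also have "(\<forall>k. S k \<in> K) \<longleftrightarrow> (\<forall>k. (\<Sum>i\<in>I. r i ^ k) \<in> K)"
  proof -
    have "(\<Sum>i\<in>I. r i ^ k) \<in> K" if "\<forall>k. S k \<in> K" for k
      using that subring_of_nat[OF R] by (cases k) (auto simp: S_def simp del: power_Suc)
    then show ?thesis by (auto simp: S_def simp del: power_Suc)
  qed
  finally show ?thesis using polys_over_reflect_iff[OF subring_zero[OF R]] by (simp add: E_def)
qed

subsection \<open>Minimal polynomials over the integers\<close>

lemma map_poly_of_int_add:
  "map_poly of_int (f + g) = (map_poly of_int f + map_poly of_int g :: complex poly)"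
  by (intro poly_eqI) (simp add: coeff_map_poly)

lemma map_poly_of_int_mult:
  "map_poly of_int (f * g) = (map_poly of_int f * map_poly of_int g :: complex poly)"
  by (intro poly_eqI) (simp add: coeff_map_poly coeff_mult)

lemma Ints_poly_eq_map_poly:
  assumes "P \<in> polys_over \<int>"
  obtains f where "P = map_poly of_int f"
proof
  have "of_int \<lfloor>Re (coeff P i)\<rfloor> = coeff P i" for i
    using polys_overD[OF assms, of i] by (auto elim: Ints_cases)
  then show "P = map_poly of_int (map_poly (\<lambda>z. \<lfloor>Re z\<rfloor>) P)"
    by (intro poly_eqI) (simp add: coeff_map_poly)
qed

lemma Rats_poly_clear_denominators:
  assumes "P \<in> polys_over \<rat>"
  obtains f n where "n > (0::nat)" "Polynomial.smult (of_nat n) P = map_poly of_int f"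
proof -
  have "\<exists>n>0. \<forall>i. of_nat n * coeff P i \<in> \<int>" if "P \<in> polys_over \<rat>" for P
    using that
  proof (induction P)
    case 0
    then show ?case by (auto intro: exI[of _ 1])
  next
    case (pCons a P)
    have "P \<in> polys_over \<rat>"
      using polys_overD[OF pCons.prems(1), of "Suc _"] by (auto intro!: polys_overI)
    with pCons obtain n where n: "n > 0" "\<And>i. of_nat n * coeff P i \<in> \<int>" by auto
    have "a \<in> \<rat>" using polys_overD[OF pCons.prems(1), of 0] by simp
    obtain b c where bc: "c > 0" "a = of_int b / of_nat c"
    proof -
      obtain b c where "c > 0" "a = of_int b / of_int c"
        using \<open>a \<in> \<rat>\<close> by (auto elim: Rats_cases')
      then show ?thesis using that[of "nat c" b] by simp
    qed
    have *: "of_nat (n * c) * a = of_int (int n * b)"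
      using bc by (simp add: field_simps)
    have "of_nat (n * c) * coeff P i = of_nat c * (of_nat n * coeff P i)" for i
      by simp
    then have "of_nat (n * c) * coeff P i \<in> \<int>" for i using n by (simp only:) auto
    then show ?case using n bc *
      by (intro exI[of _ "n * c"]) (auto simp: coeff_pCons split: nat.splits)
  qed
  then obtain n where n: "n > 0" "\<And>i. of_nat n * coeff P i \<in> \<int>" using assms by blast
  then have "Polynomial.smult (of_nat n) P \<in> polys_over \<int>" by (auto simp: polys_over_def)
  then show ?thesis using n Ints_poly_eq_map_poly that by metis
qed

text \<open>A multiplicative map that kills \<open>h\<close> must kill one of its prime factors. The
  type is general because both \<open>int poly\<close> and \<open>rat poly\<close> are
  needed.\<close>

lemma irreducible_factor_root:
  fixes h :: "'a :: factorial_semiring" and ev :: "'a \<Rightarrow> complex"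
  assumes ev: "\<And>f g. ev (f * g) = ev f * ev g" "ev 1 = 1" and h: "h \<noteq> 0" "ev h = 0"
  obtains f where "prime_elem f" "f dvd h" "ev f = 0"
proof -
  have "h dvd \<Prod>\<^sub># (prime_factorization h)"
    using prod_mset_prime_factorization_weak[OF h(1)] by (metis associated_iff_dvd)
  then obtain u where u: "\<Prod>\<^sub># (prime_factorization h) = h * u" by (rule dvdE)
  have "ev (\<Prod>\<^sub># (prime_factorization h)) = 0" unfolding u by (simp add: ev h(2))
  moreover have "\<exists>f\<in>#M. ev f = 0" if "ev (\<Prod>\<^sub># M) = 0" for M
    using that by (induction M) (auto simp: ev)
  ultimately obtain f where f: "f \<in># prime_factorization h" "ev f = 0" by blast
  then have "prime_elem f" using in_prime_factors_imp_prime prime_imp_prime_elem by blast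
  then show ?thesis using f in_prime_factors_imp_dvd that by blast
qed

text \<open>A prime factor \<open>f\<close> of an annihilating polynomial of least degree works.
  Pseudo-division shows that \<open>f\<close> divides a constant multiple \<open>a g\<close>, and
  the prime \<open>f\<close>, having positive degree, cannot divide \<open>a\<close>. So Gauss's
  lemma for rational coefficients is bypassed.\<close>

lemma minimal_int_poly:
  assumes "algebraic (x :: complex)"
  obtains f :: "int poly" where "Factorial_Ring.irreducible f" "poly (map_poly of_int f) x = 0"
    "\<And>g. poly (map_poly of_int g) x = 0 \<Longrightarrow> f dvd g"
proof -
  define ev where "ev = (\<lambda>f :: int poly. poly (map_poly of_int f) x)"
  have ev_mult: "ev (f * g) = ev f * ev g" and ev_add: "ev (f + g) = ev f + ev g" for f g
    by (simp_all add: ev_def map_poly_of_int_mult map_poly_of_int_add)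
  have ev_const: "ev [:c:] = of_int c" for c by (simp add: ev_def map_poly_pCons)
  have ev_1: "ev 1 = 1" using ev_const[of 1] by (simp add: one_pCons)
  obtain P where P: "P \<in> polys_over \<int>" "P \<noteq> 0" "poly P x = 0"
    using assms by (auto elim!: algebraicE simp: polys_over_def)
  then obtain g where g: "P = map_poly of_int g" using Ints_poly_eq_map_poly by blast
  then have "g \<noteq> 0 \<and> ev g = 0" using P by (auto simp: ev_def)
  then obtain h where h: "h \<noteq> 0" "ev h = 0"
    and h_min: "\<And>g. g \<noteq> 0 \<Longrightarrow> ev g = 0 \<Longrightarrow> degree h \<le> degree g"
    using ex_has_least_nat[of "\<lambda>g. g \<noteq> 0 \<and> ev g = 0" g degree] by auto
  obtain f where prime: "prime_elem f" and "f dvd h" and f: "ev f = 0"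
    by (rule irreducible_factor_root[OF ev_mult ev_1 h])
  have irr: "Factorial_Ring.irreducible f" using prime by (rule prime_elem_imp_irreducible)
  have deg_f: "degree f \<le> degree h" using \<open>f dvd h\<close> h dvd_imp_degree_le by blast
  have f0: "f \<noteq> 0" using prime by auto
  have pos: "degree f > 0"
  proof (rule ccontr)
    assume "\<not> degree f > 0"
    then obtain c where "f = [:c:]" by (auto elim: degree_eq_zeroE)
    then show False using f f0 by (simp add: ev_const)
  qed
  have "f dvd g" if "ev g = 0" for g
  proof -
    obtain a q where a: "a \<noteq> 0" "Polynomial.smult a g = f * q + pseudo_mod g f"
      using pseudo_mod(1)[OF f0, of g] by blast
    have "ev (Polynomial.smult a g) = 0"
      using that ev_mult[of "[:a:]" g] by simp
    then have "ev (pseudo_mod g f) = 0" using a f by (simp add: ev_add ev_mult)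
    then have "pseudo_mod g f = 0"
      using pseudo_mod(2)[OF f0, of g] h_min[of "pseudo_mod g f"] deg_f by fastforce
    then have "f dvd [:a:] * g" using a by simp
    moreover have "\<not> f dvd [:a:]"
      using a pos dvd_imp_degree_le[of f "[:a:]"] by auto
    ultimately show ?thesis using prime prime_elem_dvd_multD by blast
  qed
  then show ?thesis using that irr f by (auto simp: ev_def)
qed

lemma irreducible_int_poly_dvd:
  assumes "Factorial_Ring.irreducible f" "poly (map_poly of_int f) (x::complex) = 0"
    and "poly (map_poly of_int g) x = 0"
  shows "f dvd g"
proof -
  have "f \<noteq> 0" using assms by auto
  then have "algebraic x"
    using assms(2) polys_over_map_of_int[of f]
    by (intro algebraicI[of "map_poly of_int f"]) (auto simp: polys_over_def map_poly_eq_0_iff)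
  then obtain f0 where f0: "Factorial_Ring.irreducible f0"
    "\<And>g. poly (map_poly of_int g) x = 0 \<Longrightarrow> f0 dvd g"
    using minimal_int_poly by blast
  then obtain u where u: "f = f0 * u" using assms(2) unfolding dvd_def by blast
  then have "u dvd 1" 
    using Factorial_Ring.irreducibleD[OF assms(1) u] Factorial_Ring.irreducible_not_unit[OF f0(1)] by blast
  then have "f dvd f0" unfolding u by (simp add: mult_unit_dvd_iff)
  then show ?thesis using f0(2)[OF assms(3)] dvd_trans by blast
qed

lemma int_min_poly_exists1:
  assumes "algebraic (x :: complex)"
  shows "\<exists>!f. Factorial_Ring.irreducible f \<and> lead_coeff f > 0 \<and> poly (map_poly of_int f) x = 0"
proof -
  obtain f where f: "Factorial_Ring.irreducible f" "poly (map_poly of_int f) x = 0"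
    using minimal_int_poly[OF assms] by blast
  define g where "g = (if lead_coeff f > 0 then f else - f)"
  have "f \<noteq> 0" using f by auto
  then have "lead_coeff g > 0" by (auto simp: g_def not_less le_less)
  moreover have "g dvd f" "f dvd g" by (auto simp: g_def)
  then have "Factorial_Ring.irreducible g"
    using f(1) irreducible_mult_unit_left[of "-1" f] by (auto simp: g_def)
  moreover have "poly (map_poly of_int g) x = 0"
    using \<open>f dvd g\<close> f by (auto simp: map_poly_of_int_mult dvd_def)
  moreover have "f1 = f2" if "Factorial_Ring.irreducible f1" "lead_coeff f1 > 0"
    "poly (map_poly of_int f1) x = 0" "Factorial_Ring.irreducible f2" "lead_coeff f2 > 0"
    "poly (map_poly of_int f2) x = 0" for f1 f2
  proof -
    have "f1 dvd f2" "f2 dvd f1" using that irreducible_int_poly_dvd by blast+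
    then obtain u v where u: "f2 = f1 * u" "f1 = f2 * v" unfolding dvd_def by blast
    have "f2 * (v * u) = f2 * v * u" by (simp add: mult.assoc)
    also have "\<dots> = f2 * 1" unfolding u(2)[symmetric] u(1)[symmetric] by simp
    finally have "f2 * (v * u) = f2 * 1" .
    moreover have "f2 \<noteq> 0" using that by auto
    ultimately have "v * u = 1" by (simp only: mult_cancel_left) simp
    then have "u dvd 1" by (intro dvdI[of _ _ v]) (simp add: mult.commute)
    then obtain c where c: "u = [:c:]" "c dvd 1" by (auto simp: is_unit_poly_iff)
    then have "lead_coeff f2 = lead_coeff f1 * c" using u(1) lead_coeff_mult[of f1 u] by simp
    then have "c > 0" using that by (simp add: zero_less_mult_iff)
    then have "c = 1" using c by auto
    then show ?thesis using u(1) c by simp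
  qed
  ultimately show ?thesis by blast
qed

lemma
  assumes "algebraic (x :: complex)"
  shows irreducible_int_min_poly: "Factorial_Ring.irreducible (int_min_poly x)"
    and lead_coeff_int_min_poly: "lead_coeff (int_min_poly x) > 0"
    and poly_int_min_poly: "poly (map_poly of_int (int_min_poly x)) x = 0"
  using theI'[OF int_min_poly_exists1[OF assms]] by (auto simp: int_min_poly_def)

definition conjugates :: "complex \<Rightarrow> complex set" where
  "conjugates x = {y. poly (map_poly of_int (int_min_poly x)) y = 0}"

lemma self_in_conjugates: "algebraic x \<Longrightarrow> x \<in> conjugates x"
  by (simp add: conjugates_def poly_int_min_poly)

lemma int_min_poly_nonzero: "algebraic x \<Longrightarrow> int_min_poly x \<noteq> 0"
  using lead_coeff_int_min_poly by force

lemma finite_conjugates: "algebraic x \<Longrightarrow> finite (conjugates x)"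
  unfolding conjugates_def by (intro poly_roots_finite) (simp add: map_poly_eq_0_iff int_min_poly_nonzero)

lemma algebraic_conjugate:
  assumes "algebraic x" "y \<in> conjugates x"
  shows "algebraic y"
  using assms polys_over_map_of_int[of "int_min_poly x"] int_min_poly_nonzero[of x]
  by (intro algebraicI[of "map_poly of_int (int_min_poly x)"])
     (auto simp: polys_over_def conjugates_def map_poly_eq_0_iff)

lemma int_min_poly_conjugate:
  assumes "algebraic x" "y \<in> conjugates x"
  shows "int_min_poly y = int_min_poly x"
  unfolding int_min_poly_def[of y]
  using irreducible_int_min_poly[OF assms(1)] lead_coeff_int_min_poly[OF assms(1)]
  by (intro the1_equality int_min_poly_exists1 algebraic_conjugate[OF assms])
     (use assms(2) in \<open>auto simp: conjugates_def\<close>)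

lemma conjugates_conjugate:
  "algebraic x \<Longrightarrow> y \<in> conjugates x \<Longrightarrow> conjugates y = conjugates x"
  using int_min_poly_conjugate[of x y] by (simp add: conjugates_def[of y] conjugates_def[of x])

text \<open>The substitute for applying a field embedding that sends \<open>x\<close> to
  \<open>y\<close>: after clearing denominators the minimal polynomial divides the relation.\<close>

lemma poly_conjugate_zero:
  assumes "algebraic x" "y \<in> conjugates x" "P \<in> polys_over \<rat>" "poly P x = 0"
  shows "poly P y = 0"
proof -
  obtain f n where f: "n > (0::nat)" "Polynomial.smult (of_nat n) P = map_poly of_int f"
    using Rats_poly_clear_denominators[OF assms(3)] by blast
  then have eq: "poly (map_poly of_int f) z = of_nat n * poly P z" for z
    by (metis poly_smult)
  then have "int_min_poly x dvd f"
    using assms(4) irreducible_int_poly_dvd[OF irreducible_int_min_poly poly_int_min_poly] assms(1)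
    by simp
  then have "poly (map_poly of_int f) y = 0"
    using assms(2) by (auto simp: map_poly_of_int_mult conjugates_def elim!: dvdE)
  then show ?thesis using eq f by simp
qed

lemma poly_conjugate_zero_iff:
  assumes "algebraic x" "y \<in> conjugates x" "P \<in> polys_over \<rat>"
  shows "poly P y = 0 \<longleftrightarrow> poly P x = 0"
proof -
  have "x \<in> conjugates y" using assms conjugates_conjugate self_in_conjugates by blast
  then show ?thesis using poly_conjugate_zero assms algebraic_conjugate by blast
qed

lemma poly_in_conjugates:
  assumes "algebraic x" "y \<in> conjugates x" "A \<in> polys_over \<rat>" "algebraic (poly A x)"
  shows "poly A y \<in> conjugates (poly A x)"
proof -
  have "map_poly of_int (int_min_poly (poly A x)) \<circ>\<^sub>p A \<in> polys_over \<rat>"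
    using assms(3) by (intro polys_over_pcompose is_subfield_imp_subring is_subfield_Rats
        polys_over_mono[OF _ polys_over_map_of_int]) (auto elim!: Ints_cases)
  moreover have "poly (map_poly of_int (int_min_poly (poly A x)) \<circ>\<^sub>p A) x = 0"
    using poly_int_min_poly[OF assms(4)] by (simp add: poly_pcompose)
  ultimately show ?thesis
    using poly_conjugate_zero[OF assms(1,2), of "map_poly of_int (int_min_poly (poly A x)) \<circ>\<^sub>p A"]
    by (auto simp: conjugates_def poly_pcompose)
qed

lemma degree_nonzero_of_root:
  assumes "P \<noteq> 0" "poly P x = 0"
  shows "degree P \<noteq> 0"
proof
  assume "degree P = 0"
  then obtain c where "P = [:c:]" by (rule degree_eq_zeroE)
  then show False using assms by simp
qed

text \<open>At a root the derivative has order one less and is again rational, so induction on the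
  degree reduces the claim to the transport of zeros. It later makes the fibres of polynomial maps
  on conjugates equally large.\<close>

lemma order_conjugate:
  assumes "algebraic x" "y \<in> conjugates x" "P \<in> polys_over \<rat>" "P \<noteq> 0"
  shows "order y P = order x P"
  using assms(3,4)
proof (induction "degree P" arbitrary: P rule: less_induct)
  case less
  have iff: "poly P y = 0 \<longleftrightarrow> poly P x = 0"
    by (rule poly_conjugate_zero_iff[OF assms(1,2) less.prems(1)])
  show ?case
  proof (cases "poly P x = 0")
    case True
    then have "degree P \<noteq> 0" using less.prems(2) degree_nonzero_of_root by blast
    then have "pderiv P \<noteq> 0" "degree (pderiv P) < degree P"
      by (auto simp: pderiv_eq_0_iff degree_pderiv)
    moreover have "pderiv P \<in> polys_over \<rat>"
      using less.prems is_subfield_Rats by (blast intro: polys_over_pderiv)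
    ultimately have "order y (pderiv P) = order x (pderiv P)" using less.hyps by blast
    then show ?thesis using True iff less.prems(2) by (simp add: order_pderiv)
  next
    case False
    then show ?thesis using iff by (simp add: order_0I)
  qed
qed

text \<open>For reasons of degree the minimal polynomial cannot divide its derivative, so the
  derivative has no root in common with it.\<close>

lemma rsquarefree_int_min_poly:
  assumes "algebraic x" "y \<in> conjugates x"
  shows "order y (map_poly of_int (int_min_poly x)) = 1"
proof -
  define f where "f = int_min_poly y"
  define P :: "complex poly" where "P = map_poly of_int f"
  have y: "algebraic y" using assms algebraic_conjugate by blast
  have f0: "f \<noteq> 0" using int_min_poly_nonzero[OF y] by (simp add: f_def)
  have root: "poly P y = 0" using poly_int_min_poly[OF y] by (simp add: P_def f_def)
  have P0: "P \<noteq> 0" using f0 by (simp add: P_def map_poly_eq_0_iff)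
  have "degree P = degree f" by (simp add: P_def degree_map_poly)
  moreover have "degree P \<noteq> 0" using root P0 degree_nonzero_of_root by blast
  ultimately have deg: "degree f \<noteq> 0" by simp
  have "map_poly of_int (pderiv f) = pderiv P"
    by (intro poly_eqI) (simp add: P_def coeff_map_poly coeff_pderiv)
  moreover have "\<not> f dvd pderiv f"
    using deg dvd_imp_degree_le[of f "pderiv f"] by (auto simp: pderiv_eq_0_iff degree_pderiv)
  ultimately have "poly (pderiv P) y \<noteq> 0"
    using irreducible_int_poly_dvd[OF irreducible_int_min_poly[OF y] poly_int_min_poly[OF y], of "pderiv f"]
    by (auto simp: f_def)
  then have "order y P = 1" using root P0 by (simp add: order_pderiv order_0I)
  then show ?thesis using int_min_poly_conjugate[OF assms] by (simp add: P_def f_def)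
qed

lemma int_min_poly_eq_prod:
  assumes "algebraic x"
  shows "map_poly of_int (int_min_poly x) =
    Polynomial.smult (of_int (lead_coeff (int_min_poly x))) (\<Prod>y\<in>conjugates x. [:- y, 1:])"
proof -
  define P :: "complex poly" where "P = map_poly of_int (int_min_poly x)"
  have "P = Polynomial.smult (lead_coeff P) (\<Prod>z | poly P z = 0. [:- z, 1:] ^ order z P)"
    using complex_poly_decompose[of P] by simp
  also have "(\<Prod>z | poly P z = 0. [:- z, 1:] ^ order z P) = (\<Prod>z\<in>conjugates x. [:- z, 1:])"
    using rsquarefree_int_min_poly[OF assms]
    by (intro prod.cong) (auto simp: conjugates_def P_def)
  finally show ?thesis by (simp add: P_def degree_map_poly coeff_map_poly)
qed

lemma card_conjugates: "algebraic x \<Longrightarrow> card (conjugates x) = degree (int_min_poly x)"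
proof -
  assume x: "algebraic x"
  have "degree (\<Prod>y\<in>conjugates x. [:- y, 1:]) = card (conjugates x)"
    by (subst degree_prod_eq_sum_degree) auto
  moreover have "degree (int_min_poly x) = degree (map_poly of_int (int_min_poly x) :: complex poly)"
    by (simp add: degree_map_poly)
  ultimately show ?thesis
    using lead_coeff_int_min_poly[OF x] int_min_poly_nonzero[OF x] by (simp add: int_min_poly_eq_prod[OF x])
qed

lemma weil_height_eq:
  assumes "algebraic x"
  shows "card (conjugates x) * weil_height x =
    ln (of_int (lead_coeff (int_min_poly x))) + (\<Sum>y\<in>conjugates x. ln (max 1 (cmod y)))"
proof -
  have "degree (int_min_poly x) \<noteq> 0"
    using card_conjugates[OF assms] card_gt_0_iff[of "conjugates x"] self_in_conjugates[OF assms]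
      finite_conjugates[OF assms] by auto
  then show ?thesis
    using lead_coeff_int_min_poly[OF assms]
    by (simp add: card_conjugates[OF assms] weil_height_def Let_def flip: conjugates_def)
qed

lemma weil_height_conjugate:
  "algebraic x \<Longrightarrow> y \<in> conjugates x \<Longrightarrow> weil_height y = weil_height x"
  unfolding weil_height_def[of y] weil_height_def[of x] by (subst int_min_poly_conjugate) auto

lemma polys_over_RatsI: "P \<in> polys_over \<int> \<Longrightarrow> P \<in> polys_over \<rat>"
  by (rule polys_over_mono[of \<int>]) (auto elim!: Ints_cases)

lemmas is_subring_Rats = is_subfield_imp_subring[OF is_subfield_Rats]

subsection \<open>Conjugates and symmetric functions\<close>

lemma prod_conjugates_over_Rats:
  assumes "algebraic x"
  shows "(\<Prod>y\<in>conjugates x. [:- y, 1:]) \<in> polys_over \<rat>"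
proof -
  define c :: complex where "c = of_int (lead_coeff (int_min_poly x))"
  have "c \<noteq> 0" using int_min_poly_nonzero[OF assms] by (simp add: c_def)
  then have "(\<Prod>y\<in>conjugates x. [:- y, 1:]) = Polynomial.smult (1 / c) (map_poly of_int (int_min_poly x))"
    by (simp add: int_min_poly_eq_prod[OF assms] c_def)
  also have "\<dots> \<in> polys_over \<rat>"
    by (intro polys_over_smult is_subring_Rats polys_over_RatsI polys_over_map_of_int) (simp add: c_def)
  finally show ?thesis .
qed

lemma sum_poly_conjugates_Rats:
  assumes "algebraic x" "A \<in> polys_over \<rat>"
  shows "(\<Sum>y\<in>conjugates x. poly A y) \<in> \<rat>"
proof -
  have "(\<Sum>y\<in>conjugates x. poly A y) = (\<Sum>i\<le>degree A. coeff A i * (\<Sum>y\<in>conjugates x. y ^ i))"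
    unfolding poly_altdef sum_distrib_left by (rule sum.swap)
  also have "\<dots> \<in> \<rat>"
  proof -
    have "(\<Sum>y\<in>conjugates x. y ^ k) \<in> \<rat>" for k
      using prod_conjugates_over_Rats[OF assms(1)]
        prod_roots_over_subfield_iff[OF is_subfield_Rats finite_conjugates[OF assms(1)], of "\<lambda>y. y"]
      by simp
    then show ?thesis using polys_overD[OF assms(2)]
      by (intro subring_sum[where I = "{..degree A}"] subring_mult is_subring_Rats) auto
  qed
  finally show ?thesis .
qed

lemma prod_poly_conjugates_over_Rats:
  assumes "algebraic x" "A \<in> polys_over \<rat>"
  shows "(\<Prod>y\<in>conjugates x. [:- poly A y, 1:]) \<in> polys_over \<rat>"
  using sum_poly_conjugates_Rats[OF assms(1) polys_over_power[OF is_subring_Rats assms(2)]]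
  by (simp add: prod_roots_over_subfield_iff is_subfield_Rats finite_conjugates assms)

lemma prod_poly_conjugates_Rats:
  assumes "algebraic x" "A \<in> polys_over \<rat>"
  shows "(\<Prod>y\<in>conjugates x. poly A y) \<in> \<rat>"
proof -
  have "(\<Prod>y\<in>conjugates x. [:- poly (- A) y, 1:]) \<in> polys_over \<rat>"
    using assms by (intro prod_poly_conjugates_over_Rats polys_over_uminus is_subring_Rats)
  from poly_in_subring[OF is_subring_Rats this, of 0] show ?thesis
    by (simp add: poly_prod)
qed

lemma algebraic_root_of_rat_poly:
  "P \<in> polys_over \<rat> \<Longrightarrow> P \<noteq> 0 \<Longrightarrow> poly P x = 0 \<Longrightarrow> algebraic x"
  by (auto simp: algebraic_altdef polys_over_def)

text \<open>Rational power sums make the product of the \<open>X - r i\<close> rational. Sums and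
  products of algebraic numbers are obtained from this without resultants, since power sums over
  pairs of conjugates expand into products of power sums.\<close>

lemma algebraic_root_family:
  fixes r :: "'a \<Rightarrow> complex"
  assumes "finite I" "\<And>k. (\<Sum>i\<in>I. r i ^ k) \<in> \<rat>" "i \<in> I"
  shows "algebraic (r i)"
proof (rule algebraic_root_of_rat_poly)
  show "(\<Prod>i\<in>I. [:- r i, 1:]) \<in> polys_over \<rat>"
    using assms by (simp add: prod_roots_over_subfield_iff is_subfield_Rats)
qed (use assms in \<open>auto simp: poly_prod\<close>)

lemma algebraic_poly:
  assumes "algebraic x" "A \<in> polys_over \<rat>"
  shows "algebraic (poly A x)"
proof (rule algebraic_root_family[of "conjugates x" "poly A"])
  show "(\<Sum>y\<in>conjugates x. poly A y ^ k) \<in> \<rat>" for k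
    using sum_poly_conjugates_Rats[OF assms(1) polys_over_power[OF is_subring_Rats assms(2)]]
    by simp
qed (simp_all add: finite_conjugates self_in_conjugates assms)

lemma sum_power_conjugates_Rats: "algebraic x \<Longrightarrow> (\<Sum>y\<in>conjugates x. y ^ k) \<in> \<rat>"
  using sum_poly_conjugates_Rats[of x "Polynomial.monom 1 k"] polys_over_monom[OF is_subring_Rats]
  by (simp add: poly_monom)

lemma algebraic_add:
  assumes "algebraic x" "algebraic (y :: complex)"
  shows "algebraic (x + y)"
proof -
  have "(\<Sum>i\<in>conjugates x \<times> conjugates y. (fst i + snd i) ^ k) \<in> \<rat>" for k
  proof -
    have "(\<Sum>i\<in>conjugates x \<times> conjugates y. (fst i + snd i) ^ k) =
      (\<Sum>a\<in>conjugates x. \<Sum>b\<in>conjugates y. (a + b) ^ k)"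
      by (simp add: sum.cartesian_product case_prod_beta)
    also have "\<dots> = (\<Sum>a\<in>conjugates x. \<Sum>b\<in>conjugates y. \<Sum>j\<le>k. of_nat (k choose j) * a ^ j * b ^ (k - j))"
      by (simp add: binomial_ring)
    also have "\<dots> = (\<Sum>a\<in>conjugates x. \<Sum>j\<le>k. \<Sum>b\<in>conjugates y. of_nat (k choose j) * a ^ j * b ^ (k - j))"
      by (intro sum.cong refl sum.swap)
    also have "\<dots> = (\<Sum>j\<le>k. \<Sum>a\<in>conjugates x. \<Sum>b\<in>conjugates y. of_nat (k choose j) * a ^ j * b ^ (k - j))"
      by (rule sum.swap)
    also have "\<dots> = (\<Sum>j\<le>k. of_nat (k choose j) * (\<Sum>a\<in>conjugates x. a ^ j) * (\<Sum>b\<in>conjugates y. b ^ (k - j)))"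
      by (intro sum.cong refl) (simp add: sum_distrib_left sum_distrib_right mult_ac)
    also have "\<dots> \<in> \<rat>"
      using assms by (intro subring_intros is_subring_Rats sum_power_conjugates_Rats)
    finally show ?thesis .
  qed
  from algebraic_root_family[OF _ this, of "(x, y)"] show ?thesis
    using assms by (simp add: self_in_conjugates finite_conjugates)
qed

lemma algebraic_mult:
  assumes "algebraic x" "algebraic (y :: complex)"
  shows "algebraic (x * y)"
proof -
  have "(\<Sum>i\<in>conjugates x \<times> conjugates y. (fst i * snd i) ^ k) \<in> \<rat>" for k
  proof -
    have "(\<Sum>i\<in>conjugates x \<times> conjugates y. (fst i * snd i) ^ k) =
      (\<Sum>a\<in>conjugates x. a ^ k) * (\<Sum>b\<in>conjugates y. b ^ k)"
      by (simp add: sum_product sum.cartesian_product power_mult_distrib case_prod_beta)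
    then show ?thesis using assms by (simp add: sum_power_conjugates_Rats)
  qed
  from algebraic_root_family[OF _ this, of "(x, y)"] show ?thesis
    using assms by (simp add: self_in_conjugates finite_conjugates)
qed

lemma algebraic_of_rat: "x \<in> \<rat> \<Longrightarrow> algebraic (x :: complex)"
  by (rule algebraic_root_of_rat_poly[of "[:- x, 1:]"])
     (auto intro!: polys_over_pCons polys_over_zero is_subring_Rats)

lemma is_subring_algebraic: "is_subring {x. algebraic x}"
proof -
  have "algebraic (x - y)" if "algebraic x" "algebraic y" for x y :: complex
    using algebraic_add[OF that(1) algebraic_mult[OF algebraic_of_rat[of "-1"] that(2)]] by simp
  then show ?thesis by (auto simp: is_subring_def algebraic_mult algebraic_of_rat)
qed

lemma coeff_0_int_min_poly:
  assumes x: "algebraic x" "x \<noteq> 0" and f: "int_min_poly x = pCons c g"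
  shows "c \<noteq> 0"
proof
  assume c: "c = 0"
  then have "g \<noteq> 0" using int_min_poly_nonzero[OF x(1)] f by auto
  have "poly (map_poly of_int g) x = 0"
    using poly_int_min_poly[OF x(1)] x(2) c by (simp add: f map_poly_pCons)
  then have "pCons c g dvd g"
    using irreducible_int_poly_dvd[OF irreducible_int_min_poly[OF x(1)] poly_int_min_poly[OF x(1)]]
    by (simp add: f)
  then show False using dvd_imp_degree_le[of "pCons c g" g] \<open>g \<noteq> 0\<close> by simp
qed

text \<open>With the minimal polynomial written as \<open>c + X g\<close> and
  \<open>c \<noteq> 0\<close>, the inverse is \<open>- g(x) / c\<close>. For \<open>x = 0\<close>
  the convention \<open>inverse 0 = 0\<close> makes the zero polynomial a witness.\<close>

lemma algebraic_inverse_poly: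
  assumes "algebraic (x :: complex)"
  obtains B where "B \<in> polys_over \<rat>" "inverse x = poly B x"
proof -
  obtain c g where f: "int_min_poly x = pCons c g" by (cases "int_min_poly x") auto
  define c' :: complex where "c' = of_int c"
  have root: "c' + x * poly (map_poly of_int g) x = 0"
    using poly_int_min_poly[OF assms] by (simp add: f map_poly_pCons c'_def)
  show ?thesis
  proof (cases "x = 0")
    case True
    then show ?thesis using that[of 0] polys_over_zero[OF is_subring_Rats] by simp
  next
    case False
    have "c \<noteq> 0" by (rule coeff_0_int_min_poly[OF assms False f])
    define B where "B = Polynomial.smult (- 1 / c') (map_poly of_int g)"
    have "B \<in> polys_over \<rat>" unfolding B_def
      by (intro polys_over_smult is_subring_Rats polys_over_RatsI polys_over_map_of_int) (simp add: c'_def)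
    moreover have "x * poly (map_poly of_int g) x = - c'"
      using root by (simp add: add_eq_0_iff2 add.commute)
    then have "x * poly B x = 1" using \<open>c \<noteq> 0\<close> by (simp add: B_def c'_def field_simps)
    then have "inverse x = poly B x" using False by (simp add: field_simps)
    ultimately show ?thesis using that by blast
  qed
qed

subsection \<open>Simple extensions\<close>

definition simple_ext :: "complex set \<Rightarrow> complex \<Rightarrow> complex set" where
  "simple_ext K x = (\<lambda>P. poly P x) ` polys_over K"

lemma is_subring_simple_ext:
  assumes "is_subring K"
  shows "is_subring (simple_ext K x)"
  unfolding is_subring_def
proof (intro conjI ballI)
  have "poly 1 x \<in> simple_ext K x" using polys_over_one[OF assms] unfolding simple_ext_def by blast
  then show "1 \<in> simple_ext K x" by simp
next
  fix a b assume "a \<in> simple_ext K x" "b \<in> simple_ext K x"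
  then obtain A B where "A \<in> polys_over K" "a = poly A x" "B \<in> polys_over K" "b = poly B x"
    by (auto simp: simple_ext_def)
  then show "a - b \<in> simple_ext K x" "a * b \<in> simple_ext K x"
    using polys_over_diff[OF assms, of A B] polys_over_mult[OF assms, of A B] unfolding simple_ext_def
    by (metis imageI poly_diff, metis imageI poly_mult)
qed

lemma simple_ext_base: "is_subring K \<Longrightarrow> a \<in> K \<Longrightarrow> a \<in> simple_ext K x"
  using polys_over_const[of K a] unfolding simple_ext_def by force

lemma simple_ext_gen: "is_subring K \<Longrightarrow> x \<in> simple_ext K x"
  unfolding simple_ext_def
  by (rule image_eqI[of _ _ "[:0, 1:]"]) (auto intro!: polys_over_intros subring_intros)

lemma simple_ext_minimal:
  "is_subring R \<Longrightarrow> K \<subseteq> R \<Longrightarrow> x \<in> R \<Longrightarrow> simple_ext K x \<subseteq> R"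
  unfolding simple_ext_def using poly_in_subring polys_over_mono by blast

lemma is_subfield_simple_ext:
  assumes K: "is_subfield K" and alg: "\<And>a. a \<in> K \<Longrightarrow> algebraic a" and x: "algebraic x"
  shows "is_subfield (simple_ext K x)"
proof -
  have R: "is_subring (simple_ext K x)" using K by (intro is_subring_simple_ext) auto
  have "inverse a \<in> simple_ext K x" if a: "a \<in> simple_ext K x" for a
  proof -
    have "simple_ext K x \<subseteq> {x. algebraic x}"
      using alg x by (intro simple_ext_minimal is_subring_algebraic) auto
    then obtain B where B: "B \<in> polys_over \<rat>" "inverse a = poly B a"
      using algebraic_inverse_poly a by blast
    have "\<rat> \<subseteq> simple_ext K x" using K subfield_Rats[OF K] simple_ext_base by blast
    then show ?thesis using B poly_in_subring[OF R polys_over_mono _] a by metis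
  qed
  with R show ?thesis by (simp add: is_subfield_def)
qed

text \<open>Long division by a monic polynomial never divides coefficients, so it stays inside any
  subring.\<close>

lemma poly_division_over:
  assumes K: "is_subring K" and M: "M \<in> polys_over K" "lead_coeff M = 1" and P: "P \<in> polys_over K"
  obtains Q R where "Q \<in> polys_over K" "R \<in> polys_over K" "P = M * Q + R" "R = 0 \<or> degree R < degree M"
proof -
  have "\<exists>Q R. Q \<in> polys_over K \<and> R \<in> polys_over K \<and> P = M * Q + R \<and> (R = 0 \<or> degree R < degree M)"
    using P
  proof (induction "degree P" arbitrary: P rule: less_induct)
    case less
    show ?case
    proof (cases "P = 0 \<or> degree P < degree M")
      case True
      then show ?thesis using less.prems polys_over_zero[OF K] by (intro exI[of _ 0] exI[of _ P]) auto
    next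
      case False
      then have deg: "degree M \<le> degree P" "P \<noteq> 0" by auto
      define T where "T = Polynomial.monom (lead_coeff P) (degree P - degree M)"
      have T: "T \<in> polys_over K"
        unfolding T_def using less.prems by (intro polys_over_monom K polys_overD)
      define P' where "P' = P - M * T"
      have P': "P' \<in> polys_over K"
        unfolding P'_def using less.prems M T K by (intro polys_over_intros)
      have degMT: "degree (M * T) = degree P"
        using M(2) deg by (subst degree_mult_eq) (auto simp: T_def degree_monom_eq)
      have "coeff (M * T) (degree P) = lead_coeff P"
      proof -
        have "lead_coeff T = lead_coeff P" using deg by (simp add: T_def degree_monom_eq)
        then show ?thesis using M(2) degMT lead_coeff_mult[of M T] by simp
      qed
      then have "coeff P' (degree P) = 0" by (simp add: P'_def)
      moreover have "degree P' \<le> degree P"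
        unfolding P'_def using degMT by (intro degree_diff_le) auto
      ultimately have "P' = 0 \<or> degree P' < degree P"
        by (metis le_neq_implies_less leading_coeff_0_iff)
      then obtain Q R where QR: "Q \<in> polys_over K" "R \<in> polys_over K" "P' = M * Q + R"
        "R = 0 \<or> degree R < degree M"
        using less.hyps[OF _ P'] polys_over_zero[OF K] by (metis add.right_neutral mult_zero_right)
      then have "P = M * (Q + T) + R" by (simp add: P'_def algebra_simps)
      then show ?thesis using QR T polys_over_add[OF K] by blast
    qed
  qed
  then show ?thesis using that by blast
qed

text \<open>The classical argument: for all but finitely many \<open>c\<close>, the number \<open>y\<close> is the only common root of
  its minimal polynomial and of \<open>f (z - c X)\<close>, where \<open>z = x + c y\<close> and \<open>f\<close> is the minimal polynomial of
  \<open>x\<close>. So the minimal polynomial of \<open>y\<close> over \<open>\<rat>(z)\<close> is linear.\<close>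
lemma primitive_element:
  assumes x: "algebraic x" and y: "algebraic y"
  obtains z where "algebraic z" "x \<in> simple_ext \<rat> z" "y \<in> simple_ext \<rat> z"
proof -
  \<comment> \<open>The values of \<open>c\<close> for which some other conjugates satisfy
    \<open>a + c b = x + c y\<close>. Pairs with \<open>b = y\<close> contribute 0 by the convention
    on division, which merely excludes one more value.\<close>
  define bad where "bad = (\<lambda>(a, b). (x - a) / (b - y)) ` (conjugates x \<times> conjugates y)"
  have "finite bad" by (simp add: bad_def finite_conjugates x y)
  moreover have "infinite (range (of_nat :: nat \<Rightarrow> complex))"
    by (intro range_inj_infinite) (simp add: inj_on_def)
  ultimately obtain n where n: "complex_of_nat n \<notin> bad" by (metis finite_subset rangeE subsetI)
  define c where "c = complex_of_nat n"
  define z where "z = x + c * y"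
  define K where "K = simple_ext \<rat> z"
  have z: "algebraic z" unfolding z_def c_def
    using algebraic_add[OF x algebraic_mult[OF algebraic_of_rat y]] by simp
  have K: "is_subfield K" unfolding K_def
    using z is_subfield_simple_ext[OF is_subfield_Rats algebraic_of_rat] by blast
  then have KR: "is_subring K" by auto
  have "z \<in> K" unfolding K_def by (intro simple_ext_gen is_subring_Rats)
  have QK: "\<rat> \<subseteq> K" using subfield_Rats[OF K] by blast
  define P1 :: "complex poly" where "P1 = map_poly of_int (int_min_poly y)"
  define P2 :: "complex poly" where "P2 = map_poly of_int (int_min_poly x) \<circ>\<^sub>p [:z, - c:]"
  have P1: "P1 \<in> polys_over K" "poly P1 y = 0"
    using poly_int_min_poly[OF y] polys_over_mono[OF QK polys_over_RatsI[OF polys_over_map_of_int]]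
    by (simp_all add: P1_def)
  have P2: "P2 \<in> polys_over K" "poly P2 y = 0"
  proof -
    show "P2 \<in> polys_over K" unfolding P2_def c_def
      by (intro polys_over_intros KR subring_intros \<open>z \<in> K\<close>
          polys_over_mono[OF QK polys_over_RatsI[OF polys_over_map_of_int]])
    show "poly P2 y = 0"
      using poly_int_min_poly[OF x] by (simp add: P2_def poly_pcompose z_def mult.commute)
  qed
  have common: "b = y" if "poly P1 b = 0" "poly P2 b = 0" for b
  proof (rule ccontr)
    assume "b \<noteq> y"
    define a where "a = z - c * b"
    have "b \<in> conjugates y" "a \<in> conjugates x"
      using that by (auto simp: P1_def P2_def conjugates_def poly_pcompose a_def mult.commute)
    moreover have "c = (x - a) / (b - y)"
      using \<open>b \<noteq> y\<close> by (simp add: a_def z_def field_simps)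
    ultimately have "c \<in> bad" by (auto simp: bad_def)
    then show False using n by (simp add: c_def)
  qed
  define S where "S = {M \<in> polys_over K. lead_coeff M = 1 \<and> poly M y = 0}"
  have normalise: "Polynomial.smult (1 / lead_coeff R) R \<in> S"
    if "R \<in> polys_over K" "R \<noteq> 0" "poly R y = 0" for R
    using that by (auto simp: S_def intro!: polys_over_intros KR subfield_divide K subring_intros polys_overD)
  have "P1 \<noteq> 0" using int_min_poly_nonzero[OF y] by (simp add: P1_def map_poly_eq_0_iff)
  with normalise P1 have "S \<noteq> {}" by blast
  then obtain M where M: "M \<in> S" and M_min: "\<And>N. N \<in> S \<Longrightarrow> degree M \<le> degree N"
    using ex_has_least_nat[of "\<lambda>M. M \<in> S" _ degree] by blast
  have dvd: "M dvd P" if P: "P \<in> polys_over K" "poly P y = 0" for P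
  proof -
    have "M \<in> polys_over K" "lead_coeff M = 1" using M by (auto simp: S_def)
    from poly_division_over[OF KR this P(1)]
    obtain Q R where QR: "R \<in> polys_over K" "P = M * Q + R" "R = 0 \<or> degree R < degree M"
      by metis
    have "poly R y = 0" using QR(2) P M by (auto simp: S_def)
    have "R = 0"
    proof (rule ccontr)
      assume "R \<noteq> 0"
      then show False
        using normalise[OF QR(1) _ \<open>poly R y = 0\<close>] M_min QR(3) by fastforce
    qed
    then show ?thesis using QR by simp
  qed
  have roots: "{w. poly M w = 0} = {y}"
    using dvd[OF P1] dvd[OF P2] common M by (auto simp: S_def dvd_def)
  have "order y M \<le> order y P1"
    using dvd[OF P1] \<open>P1 \<noteq> 0\<close> by (intro dvd_imp_order_le)
  also have "\<dots> = 1"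
    unfolding P1_def by (rule rsquarefree_int_min_poly[OF y self_in_conjugates[OF y]])
  finally have "order y M \<le> 1" .
  moreover have "order y M \<noteq> 0" using M order_root[of M y] by (auto simp: S_def)
  ultimately have "order y M = 1" by simp
  then have "M = [:- y, 1:]"
    using complex_poly_decompose[of M] roots M by (simp add: S_def)
  then have "- y \<in> K" using M polys_overD[of M K 0] by (simp add: S_def)
  then have "y \<in> K" using subring_uminus[OF KR] by force
  moreover have "x \<in> K"
  proof -
    have "z - c * y \<in> K" unfolding c_def using \<open>z \<in> K\<close> \<open>y \<in> K\<close> KR by (intro subring_intros)
    then show ?thesis by (simp add: z_def)
  qed
  ultimately show ?thesis using that z by (simp add: K_def)
qed

lemma primitive_element_finite:
  assumes "finite S" "\<And>x. x \<in> S \<Longrightarrow> algebraic x"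
  obtains z where "algebraic z" "S \<subseteq> simple_ext \<rat> z"
proof -
  have "\<exists>z. algebraic z \<and> S \<subseteq> simple_ext \<rat> z"
    using assms
  proof (induction S rule: finite_induct)
    case empty
    show ?case using algebraic_of_rat[of 0] by auto
  next
    case (insert x S)
    then obtain z where z: "algebraic z" "S \<subseteq> simple_ext \<rat> z" by auto
    obtain w where w: "algebraic w" "x \<in> simple_ext \<rat> w" "z \<in> simple_ext \<rat> w"
      using primitive_element[of x z] z insert.prems by auto
    have "simple_ext \<rat> z \<subseteq> simple_ext \<rat> w"
      using w simple_ext_base[OF is_subring_Rats]
      by (intro simple_ext_minimal is_subring_simple_ext is_subring_Rats) auto
    then show ?case using w z by blast
  qed
  then show ?thesis using that by blast
qed

subsection \<open>Valuation rings of the complex numbers above a prime\<close>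

text \<open>No value group is constructed: integrality is membership in \<open>V\<close>, and
  divisibility by \<open>c\<close> is membership of a quotient by \<open>c\<close>. Maximality is
  what Zorn's lemma delivers; the dichotomy of valuation rings is derived from it in
  \<open>val_ring_inverse\<close>.\<close>

definition val_ring :: "nat \<Rightarrow> complex set \<Rightarrow> bool" where
  "val_ring l V \<longleftrightarrow> Factorial_Ring.prime l \<and> is_subring V \<and> inverse (of_nat l) \<notin> V \<and>
     (\<forall>R. is_subring R \<and> V \<subseteq> R \<and> inverse (of_nat l) \<notin> R \<longrightarrow> R = V)"

definition val_unit :: "complex set \<Rightarrow> complex \<Rightarrow> bool" where
  "val_unit V x \<longleftrightarrow> x \<noteq> 0 \<and> x \<in> V \<and> inverse x \<in> V"

text \<open>A number whose absolute value at the place of \<open>V\<close> is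
  \<open>1 / max(1, |x|)\<close>, that is, the inverse of the local height factor.\<close>

definition val_den :: "complex set \<Rightarrow> complex \<Rightarrow> complex" where
  "val_den V x = (if x \<in> V then 1 else inverse x)"

lemma val_ring_exists:
  assumes "Factorial_Ring.prime l"
  obtains V where "val_ring l V"
proof -
  define cand where "cand = {R. is_subring R \<and> inverse (complex_of_nat l) \<notin> R}"
  have "\<exists>M\<in>cand. \<forall>N\<in>cand. M \<subseteq> N \<longrightarrow> N = M"
  proof (rule subset_Zorn_nonempty)
    have "inverse (complex_of_nat l) \<notin> \<int>"
    proof
      assume "inverse (complex_of_nat l) \<in> \<int>"
      then obtain k where k: "inverse (complex_of_nat l) = of_int k" by (auto elim: Ints_cases)
      then have "complex_of_int (int l * k) = of_int 1"
        using prime_gt_0_nat[OF assms] by (simp flip: k)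
      then have "int l * k = 1" by (simp only: of_int_eq_iff)
      then have "int l dvd 1" by (metis dvd_triv_left)
      then show False using prime_gt_1_nat[OF assms] by simp
    qed
    then show "cand \<noteq> {}" unfolding cand_def using is_subring_Ints by blast
  next
    fix C assume C: "C \<noteq> {}" "subset.chain cand C"
    have sub: "is_subring R \<and> inverse (of_nat l) \<notin> R" if "R \<in> C" for R
      using that C(2) by (auto simp: cand_def subset_chain_def)
    have "is_subring (\<Union>C)"
      unfolding is_subring_def
    proof (intro conjI ballI)
      show "1 \<in> \<Union>C" using C(1) sub subring_one by blast
      fix x y assume "x \<in> \<Union>C" "y \<in> \<Union>C"
      then obtain R where R: "R \<in> C" "x \<in> R" "y \<in> R"
        using C(2) unfolding subset_chain_def by blast
      then show "x - y \<in> \<Union>C" "x * y \<in> \<Union>C" using sub subring_diff subring_mult by blast+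
    qed
    then show "\<Union>C \<in> cand" using sub by (auto simp: cand_def)
  qed
  then show ?thesis using that assms by (auto simp: cand_def val_ring_def)
qed

lemma val_unitD: "val_unit V x \<Longrightarrow> x \<in> V" "val_unit V x \<Longrightarrow> inverse x \<in> V" "val_unit V x \<Longrightarrow> x \<noteq> 0"
  by (auto simp: val_unit_def)

lemma val_unit_inverse: "val_unit V x \<Longrightarrow> val_unit V (inverse x)"
  by (auto simp: val_unit_def)

lemma prod_const_poly: "(\<Prod>i\<in>I. [:f i :: complex:]) = [:prod f I:]"
  by (induction I rule: infinite_finite_induct) (auto simp: one_pCons mult.commute)

lemma reverse_poly_in_subring:
  assumes R: "is_subring R" and x: "x \<in> R" "x \<noteq> 0" and P: "P \<in> polys_over R" "degree P \<le> n"
  shows "x ^ n * poly P (inverse x) \<in> R"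
proof -
  have "x ^ n * poly P (inverse x) = (\<Sum>i\<le>degree P. coeff P i * x ^ (n - i))"
    unfolding poly_altdef sum_distrib_left
  proof (intro sum.cong refl)
    fix i assume "i \<in> {..degree P}"
    then have "x ^ n = x ^ (n - i) * x ^ i" using P(2) by (simp flip: power_add)
    then show "x ^ n * (coeff P i * inverse x ^ i) = coeff P i * x ^ (n - i)"
      using x(2) by (simp add: power_inverse)
  qed
  also have "\<dots> \<in> R" using polys_overD[OF P(1)] x R
    by (intro subring_sum[where I = "{..degree P}"] subring_mult subring_power) auto
  finally show ?thesis .
qed

section \<open>Maximal subrings without 1/l are valuation rings\<close>

context
  fixes l V assumes V: "val_ring l V"
begin

lemma val_ring_prime: "Factorial_Ring.prime l"
  and val_ring_subring: "is_subring V"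
  and val_ring_inverse_prime: "inverse (of_nat l) \<notin> V"
  using V by (auto simp: val_ring_def)

lemma val_ring_maximal: "is_subring R \<Longrightarrow> V \<subseteq> R \<Longrightarrow> inverse (of_nat l) \<notin> R \<Longrightarrow> R = V"
  using V by (auto simp: val_ring_def)

lemma val_ring_prime_nonzero: "of_nat l \<noteq> (0 :: complex)"
  using prime_gt_0_nat[OF val_ring_prime] by simp

lemma prime_mult_in_val_ring: "a \<in> V \<Longrightarrow> of_nat l * a \<noteq> 1"
  using val_ring_inverse_prime by (metis inverse_unique)

lemma simple_ext_val_ring:
  assumes "x \<notin> V"
  obtains P where "P \<in> polys_over V" "of_nat l * poly P x = 1"
proof -
  have "inverse (of_nat l) \<in> simple_ext V x"
    using val_ring_maximal[OF is_subring_simple_ext[OF val_ring_subring, of x]]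
      simple_ext_base[OF val_ring_subring] simple_ext_gen[OF val_ring_subring] assms by blast
  then obtain P where "P \<in> polys_over V" "inverse (of_nat l) = poly P x"
    by (auto simp: simple_ext_def)
  then show ?thesis using that val_ring_prime_nonzero by (metis right_inverse)
qed

text \<open>Were \<open>1/u\<close> outside \<open>V\<close>, maximality would give
  \<open>l P(1/u) = 1\<close>. Multiplied by a power of \<open>u\<close>, which is congruent to 1
  modulo \<open>l\<close>, this becomes \<open>l (r + s) = 1\<close> with \<open>r + s\<close> in
  \<open>V\<close>, which is impossible.\<close>

lemma val_unit_one_minus:
  assumes a: "a \<in> V"
  shows "val_unit V (1 - of_nat l * a)"
proof -
  define u where "u = 1 - of_nat l * a"
  have R: "is_subring V" by (rule val_ring_subring)
  have u: "u \<in> V" unfolding u_def using a R by (intro subring_intros)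
  have u0: "u \<noteq> 0" using prime_mult_in_val_ring[OF a] by (auto simp: u_def)
  have "inverse u \<in> V"
  proof (rule ccontr)
    assume "inverse u \<notin> V"
    then obtain P where P: "P \<in> polys_over V" "of_nat l * poly P (inverse u) = 1"
      by (rule simple_ext_val_ring)
    define r where "r = u ^ degree P * poly P (inverse u)"
    have r: "r \<in> V" unfolding r_def using P u u0 R by (intro reverse_poly_in_subring) auto
    have "\<exists>s\<in>V. u ^ n = 1 - of_nat l * s" for n
    proof (induction n)
      case 0
      show ?case using subring_zero[OF R] by (intro bexI[of _ 0]) auto
    next
      case (Suc n)
      then obtain s where s: "s \<in> V" "u ^ n = 1 - of_nat l * s" by blast
      have "a + s - of_nat l * a * s \<in> V" using s a R by (intro subring_intros)
      moreover have "u ^ Suc n = 1 - of_nat l * (a + s - of_nat l * a * s)"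
        unfolding power_Suc s(2) by (simp add: u_def algebra_simps)
      ultimately show ?case by blast
    qed
    then obtain s where s: "s \<in> V" "u ^ degree P = 1 - of_nat l * s" by blast
    have "of_nat l * r = u ^ degree P * (of_nat l * poly P (inverse u))" by (simp add: r_def)
    then have "of_nat l * (r + s) = 1" using P(2) s(2) by (simp add: algebra_simps)
    moreover have "r + s \<in> V" using r s R by (intro subring_intros)
    ultimately show False using prime_mult_in_val_ring by blast
  qed
  then show ?thesis using u u0 by (simp add: val_unit_def u_def)
qed

text \<open>The degree reduction of Chevalley's extension argument. If \<open>q\<^sub>0\<close> is
  the constant coefficient of \<open>Q\<close>, then \<open>u = 1 - l q\<^sub>0\<close> is a unit.
  Solving the relation for \<open>1/x\<close> and multiplying by \<open>x^n\<close> writes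
  \<open>x^n\<close> as \<open>l S(x)\<close> with \<open>S\<close> of lower degree, and this
  replaces the top term of \<open>P\<close>.\<close>

lemma val_ring_reduce_degree:
  assumes x: "x \<noteq> 0" and P: "P \<in> polys_over V" "of_nat l * poly P x = 1"
    and Q: "Q \<in> polys_over V" "of_nat l * poly Q (inverse x) = 1" and deg: "degree Q \<le> degree P"
  obtains P' where "P' \<in> polys_over V" "of_nat l * poly P' x = 1" "degree P' < degree P"
proof -
  have R: "is_subring V" by (rule val_ring_subring)
  define n where "n = degree P"
  have n: "n > 0"
  proof (rule ccontr)
    assume "\<not> n > 0"
    then obtain c where "P = [:c:]" unfolding n_def by (auto elim: degree_eq_zeroE)
    then show False using P polys_overD[OF P(1), of 0] prime_mult_in_val_ring by auto
  qed
  define u where "u = 1 - of_nat l * coeff Q 0"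
  have u: "val_unit V u" unfolding u_def by (intro val_unit_one_minus polys_overD Q)
  \<comment> \<open>The assumption \<open>degree Q \<le> degree P\<close> keeps the exponents
    \<open>n - j\<close> free of truncation.\<close>
  define S where "S = (\<Sum>j\<in>{1..degree Q}. Polynomial.monom (coeff Q j / u) (n - j))"
  have S: "S \<in> polys_over V" unfolding S_def divide_inverse using val_unitD[OF u] Q R
    by (intro polys_over_sum polys_over_monom subring_mult polys_overD)
  have degS: "degree S \<le> n - 1"
    unfolding S_def by (intro degree_sum_le) (auto intro: order.trans[OF degree_monom_le])
  have polyS: "of_nat l * poly S x = x ^ n"
  proof -
    have pow: "x ^ (n - j) = x ^ n * inverse x ^ j" if "j \<le> degree Q" for j
      using that deg x by (simp add: power_diff n_def divide_inverse power_inverse)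
    have "poly S x = (\<Sum>j\<in>{1..degree Q}. coeff Q j / u * (x ^ n * inverse x ^ j))"
      by (simp add: S_def poly_sum poly_monom pow)
    also have "\<dots> = x ^ n / u * (\<Sum>j\<in>{1..degree Q}. coeff Q j * inverse x ^ j)"
      by (simp add: sum_distrib_left field_simps)
    also have "(\<Sum>j\<in>{1..degree Q}. coeff Q j * inverse x ^ j) = poly Q (inverse x) - coeff Q 0"
      by (simp add: poly_altdef atMost_atLeast0 sum.atLeast_Suc_atMost)
    finally have pS: "poly S x = x ^ n / u * (poly Q (inverse x) - coeff Q 0)" .
    have "of_nat l * poly S x = x ^ n / u * (of_nat l * poly Q (inverse x) - of_nat l * coeff Q 0)"
      by (simp only: pS right_diff_distrib mult.assoc mult.left_commute mult.commute)
    then show ?thesis using Q(2) val_unitD(3)[OF u] by (simp add: u_def)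
  qed
  define P' where "P' = P - Polynomial.monom (coeff P n) n + Polynomial.smult (of_nat l * coeff P n) S"
  have "P' \<in> polys_over V"
    unfolding P'_def using P S R by (intro polys_over_intros subring_intros polys_overD)
  moreover have "of_nat l * poly P' x = 1"
  proof -
    have "of_nat l * poly P' x = of_nat l * poly P x + of_nat l * coeff P n * (of_nat l * poly S x - x ^ n)"
      by (simp add: P'_def poly_monom algebra_simps)
    then show ?thesis using P(2) polyS by simp
  qed
  moreover have "degree P' < n"
  proof -
    have "coeff P' i = 0" if "i \<ge> n" for i
    proof (cases "i = n")
      case True
      then show ?thesis using degS n by (simp add: P'_def coeff_eq_0)
    next
      case False
      then show ?thesis using that degS n by (simp add: P'_def coeff_eq_0 n_def)
    qed
    then have "degree P' \<le> n - 1" using n by (intro degree_le) auto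
    then show ?thesis using n by simp
  qed
  ultimately show ?thesis using that by (simp add: n_def)
qed

text \<open>If neither \<open>x\<close> nor \<open>1/x\<close> were in \<open>V\<close>, there would
  be relations \<open>l P(x) = 1\<close> and \<open>l Q(1/x) = 1\<close> of least degree, and the
  one of larger degree could be shortened by means of the other.\<close>

lemma val_ring_inverse:
  assumes "x \<notin> V"
  shows "inverse x \<in> V"
proof (rule ccontr)
  assume inv: "inverse x \<notin> V"
  have x: "x \<noteq> 0" using assms subring_zero[OF val_ring_subring] by auto
  define good where "good = (\<lambda>x P. P \<in> polys_over V \<and> of_nat l * poly P x = 1)"
  obtain P0 where "good x P0"
    using simple_ext_val_ring[OF assms] unfolding good_def by blast
  then obtain P where P: "good x P" "\<And>P'. good x P' \<Longrightarrow> degree P \<le> degree P'"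
    using ex_has_least_nat[of "good x" P0 degree] by blast
  obtain Q0 where "good (inverse x) Q0"
    using simple_ext_val_ring[OF inv] unfolding good_def by blast
  then obtain Q where Q: "good (inverse x) Q" "\<And>Q'. good (inverse x) Q' \<Longrightarrow> degree Q \<le> degree Q'"
    using ex_has_least_nat[of "good (inverse x)" Q0 degree] by blast
  have P': "P \<in> polys_over V" "of_nat l * poly P x = 1"
    and Q': "Q \<in> polys_over V" "of_nat l * poly Q (inverse x) = 1"
    using P(1) Q(1) by (auto simp: good_def)
  show False
  proof (cases "degree Q \<le> degree P")
    case True
    from val_ring_reduce_degree[OF x P' Q' this]
    obtain R where "good x R" "degree R < degree P" unfolding good_def by blast
    then show False using P(2) by fastforce
  next
    case False
    then have deg: "degree P \<le> degree Q" and "inverse x \<noteq> 0" using x by auto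
    from val_ring_reduce_degree[OF this(2) Q' P'(1) _ deg] P'(2)
    obtain R where "good (inverse x) R" "degree R < degree Q" unfolding good_def by auto
    then show False using Q(2) by fastforce
  qed
qed

lemma val_unit_mult: "val_unit V x \<Longrightarrow> val_unit V y \<Longrightarrow> val_unit V (x * y)"
  using subring_mult[OF val_ring_subring] by (auto simp: val_unit_def)

lemma val_unit_factor:
  assumes "x \<in> V" "y \<in> V" "val_unit V (x * y)"
  shows "val_unit V x"
proof -
  have nz: "x \<noteq> 0" "y \<noteq> 0" using val_unitD(3)[OF assms(3)] by auto
  then have "inverse x = y * inverse (x * y)" by simp
  also have "\<dots> \<in> V" by (intro subring_mult val_ring_subring assms(2) val_unitD(2)[OF assms(3)])
  finally show ?thesis using assms(1) nz(1) by (simp add: val_unit_def)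
qed

lemma val_unit_one: "val_unit V 1"
  using subring_one[OF val_ring_subring] by (simp add: val_unit_def)

lemma val_unit_uminus: "val_unit V x \<Longrightarrow> val_unit V (- x)"
  using subring_uminus[OF val_ring_subring] by (auto simp: val_unit_def)

lemma val_unit_prod: "(\<And>i. i \<in> I \<Longrightarrow> val_unit V (f i)) \<Longrightarrow> val_unit V (prod f I)"
  by (induction I rule: infinite_finite_induct) (auto intro: val_unit_one val_unit_mult)

lemma val_unit_power: "val_unit V x \<Longrightarrow> val_unit V (x ^ n)"
  by (induction n) (auto intro: val_unit_one val_unit_mult)

lemma not_val_unit_prime: "\<not> val_unit V (of_nat l)"
  using val_ring_inverse_prime by (simp add: val_unit_def)

lemma not_val_unit_prime_mult: "a \<in> V \<Longrightarrow> \<not> val_unit V (of_nat l * a)"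
  using val_unit_factor subring_of_nat[OF val_ring_subring] not_val_unit_prime by blast

text \<open>Of two nonzero elements one divides the other in \<open>V\<close>, so their sum is a
  multiple of one of these nonunits.\<close>

lemma val_nonunit_add:
  assumes x: "x \<in> V" "\<not> val_unit V x" and y: "y \<in> V" "\<not> val_unit V y"
  shows "\<not> val_unit V (x + y)"
proof
  assume u: "val_unit V (x + y)"
  have R: "is_subring V" by (rule val_ring_subring)
  have *: False if "b \<in> V" "\<not> val_unit V b" "val_unit V (a + b)" "a / b \<in> V" "b \<noteq> 0" for a b
  proof -
    have "a + b = b * (a / b + 1)" using that by (simp add: field_simps)
    moreover have "a / b + 1 \<in> V" using that R by (intro subring_intros)
    ultimately show False using val_unit_factor that by metis
  qed
  show False
  proof (cases "x = 0 \<or> y = 0")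
    case True
    then show ?thesis using u x y by auto
  next
    case False
    then have "x / y \<in> V \<or> y / x \<in> V" using val_ring_inverse[of "x / y"] by auto
    then show ?thesis using *[of y x] *[of x y] u x y False by (auto simp: add.commute)
  qed
qed

lemma val_nonunit_sum:
  assumes "finite I" "\<And>i. i \<in> I \<Longrightarrow> f i \<in> V \<and> \<not> val_unit V (f i)"
  shows "\<not> val_unit V (sum f I)"
  using assms
proof (induction I rule: finite_induct)
  case (insert i I)
  then show ?case
    using val_nonunit_add[of "f i" "sum f I"] subring_sum[OF val_ring_subring, of I f] by auto
qed (simp add: val_unit_def)

text \<open>Bezout's identity gives \<open>v c = 1 - l u\<close>, a unit by
  \<open>val_unit_one_minus\<close>.\<close>

lemma val_unit_of_int:
  assumes "\<not> int l dvd c"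
  shows "val_unit V (of_int c)"
proof -
  have R: "is_subring V" by (rule val_ring_subring)
  have "coprime (int l) c" using assms val_ring_prime by (intro prime_imp_coprime) auto
  then obtain u v where "u * int l + v * c = 1"
    by (metis bezout_int coprime_iff_gcd_eq_1)
  then have "v * c = 1 - int l * u" by (simp add: algebra_simps)
  then have "complex_of_int (v * c) = of_int (1 - int l * u)" by simp
  then have "of_int c * of_int v = 1 - of_nat l * complex_of_int u" by (simp add: mult.commute)
  then have "val_unit V (of_int c * of_int v)"
    using val_unit_one_minus[OF subring_of_int[OF R, of u]] by simp
  then show ?thesis using val_unit_factor subring_of_int[OF R] by blast
qed

text \<open>Otherwise \<open>y = 1/x\<close> is in \<open>V\<close>, and the equation multiplied by
  \<open>y^(degree P - 1)\<close> exhibits \<open>x\<close> as a polynomial in \<open>y\<close> over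
  \<open>V\<close>.\<close>

lemma val_ring_integrally_closed:
  assumes P: "P \<in> polys_over V" "lead_coeff P = 1" "poly P x = 0"
  shows "x \<in> V"
proof (rule ccontr)
  assume "x \<notin> V"
  have R: "is_subring V" by (rule val_ring_subring)
  define y where "y = inverse x"
  have y: "y \<in> V" unfolding y_def by (rule val_ring_inverse[OF \<open>x \<notin> V\<close>])
  have x0: "x \<noteq> 0" using \<open>x \<notin> V\<close> subring_zero[OF R] by auto
  have yx: "y * x = 1" using x0 by (simp add: y_def)
  have "P \<noteq> 0" using P(2) by auto
  then have "degree P \<noteq> 0" using P(3) by (rule degree_nonzero_of_root)
  then obtain n where n: "degree P = Suc n" by (cases "degree P") auto
  have pow: "y ^ n * x ^ i = y ^ (n - i)" if "i \<le> n" for i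
  proof -
    have "y ^ n * x ^ i = y ^ (n - i) * (y * x) ^ i"
      using that by (simp add: power_mult_distrib flip: power_add mult.assoc)
    then show ?thesis by (simp add: yx)
  qed
  have "0 = y ^ n * poly P x" using P by simp
  also have "\<dots> = y ^ n * ((\<Sum>i\<le>n. coeff P i * x ^ i) + x ^ n * x)"
    using P(2) n by (simp add: poly_altdef mult.commute)
  also have "\<dots> = (\<Sum>i\<le>n. coeff P i * (y ^ n * x ^ i)) + y ^ n * x ^ n * x"
    by (simp add: sum_distrib_left algebra_simps)
  also have "\<dots> = (\<Sum>i\<le>n. coeff P i * y ^ (n - i)) + x"
    by (simp add: pow)
  finally have "x = - (\<Sum>i\<le>n. coeff P i * y ^ (n - i))"
    by (metis add.commute eq_neg_iff_add_eq_0)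
  also have "\<dots> \<in> V" using y R P
    by (intro subring_uminus subring_sum[where I = "{..n}"] subring_mult subring_power polys_overD)
  finally show False using \<open>x \<notin> V\<close> by blast
qed

lemma algebraic_int_in_val_ring:
  assumes "algebraic_int x"
  shows "x \<in> V"
proof -
  obtain P where P: "lead_coeff P = 1" "\<forall>i. coeff P i \<in> \<int>" "poly P x = 0"
    using assms by (auto elim: algebraic_int.cases)
  then have "P \<in> polys_over V"
    using subring_Ints[OF val_ring_subring] by (blast intro: polys_overI)
  then show ?thesis using P(1,3) by (rule val_ring_integrally_closed)
qed

lemma val_den_nonzero: "val_den V x \<noteq> 0"
  using subring_zero[OF val_ring_subring] by (auto simp: val_den_def)

lemma val_den_in: "val_den V x \<in> V"
  using subring_one[OF val_ring_subring] val_ring_inverse by (auto simp: val_den_def)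

lemma val_den_mult_in: "val_den V x * x \<in> V"
  using subring_one[OF val_ring_subring] subring_zero[OF val_ring_subring]
  by (cases "x = 0") (auto simp: val_den_def)

text \<open>Gauss's lemma over \<open>V\<close>: at the sum of the least indices with unit
  coefficients, all other terms of the convolution are nonunits.\<close>

lemma gauss_val_ring:
  assumes P: "P \<in> polys_over V" "val_unit V (coeff P i)" and Q: "Q \<in> polys_over V" "val_unit V (coeff Q j)"
  obtains k where "val_unit V (coeff (P * Q) k)"
proof -
  have R: "is_subring V" by (rule val_ring_subring)
  define m where "m = (LEAST i. val_unit V (coeff P i))"
  define n where "n = (LEAST j. val_unit V (coeff Q j))"
  have m: "val_unit V (coeff P m)" "\<And>i. i < m \<Longrightarrow> \<not> val_unit V (coeff P i)"
    and n: "val_unit V (coeff Q n)" "\<And>i. i < n \<Longrightarrow> \<not> val_unit V (coeff Q i)"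
    using P Q LeastI[of "\<lambda>i. val_unit V (coeff P i)"] LeastI[of "\<lambda>i. val_unit V (coeff Q i)"]
      not_less_Least[of _ "\<lambda>i. val_unit V (coeff P i)"] not_less_Least[of _ "\<lambda>i. val_unit V (coeff Q i)"]
    unfolding m_def n_def by blast+
  define r where "r = (\<Sum>i\<in>{..m + n} - {m}. coeff P i * coeff Q (m + n - i))"
  have eq: "coeff (P * Q) (m + n) = coeff P m * coeff Q n + r"
    unfolding r_def coeff_mult by (subst sum.remove[of _ m]) auto
  have nonunit: "coeff P i * coeff Q (m + n - i) \<in> V \<and> \<not> val_unit V (coeff P i * coeff Q (m + n - i))"
    if "i \<in> {..m + n} - {m}" for i
  proof
    show "coeff P i * coeff Q (m + n - i) \<in> V" using P Q R by (intro subring_mult polys_overD)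
    show "\<not> val_unit V (coeff P i * coeff Q (m + n - i))"
    proof (cases "i < m")
      case True
      then show ?thesis using m val_unit_factor polys_overD[OF P(1)] polys_overD[OF Q(1)] by blast
    next
      case False
      then have "m + n - i < n" using that by auto
      then show ?thesis
        using n val_unit_factor polys_overD[OF P(1)] polys_overD[OF Q(1)] mult.commute by metis
    qed
  qed
  have r: "r \<in> V" "\<not> val_unit V r"
    unfolding r_def using nonunit by (intro subring_sum[OF R] val_nonunit_sum; simp)+
  have "val_unit V (coeff (P * Q) (m + n))"
  proof (rule ccontr)
    assume "\<not> val_unit V (coeff (P * Q) (m + n))"
    moreover have "\<not> val_unit V (- r)" using r val_unit_uminus[of "- r"] by auto
    ultimately have "\<not> val_unit V (coeff (P * Q) (m + n) + (- r))"
      using P Q R r by (intro val_nonunit_add subring_uminus polys_overD polys_over_mult)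
    then show False using m n eq val_unit_mult by simp
  qed
  then show ?thesis using that by blast
qed

lemma gauss_val_ring_prod:
  assumes "finite I" "\<And>i. i \<in> I \<Longrightarrow> f i \<in> polys_over V \<and> (\<exists>k. val_unit V (coeff (f i) k))"
  shows "\<exists>k. val_unit V (coeff (prod f I) k)"
  using assms
proof (induction I rule: finite_induct)
  case empty
  show ?case using val_unit_one by (intro exI[of _ 0]) simp
next
  case (insert i I)
  obtain j where "val_unit V (coeff (f i) j)" using insert.prems by blast
  moreover obtain k where "val_unit V (coeff (prod f I) k)" using insert.IH insert.prems by blast
  moreover have "f i \<in> polys_over V" "prod f I \<in> polys_over V"
    using insert.prems by (auto intro: polys_over_prod[OF val_ring_subring])
  ultimately obtain n where "val_unit V (coeff (f i * prod f I) n)"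
    using gauss_val_ring by metis
  then show ?case using insert.hyps by auto
qed

text \<open>The contribution of one place to the height: the leading coefficient has the same
  absolute value as the product of the \<open>1 / max(1, |y|)\<close>. Clearing denominators in each
  linear factor gives a product \<open>G\<close> that is primitive by Gauss's lemma. The minimal
  polynomial is primitive as well, so the ratio \<open>e\<close> of the two is a unit.\<close>

lemma lead_coeff_val_den:
  assumes "algebraic x"
  shows "val_unit V (of_int (lead_coeff (int_min_poly x)) / (\<Prod>y\<in>conjugates x. val_den V y))"
proof -
  have R: "is_subring V" by (rule val_ring_subring)
  define f where "f = int_min_poly x"
  define F :: "complex poly" where "F = map_poly of_int f"
  define D where "D = (\<Prod>y\<in>conjugates x. val_den V y)"
  define e where "e = of_int (lead_coeff f) / D"
  define G where "G = (\<Prod>y\<in>conjugates x. [:- (val_den V y * y), val_den V y:])"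
  have D0: "D \<noteq> 0" using finite_conjugates[OF assms] val_den_nonzero by (simp add: D_def)
  have e0: "e \<noteq> 0" using D0 int_min_poly_nonzero[OF assms] by (simp add: e_def f_def)
  have "G = (\<Prod>y\<in>conjugates x. [:val_den V y:] * [:- y, 1:])"
    unfolding G_def by (intro prod.cong) auto
  also have "\<dots> = [:D:] * (\<Prod>y\<in>conjugates x. [:- y, 1:])"
    by (simp only: prod.distrib D_def prod_const_poly)
  finally have FG: "F = Polynomial.smult e G"
    using D0 int_min_poly_eq_prod[OF assms] by (simp add: F_def f_def e_def)
  have unit_factor: "\<exists>k. val_unit V (coeff [:- (val_den V y * y), val_den V y:] k)" for y
  proof (cases "y \<in> V")
    case True
    then show ?thesis using val_unit_one by (intro exI[of _ 1]) (simp add: val_den_def)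
  next
    case False
    then have "y \<noteq> 0" using subring_zero[OF R] by auto
    then have "- (val_den V y * y) = - 1" using False by (simp add: val_den_def)
    then show ?thesis using val_unit_uminus[OF val_unit_one] by (intro exI[of _ 0]) simp
  qed
  have G: "G \<in> polys_over V" unfolding G_def
    by (intro polys_over_intros R subring_uminus val_den_in val_den_mult_in)
  obtain k where k: "val_unit V (coeff G k)"
    unfolding G_def using gauss_val_ring_prod[OF finite_conjugates[OF assms], of "\<lambda>y. [:- (val_den V y * y), val_den V y:]"]
      unit_factor by (auto intro!: polys_over_intros R subring_uminus val_den_in val_den_mult_in)
  \<comment> \<open>An irreducible integer polynomial of positive degree is primitive, so some
    coefficient is prime to \<open>l\<close>.\<close>
  obtain j where j: "\<not> int l dvd coeff f j"
  proof (rule ccontr)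
    assume "\<not> thesis"
    then have "[:int l:] dvd f" using that const_poly_dvd_iff by blast
    then obtain g where g: "f = [:int l:] * g" by (auto simp: dvd_def)
    have "\<not> [:int l:] dvd 1" using prime_gt_1_nat[OF val_ring_prime] by (simp add: is_unit_const_poly_iff)
    then have "g dvd 1"
      using Factorial_Ring.irreducibleD[OF irreducible_int_min_poly[OF assms] g[unfolded f_def]] by blast
    then have "degree f = 0" unfolding g by (auto simp: is_unit_poly_iff)
    then show False
      using card_conjugates[OF assms] finite_conjugates[OF assms] self_in_conjugates[OF assms]
      by (auto simp: f_def)
  qed
  have "val_unit V (coeff F j)" using val_unit_of_int[OF j] by (simp add: F_def coeff_map_poly)
  then have ej: "val_unit V (e * coeff G j)" using FG by simp
  have "e \<in> V"
  proof (rule ccontr)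
    assume "e \<notin> V"
    then have e': "inverse e \<in> V" by (rule val_ring_inverse)
    have "coeff G k = inverse e * coeff F k" using FG e0 by simp
    moreover have "coeff F k \<in> V" using subring_of_int[OF R] by (simp add: F_def coeff_map_poly)
    ultimately have "val_unit V (inverse e)" using val_unit_factor e' k by metis
    then show False using val_unit_inverse val_unitD(1) \<open>e \<notin> V\<close> by force
  qed
  then have "val_unit V e" using val_unit_factor[OF _ polys_overD[OF G] ej] by blast
  then show ?thesis by (simp add: e_def f_def D_def)
qed

end

text \<open>This stands in for the product formula: a nonzero rational that is integral at all
  places is an integer and therefore at least 1 in absolute value. A prime in the denominator would
  put its own inverse into a valuation ring above it.\<close>

lemma rational_in_all_val_rings:
  assumes "r \<in> \<rat>" "\<And>l V. val_ring l V \<Longrightarrow> r \<in> V"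
  shows "r \<in> \<int>"
proof -
  obtain a b where ab: "b > 0" "coprime a b" "r = of_int a / of_int b"
    using assms(1) by (auto elim: Rats_cases')
  have "b = 1"
  proof (rule ccontr)
    assume "b \<noteq> 1"
    then have "nat b \<noteq> 1" using ab(1) by linarith
    then obtain q where q: "Factorial_Ring.prime q" "q dvd nat b"
      using prime_factor_nat by blast
    obtain V where V: "val_ring q V" using val_ring_exists[OF q(1)] .
    have R: "is_subring V" using V by (rule val_ring_subring)
    have dvd_b: "int q dvd b" using q ab(1) by (metis int_dvd_int_iff int_nat_eq less_le)
    then obtain c where c: "b = int q * c" by (auto simp: dvd_def)
    have "\<not> int q dvd a"
    proof
      assume "int q dvd a"
      then have "int q dvd 1" using dvd_b ab(2) by (metis coprime_common_divisor)
      then show False using prime_gt_1_nat[OF q(1)] by simp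
    qed
    then have "val_unit V (of_int a)" by (rule val_unit_of_int[OF V])
    then have "r * inverse (of_int a) * of_int c \<in> V"
      using assms(2)[OF V] R val_unitD by (intro subring_mult subring_of_int) auto
    moreover have "a \<noteq> 0" "c \<noteq> 0" "q \<noteq> 0"
      using \<open>\<not> int q dvd a\<close> c ab(1) prime_gt_0_nat[OF q(1)] by auto
    then have "r * inverse (of_int a) * of_int c = inverse (of_nat q)"
      using ab c by (simp add: field_simps)
    ultimately show False using val_ring_inverse_prime[OF V] by simp
  qed
  then show ?thesis using ab by simp
qed

subsection \<open>Algebraic integers\<close>

text \<open>One inclusion transports the minimal polynomial of \<open>poly A z\<close>. The other
  holds because the product of all \<open>X - A(y)\<close> is rational and vanishes at
  \<open>poly A z\<close>, hence at each of its conjugates.\<close>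

lemma conjugates_poly:
  assumes z: "algebraic z" and A: "A \<in> polys_over \<rat>"
  shows "conjugates (poly A z) = poly A ` conjugates z"
proof
  show "poly A ` conjugates z \<subseteq> conjugates (poly A z)"
    using poly_in_conjugates[OF z _ A algebraic_poly[OF z A]] by blast
  show "conjugates (poly A z) \<subseteq> poly A ` conjugates z"
  proof
    fix c assume c: "c \<in> conjugates (poly A z)"
    define Q where "Q = (\<Prod>y\<in>conjugates z. [:- poly A y, 1:])"
    have "poly Q (poly A z) = 0"
      using self_in_conjugates[OF z] finite_conjugates[OF z] by (auto simp: Q_def poly_prod)
    then have "poly Q c = 0"
      using poly_conjugate_zero[OF algebraic_poly[OF z A] c] prod_poly_conjugates_over_Rats[OF z A]
      by (simp add: Q_def)
    then show "c \<in> poly A ` conjugates z"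
      using finite_conjugates[OF z] by (auto simp: Q_def poly_prod)
  qed
qed

lemma algebraic_int_conjugate:
  assumes "algebraic_int x" "y \<in> conjugates x"
  shows "algebraic_int y"
proof -
  obtain P where P: "lead_coeff P = 1" "\<forall>i. coeff P i \<in> \<int>" "poly P x = 0"
    using assms by (auto elim: algebraic_int.cases)
  then have "P \<in> polys_over \<rat>" by (intro polys_over_RatsI) (simp add: polys_over_def)
  then have "poly P y = 0"
    using poly_conjugate_zero assms P(3) algebraic_int_imp_algebraic by blast
  then show ?thesis using P algebraic_int.intros by blast
qed

text \<open>Without denominators at any conjugate, \<open>lead_coeff_val_den\<close> makes the
  leading coefficient a unit at every prime, so it is 1.\<close>

lemma algebraic_intI_val_rings:
  assumes x: "algebraic x" and V: "\<And>l V. val_ring l V \<Longrightarrow> conjugates x \<subseteq> V"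
  shows "algebraic_int x"
proof -
  define c where "c = lead_coeff (int_min_poly x)"
  have c: "c > 0" using lead_coeff_int_min_poly[OF x] by (simp add: c_def)
  have "inverse (complex_of_int c) \<in> V" if "val_ring l V" for l V
  proof -
    have "(\<Prod>y\<in>conjugates x. val_den V y) = 1"
      using V[OF that] by (intro prod.neutral) (auto simp: val_den_def)
    then show ?thesis using lead_coeff_val_den[OF that x] by (simp add: c_def val_unit_def)
  qed
  then have "inverse (complex_of_int c) \<in> \<int>"
    by (intro rational_in_all_val_rings) auto
  then obtain k where "inverse (complex_of_int c) = of_int k" by (auto elim: Ints_cases)
  then have "complex_of_int (c * k) = of_int 1" using c by (simp flip: \<open>_ = of_int k\<close>)
  then have "c * k = 1" by (simp only: of_int_eq_iff)
  then have "c = 1" using c by (simp add: zmult_eq_1_iff)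
  then show ?thesis
    using poly_int_min_poly[OF x] by (auto simp: algebraic_int_altdef_ipoly c_def)
qed

text \<open>Integrality is a local condition on conjugates, and each \<open>V\<close> is closed
  under the ring operations; a common primitive element matches the conjugates of \<open>x\<close>
  with those of \<open>y\<close>.\<close>

lemma is_subring_algebraic_int: "is_subring {x. algebraic_int x}"
proof -
  have "algebraic_int (x - y) \<and> algebraic_int (x * y)" if x: "algebraic_int x" and y: "algebraic_int y" for x y :: complex
  proof -
    obtain z where z: "algebraic z" "x \<in> simple_ext \<rat> z" "y \<in> simple_ext \<rat> z"
      using primitive_element x y algebraic_int_imp_algebraic by blast
    then obtain A B where A: "A \<in> polys_over \<rat>" "x = poly A z" and B: "B \<in> polys_over \<rat>" "y = poly B z"
      by (auto simp: simple_ext_def)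
    have in_V: "poly A d \<in> V" "poly B d \<in> V" if "d \<in> conjugates z" "val_ring l V" for d l V
      using that x y algebraic_int_in_val_ring algebraic_int_conjugate
        conjugates_poly[OF z(1) A(1)] conjugates_poly[OF z(1) B(1)] A(2) B(2) by blast+
    have closed: "algebraic_int (poly C z)" if C: "C \<in> polys_over \<rat>"
      and C_V: "\<And>l V d. val_ring l V \<Longrightarrow> d \<in> conjugates z \<Longrightarrow> poly C d \<in> V" for C
      using C_V conjugates_poly[OF z(1) C]
      by (intro algebraic_intI_val_rings algebraic_poly[OF z(1) C]) auto
    have "algebraic_int (poly (A - B) z)"
      by (intro closed polys_over_diff is_subring_Rats A(1) B(1))
        (auto intro: subring_diff[OF val_ring_subring] in_V)
    moreover have "algebraic_int (poly (A * B) z)"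
      by (intro closed polys_over_mult is_subring_Rats A(1) B(1))
        (auto intro: subring_mult[OF val_ring_subring] in_V)
    ultimately show ?thesis by (simp add: A(2) B(2))
  qed
  then show ?thesis by (simp add: is_subring_def)
qed

lemma algebraic_int_multiple:
  assumes "algebraic (x :: complex)"
  obtains n where "n > (0::nat)" "algebraic_int (of_nat n * x)"
proof -
  define c where "c = lead_coeff (int_min_poly x)"
  have c: "c > 0" using lead_coeff_int_min_poly[OF assms] by (simp add: c_def)
  define y where "y = of_int c * x"
  have y: "algebraic y" unfolding y_def using algebraic_mult[OF algebraic_of_rat assms] by simp
  have "conjugates y \<subseteq> V" if V: "val_ring l V" for l V
  proof
    fix w assume w: "w \<in> conjugates y"
    have A: "[:0, complex_of_int c:] \<in> polys_over \<rat>"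
      by (intro polys_over_pCons is_subring_Rats polys_over_zero) auto
    have "y = poly [:0, of_int c:] x" by (simp add: y_def mult.commute)
    then have "conjugates y = poly [:0, of_int c:] ` conjugates x"
      using conjugates_poly[OF assms A] by simp
    then obtain v where v: "v \<in> conjugates x" "w = of_int c * v"
      using w by (auto simp: mult.commute)
    define D where "D = (\<Prod>y\<in>conjugates x. val_den V y)"
    define D' where "D' = (\<Prod>y\<in>conjugates x - {v}. val_den V y)"
    have R: "is_subring V" by (rule val_ring_subring[OF V])
    have D: "D = val_den V v * D'"
      unfolding D_def D'_def using v(1) finite_conjugates[OF assms] by (rule prod.remove[rotated])
    have D0: "D \<noteq> 0" using finite_conjugates[OF assms] val_den_nonzero[OF V] by (simp add: D_def)
    \<comment> \<open>The first factor is a unit by \<open>lead_coeff_val_den\<close>,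
      \<open>D'\<close> collects the local denominators of the other conjugates, and the last factor
      is \<open>v\<close> with its own denominator cleared. So the leading coefficient times any
      root is integral.\<close>
    have w_eq: "w = of_int c / D * (D' * (val_den V v * v))" using D D0 v(2) by simp
    have "of_int c / D \<in> V" using lead_coeff_val_den[OF V assms] by (simp add: c_def D_def val_unit_def)
    moreover have "D' \<in> V" unfolding D'_def by (intro subring_prod R val_den_in[OF V])
    ultimately show "w \<in> V"
      unfolding w_eq by (intro subring_mult R val_den_mult_in[OF V])
  qed
  then have "algebraic_int y" using y by (intro algebraic_intI_val_rings)
  then show ?thesis using that[of "nat c"] c by (simp add: y_def)
qed

subsection \<open>Heights\<close>

lemma order_prod_linear:
  assumes "finite I"
  shows "order c (\<Prod>i\<in>I. [:- r i, 1:]) = card {i \<in> I. r i = (c :: complex)}"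
  using assms
proof (induction I rule: finite_induct)
  case empty
  show ?case by (simp add: order_0I)
next
  case (insert i I)
  have "{j \<in> insert i I. r j = c} = (if r i = c then insert i {j \<in> I. r j = c} else {j \<in> I. r j = c})"
    by auto
  moreover have "order c [:- r i, 1:] = (if r i = c then 1 else 0)"
    using order_power_n_n[of c 1] by (auto intro: order_0I)
  moreover have "order c ([:- r i, 1:] * (\<Prod>i\<in>I. [:- r i, 1:])) =
      order c [:- r i, 1:] + order c (\<Prod>i\<in>I. [:- r i, 1:])"
    using insert.hyps by (intro order_mult no_zero_divisors) auto
  ultimately show ?case using insert.hyps insert.IH by (simp del: mult_pCons_left)
qed

text \<open>All fibres of \<open>d \<mapsto> A(d)\<close> have the same size \<open>m\<close>,
  because conjugate numbers are roots of equal order of the rational product of the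
  \<open>X - A(d)\<close>. Thus \<open>m\<close> is the degree of \<open>\<rat>(z)\<close> over
  \<open>\<rat>(A(z))\<close>. It allows several numbers to be compared over the conjugates of one
  generator.\<close>

lemma conjugates_poly_multiplicity:
  assumes z: "algebraic z" and A: "A \<in> polys_over \<rat>"
  obtains m where "card (conjugates z) = m * card (conjugates (poly A z))"
    "\<And>\<phi> :: complex \<Rightarrow> real. (\<Sum>d\<in>conjugates z. \<phi> (poly A d)) = of_nat m * (\<Sum>c\<in>conjugates (poly A z). \<phi> c)"
    "\<And>\<phi> :: complex \<Rightarrow> complex. (\<Prod>d\<in>conjugates z. \<phi> (poly A d)) = (\<Prod>c\<in>conjugates (poly A z). \<phi> c) ^ m"
proof -
  define x where "x = poly A z"
  define Q where "Q = (\<Prod>y\<in>conjugates z. [:- poly A y, 1:])"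
  define m where "m = order x Q"
  have x: "algebraic x" unfolding x_def by (rule algebraic_poly[OF z A])
  have fin: "finite (conjugates z)" "finite (conjugates x)" using z x by (simp_all add: finite_conjugates)
  have im: "poly A ` conjugates z \<subseteq> conjugates x" using conjugates_poly[OF z A] by (simp add: x_def)
  have fib: "card {d \<in> conjugates z. poly A d = c} = m" if c: "c \<in> conjugates x" for c
  proof -
    have "order c Q = order x Q"
      using prod_poly_conjugates_over_Rats[OF z A] fin
      by (intro order_conjugate[OF x c]) (auto simp: Q_def)
    then show ?thesis using order_prod_linear[OF fin(1), of c "poly A"] by (simp add: Q_def m_def)
  qed
  have group: "(\<Sum>d\<in>conjugates z. \<phi> (poly A d)) = of_nat m * (\<Sum>c\<in>conjugates x. \<phi> c)" for \<phi> :: "complex \<Rightarrow> real"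
  proof -
    have "(\<Sum>d\<in>conjugates z. \<phi> (poly A d)) =
      (\<Sum>c\<in>conjugates x. \<Sum>d\<in>{d \<in> conjugates z. poly A d = c}. \<phi> (poly A d))"
      using sum.group[OF fin im, of "\<lambda>d. \<phi> (poly A d)"] by simp
    also have "\<dots> = (\<Sum>c\<in>conjugates x. of_nat m * \<phi> c)" by (intro sum.cong refl) (simp add: fib)
    finally show ?thesis by (simp add: sum_distrib_left)
  qed
  have "(\<Prod>d\<in>conjugates z. \<phi> (poly A d)) = (\<Prod>c\<in>conjugates x. \<phi> c) ^ m" for \<phi> :: "complex \<Rightarrow> complex"
  proof -
    have "(\<Prod>d\<in>conjugates z. \<phi> (poly A d)) =
      (\<Prod>c\<in>conjugates x. \<Prod>d\<in>{d \<in> conjugates z. poly A d = c}. \<phi> (poly A d))"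
      using prod.group[OF fin im, of "\<lambda>d. \<phi> (poly A d)"] by simp
    also have "\<dots> = (\<Prod>c\<in>conjugates x. \<phi> c ^ m)" by (intro prod.cong refl) (simp add: fib)
    finally show ?thesis by (simp add: prod_power_distrib)
  qed
  moreover have "card (conjugates z) = m * card (conjugates x)"
  proof -
    have "real (card (conjugates z)) = real (m * card (conjugates x))" using group[of "\<lambda>_. 1"] by simp
    then show ?thesis by (simp only: of_nat_eq_iff)
  qed
  ultimately show ?thesis using group by (intro that[of m]) (simp_all add: x_def)
qed

text \<open>The height normalised over the generator \<open>z\<close> instead of
  \<open>poly A z\<close>. The integer \<open>a\<close>, a power of the leading coefficient, carries
  all finite places at once: at each of them it equals the product of the local denominators up to a
  unit.\<close>

lemma height_formula:
  assumes z: "algebraic z" and A: "A \<in> polys_over \<rat>"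
  obtains a :: nat where "a > 0"
    "card (conjugates z) * weil_height (poly A z) = ln (real a) + (\<Sum>d\<in>conjugates z. ln (max 1 (cmod (poly A d))))"
    "\<And>l V. val_ring l V \<Longrightarrow> val_unit V (of_nat a / (\<Prod>d\<in>conjugates z. val_den V (poly A d)))"
proof -
  define x where "x = poly A z"
  have x: "algebraic x" unfolding x_def by (rule algebraic_poly[OF z A])
  obtain m where m: "card (conjugates z) = m * card (conjugates x)"
    "\<And>\<phi> :: complex \<Rightarrow> real. (\<Sum>d\<in>conjugates z. \<phi> (poly A d)) = of_nat m * (\<Sum>c\<in>conjugates x. \<phi> c)"
    "\<And>\<phi> :: complex \<Rightarrow> complex. (\<Prod>d\<in>conjugates z. \<phi> (poly A d)) = (\<Prod>c\<in>conjugates x. \<phi> c) ^ m"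
    using conjugates_poly_multiplicity[OF z A] unfolding x_def by blast
  define c where "c = nat (lead_coeff (int_min_poly x))"
  have c: "c > 0" "real_of_int (lead_coeff (int_min_poly x)) = real c"
    "complex_of_int (lead_coeff (int_min_poly x)) = of_nat c"
    using lead_coeff_int_min_poly[OF x] by (simp_all add: c_def)
  have "card (conjugates z) * weil_height x = real m * (card (conjugates x) * weil_height x)"
    using m(1) by simp
  also have "\<dots> = real m * ln (real c) + real m * (\<Sum>y\<in>conjugates x. ln (max 1 (cmod y)))"
    unfolding weil_height_eq[OF x] c(2) by (simp add: distrib_left)
  also have "real m * ln (real c) = ln (real (c ^ m))" using c(1) by (simp add: ln_realpow)
  also have "real m * (\<Sum>y\<in>conjugates x. ln (max 1 (cmod y))) = (\<Sum>d\<in>conjugates z. ln (max 1 (cmod (poly A d))))"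
    by (rule m(2)[of "\<lambda>y. ln (max 1 (cmod y))", symmetric])
  finally have height: "card (conjugates z) * weil_height x =
    ln (real (c ^ m)) + (\<Sum>d\<in>conjugates z. ln (max 1 (cmod (poly A d))))" .
  have "val_unit V (of_nat (c ^ m) / (\<Prod>d\<in>conjugates z. val_den V (poly A d)))" if V: "val_ring l V" for l V
  proof -
    have "of_nat (c ^ m) / (\<Prod>d\<in>conjugates z. val_den V (poly A d)) =
      (of_nat c / (\<Prod>y\<in>conjugates x. val_den V y)) ^ m"
      unfolding m(3) by (simp add: power_divide)
    then show ?thesis
      using val_unit_power[OF V lead_coeff_val_den[OF V x], of m] by (simp only: c(3))
  qed
  then show ?thesis using that[of "c ^ m"] height c(1) by (simp add: x_def)
qed

lemma card_conjugates_pos: "algebraic z \<Longrightarrow> card (conjugates z) > 0"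
  using self_in_conjugates finite_conjugates by (auto simp: card_gt_0_iff)

text \<open>A comparison place by place. The conditions at the finite places say that
  \<open>a^q / b\<close> is integral everywhere, so \<open>b\<close> divides \<open>a^q\<close> and
  \<open>ln b \<le> q ln a\<close>.\<close>

lemma height_le_power:
  assumes z: "algebraic z" and A: "A \<in> polys_over \<rat>" and B: "B \<in> polys_over \<rat>"
    and arch: "\<And>d. d \<in> conjugates z \<Longrightarrow> cmod (poly B d) \<le> max 1 (cmod (poly A d)) ^ q"
    and nonarch: "\<And>l V d. val_ring l V \<Longrightarrow> d \<in> conjugates z \<Longrightarrow> val_den V (poly A d) ^ q * poly B d \<in> V"
  shows "weil_height (poly B z) \<le> q * weil_height (poly A z)"
proof -
  obtain a where a: "a > 0"
    "card (conjugates z) * weil_height (poly A z) = ln (real a) + (\<Sum>d\<in>conjugates z. ln (max 1 (cmod (poly A d))))"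
    "\<And>l V. val_ring l V \<Longrightarrow> val_unit V (of_nat a / (\<Prod>d\<in>conjugates z. val_den V (poly A d)))"
    using height_formula[OF z A] by blast
  obtain b where b: "b > 0"
    "card (conjugates z) * weil_height (poly B z) = ln (real b) + (\<Sum>d\<in>conjugates z. ln (max 1 (cmod (poly B d))))"
    "\<And>l V. val_ring l V \<Longrightarrow> val_unit V (of_nat b / (\<Prod>d\<in>conjugates z. val_den V (poly B d)))"
    using height_formula[OF z B] by blast
  have "of_nat a ^ q / complex_of_nat b \<in> V" if V: "val_ring l V" for l V
  proof -
    have R: "is_subring V" by (rule val_ring_subring[OF V])
    define DA where "DA = (\<Prod>d\<in>conjugates z. val_den V (poly A d))"
    define DB where "DB = (\<Prod>d\<in>conjugates z. val_den V (poly B d))"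
    have nz: "DA \<noteq> 0" "DB \<noteq> 0"
      using finite_conjugates[OF z] val_den_nonzero[OF V] by (simp_all add: DA_def DB_def)
    have "val_den V (poly A d) ^ q / val_den V (poly B d) \<in> V" if "d \<in> conjugates z" for d
      using nonarch[OF V that] subring_power[OF R val_den_in[OF V]]
      by (auto simp: val_den_def[of V "poly B d"] divide_inverse)
    then have "(\<Prod>d\<in>conjugates z. val_den V (poly A d) ^ q / val_den V (poly B d)) \<in> V"
      by (intro subring_prod[OF R])
    then have "DA ^ q / DB \<in> V"
      by (simp add: DA_def DB_def prod_dividef prod_power_distrib)
    moreover have "(of_nat a / DA) ^ q \<in> V" "inverse (of_nat b / DB) \<in> V"
      using a(3)[OF V] b(3)[OF V] subring_power[OF R] by (auto simp: DA_def DB_def val_unit_def)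
    ultimately have prod_in: "(of_nat a / DA) ^ q * (DA ^ q / DB) * inverse (of_nat b / DB) \<in> V"
      by (intro subring_mult R)
    have "(of_nat a / DA) ^ q * (DA ^ q / DB) * inverse (of_nat b / DB) = of_nat a ^ q / of_nat b"
      using nz b(1) by (simp add: field_simps)
    then show ?thesis using prod_in by metis
  qed
  then have "of_nat a ^ q / complex_of_nat b \<in> \<int>" by (intro rational_in_all_val_rings) auto
  then obtain k where k: "of_nat a ^ q / complex_of_nat b = of_int k" by (auto elim: Ints_cases)
  then have "complex_of_int (int (a ^ q)) = of_int (k * int b)" using b(1) by (simp add: field_simps)
  then have "int (a ^ q) = k * int b" by (simp only: of_int_eq_iff)
  moreover have "int (a ^ q) > 0" using a(1) by simp
  ultimately have "k > 0" using b(1) by (simp add: zero_less_mult_iff)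
  then have "int b \<le> int (a ^ q)" unfolding \<open>int (a ^ q) = k * int b\<close> using b(1) by simp
  then have "real b \<le> real a ^ q" by (metis of_nat_le_iff of_nat_power)
  then have "ln (real b) \<le> ln (real a ^ q)" using b(1) by (intro ln_mono) auto
  also have "\<dots> = q * ln (real a)" using a(1) by (simp add: ln_realpow)
  finally have lead: "ln (real b) \<le> q * ln (real a)" .
  have "ln (max 1 (cmod (poly B d))) \<le> q * ln (max 1 (cmod (poly A d)))" if d: "d \<in> conjugates z" for d
  proof -
    have "max 1 (cmod (poly B d)) \<le> max 1 (cmod (poly A d)) ^ q"
      using arch[OF d] one_le_power[of "max 1 (cmod (poly A d))" q] by simp
    then have "ln (max 1 (cmod (poly B d))) \<le> ln (max 1 (cmod (poly A d)) ^ q)" by (intro ln_mono) auto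
    then show ?thesis by (simp add: ln_realpow)
  qed
  then have "(\<Sum>d\<in>conjugates z. ln (max 1 (cmod (poly B d)))) \<le> q * (\<Sum>d\<in>conjugates z. ln (max 1 (cmod (poly A d))))"
    unfolding sum_distrib_left by (intro sum_mono)
  with lead have "card (conjugates z) * weil_height (poly B z) \<le> q * (card (conjugates z) * weil_height (poly A z))"
    unfolding a(2) b(2) by (simp add: distrib_left)
  then have "card (conjugates z) * weil_height (poly B z) \<le> card (conjugates z) * (q * weil_height (poly A z))"
    by (simp add: mult_ac)
  then show ?thesis using card_conjugates_pos[OF z] by simp
qed

lemma height_power_le:
  assumes "algebraic x"
  shows "weil_height (x ^ n) \<le> n * weil_height x"
proof -
  have A: "[:0, 1:] \<in> polys_over \<rat>" and B: "Polynomial.monom 1 n \<in> polys_over \<rat>"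
    by (intro polys_over_pCons polys_over_zero polys_over_monom is_subring_Rats; simp)+
  have "weil_height (poly (Polynomial.monom 1 n) x) \<le> n * weil_height (poly [:0, 1:] x)"
  proof (rule height_le_power[OF assms A B])
    show "cmod (poly (Polynomial.monom 1 n) d) \<le> max 1 (cmod (poly [:0, 1:] d)) ^ n" for d
      by (simp add: poly_monom norm_power power_mono)
    show "val_den V (poly [:0, 1:] d) ^ n * poly (Polynomial.monom 1 n) d \<in> V" if V: "val_ring l V" for l V d
      using subring_power[OF val_ring_subring[OF V] val_den_mult_in[OF V], of d n]
      by (simp add: poly_monom power_mult_distrib)
  qed
  then show ?thesis by (simp add: poly_monom)
qed

lemma algebraic_int_root_of_unity:
  assumes "n > 0" "w ^ n = (1 :: complex)"
  shows "algebraic_int w"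
proof (rule algebraic_int.intros)
  show "lead_coeff (Polynomial.monom 1 n - 1 :: complex poly) = 1"
  proof -
    have "coeff (Polynomial.monom 1 n - 1 :: complex poly) n = 1" using assms(1) by (simp add: coeff_1)
    moreover from this have "n \<le> degree (Polynomial.monom 1 n - 1 :: complex poly)"
      by (intro le_degree) simp
    moreover have "degree (Polynomial.monom 1 n - 1 :: complex poly) \<le> n"
      by (intro degree_diff_le degree_monom_le) simp
    ultimately show ?thesis by simp
  qed
  show "\<forall>i. coeff (Polynomial.monom 1 n - 1 :: complex poly) i \<in> \<int>" by (auto simp: coeff_1)
  show "poly (Polynomial.monom 1 n - 1) w = 0" using assms(2) by (simp add: poly_monom)
qed

lemma norm_root_of_unity: "n > 0 \<Longrightarrow> w ^ n = (1 :: complex) \<Longrightarrow> cmod w = 1"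
  by (metis power_eq_1_iff less_numeral_extra(3))

lemma height_mult_root_of_unity_le:
  assumes x: "algebraic x" and w: "n > 0" "w ^ n = 1"
  shows "weil_height (x * w) \<le> weil_height x"
proof -
  have "algebraic w" using algebraic_int_root_of_unity[OF w] by blast
  then obtain z where z: "algebraic z" "x \<in> simple_ext \<rat> z" "w \<in> simple_ext \<rat> z"
    using primitive_element x by blast
  then obtain A B where A: "A \<in> polys_over \<rat>" "x = poly A z" and B: "B \<in> polys_over \<rat>" "w = poly B z"
    by (auto simp: simple_ext_def)
  have unity: "poly B d ^ n = 1" if d: "d \<in> conjugates z" for d
  proof -
    have "B ^ n - 1 \<in> polys_over \<rat>"
      using B by (intro polys_over_diff polys_over_power polys_over_one is_subring_Rats)
    from poly_conjugate_zero[OF z(1) d this] show ?thesis using w(2) B(2) by simp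
  qed
  have "A * B \<in> polys_over \<rat>" using A B by (intro polys_over_mult is_subring_Rats)
  then have "weil_height (poly (A * B) z) \<le> real 1 * weil_height (poly A z)"
  proof (rule height_le_power[OF z(1) A(1)])
    fix d assume d: "d \<in> conjugates z"
    show "cmod (poly (A * B) d) \<le> max 1 (cmod (poly A d)) ^ 1"
      using norm_root_of_unity[OF w(1) unity[OF d]] by (simp add: norm_mult)
    show "val_den V (poly A d) ^ 1 * poly (A * B) d \<in> V" if V: "val_ring l V" for l V
      using subring_mult[OF val_ring_subring[OF V] val_den_mult_in[OF V, of "poly A d"]
          algebraic_int_in_val_ring[OF V algebraic_int_root_of_unity[OF w(1) unity[OF d]]]]
      by (simp add: mult.assoc)
  qed
  then show ?thesis by (simp add: A(2) B(2))
qed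

text \<open>A Liouville inequality. The norm of \<open>A(z)^q - B(z)^q\<close>, multiplied by
  \<open>(a b)^q\<close> to clear denominators and divided by \<open>p^k\<close> once for each
  conjugate, is a nonzero rational integral at every place. Its absolute value is at least 1, and
  logarithms give the bound.\<close>

lemma height_sum_lower_bound:
  assumes z: "algebraic z" and A: "A \<in> polys_over \<rat>" and B: "B \<in> polys_over \<rat>"
    and p: "Factorial_Ring.prime p" and neq: "poly A z ^ q \<noteq> poly B z ^ q"
    and cong: "\<And>V d. val_ring p V \<Longrightarrow> d \<in> conjugates z \<Longrightarrow>
      (poly A d ^ q - poly B d ^ q) * val_den V (poly A d) ^ q * val_den V (poly B d) ^ q / of_nat p ^ k \<in> V"
  shows "k * ln p - ln 2 \<le> q * (weil_height (poly A z) + weil_height (poly B z))"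
proof -
  define D where "D = card (conjugates z)"
  define C where "C = A ^ q - B ^ q"
  have C: "C \<in> polys_over \<rat>"
    unfolding C_def using A B by (intro polys_over_diff polys_over_power is_subring_Rats)
  have C0: "poly C d \<noteq> 0" if "d \<in> conjugates z" for d
    using poly_conjugate_zero_iff[OF z that C] neq by (simp add: C_def)
  obtain a where a: "a > 0"
    "D * weil_height (poly A z) = ln (real a) + (\<Sum>d\<in>conjugates z. ln (max 1 (cmod (poly A d))))"
    "\<And>l V. val_ring l V \<Longrightarrow> val_unit V (of_nat a / (\<Prod>d\<in>conjugates z. val_den V (poly A d)))"
    using height_formula[OF z A] unfolding D_def by blast
  obtain b where b: "b > 0"
    "D * weil_height (poly B z) = ln (real b) + (\<Sum>d\<in>conjugates z. ln (max 1 (cmod (poly B d))))"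
    "\<And>l V. val_ring l V \<Longrightarrow> val_unit V (of_nat b / (\<Prod>d\<in>conjugates z. val_den V (poly B d)))"
    using height_formula[OF z B] unfolding D_def by blast
  have p0: "p > 0" using prime_gt_0_nat[OF p] .
  define M where "M = (of_nat a * of_nat b) ^ q * (\<Prod>d\<in>conjugates z. poly C d) / of_nat p ^ (k * D)"
  have "M \<in> V" if V: "val_ring l V" for l V
  proof -
    have R: "is_subring V" by (rule val_ring_subring[OF V])
    define \<alpha> where "\<alpha> = (\<lambda>d. val_den V (poly A d))"
    define \<beta> where "\<beta> = (\<lambda>d. val_den V (poly B d))"
    have nz: "prod \<alpha> (conjugates z) \<noteq> 0" "prod \<beta> (conjugates z) \<noteq> 0"
      using finite_conjugates[OF z] val_den_nonzero[OF V] by (simp_all add: \<alpha>_def \<beta>_def)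
    have "poly C d * \<alpha> d ^ q * \<beta> d ^ q / of_nat p ^ k \<in> V" if d: "d \<in> conjugates z" for d
    proof (cases "l = p")
      case True
      then show ?thesis using cong[OF _ d] V by (simp add: C_def \<alpha>_def \<beta>_def)
    next
      \<comment> \<open>Away from \<open>p\<close> the division by \<open>p^k\<close> is by a unit,
        and \<open>\<alpha> d\<close>, \<open>\<beta> d\<close> clear the denominators of the two
        powers.\<close>
      case False
      have "\<not> int l dvd int p"
        using False p val_ring_prime[OF V] primes_dvd_imp_eq by (simp add: int_dvd_int_iff) blast
      then have "val_unit V (of_nat p)" using val_unit_of_int[OF V, of "int p"] by simp
      then have "inverse (of_nat p) ^ k \<in> V" by (intro subring_power[OF R]) (simp add: val_unit_def)
      moreover have "(\<alpha> d * poly A d) ^ q * \<beta> d ^ q - (\<beta> d * poly B d) ^ q * \<alpha> d ^ q \<in> V"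
        unfolding \<alpha>_def \<beta>_def
        by (intro subring_diff subring_mult subring_power R val_den_in[OF V] val_den_mult_in[OF V])
      moreover have "poly C d * \<alpha> d ^ q * \<beta> d ^ q / of_nat p ^ k =
        ((\<alpha> d * poly A d) ^ q * \<beta> d ^ q - (\<beta> d * poly B d) ^ q * \<alpha> d ^ q) * inverse (of_nat p) ^ k"
        by (simp add: C_def power_mult_distrib power_inverse divide_inverse algebra_simps)
      ultimately show ?thesis using subring_mult[OF R] by simp
    qed
    then have "(\<Prod>d\<in>conjugates z. poly C d * \<alpha> d ^ q * \<beta> d ^ q / of_nat p ^ k) \<in> V"
      by (intro subring_prod[OF R])
    also have "(\<Prod>d\<in>conjugates z. poly C d * \<alpha> d ^ q * \<beta> d ^ q / of_nat p ^ k) =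
      (\<Prod>d\<in>conjugates z. poly C d) * prod \<alpha> (conjugates z) ^ q * prod \<beta> (conjugates z) ^ q / of_nat p ^ (k * D)"
      by (simp add: prod_dividef prod.distrib prod_power_distrib D_def power_mult)
    finally have 1: "(\<Prod>d\<in>conjugates z. poly C d) * prod \<alpha> (conjugates z) ^ q * prod \<beta> (conjugates z) ^ q / of_nat p ^ (k * D) \<in> V" .
    have 2: "(of_nat a / prod \<alpha> (conjugates z)) ^ q \<in> V" "(of_nat b / prod \<beta> (conjugates z)) ^ q \<in> V"
      using a(3)[OF V] b(3)[OF V] subring_power[OF R] by (auto simp: \<alpha>_def \<beta>_def val_unit_def)
    have M_eq: "M = (of_nat a / prod \<alpha> (conjugates z)) ^ q * (of_nat b / prod \<beta> (conjugates z)) ^ q *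
      ((\<Prod>d\<in>conjugates z. poly C d) * prod \<alpha> (conjugates z) ^ q * prod \<beta> (conjugates z) ^ q / of_nat p ^ (k * D))"
      using nz by (simp add: M_def power_mult_distrib power_divide)
    show ?thesis unfolding M_eq by (intro subring_mult R 1 2)
  qed
  moreover have "M \<in> \<rat>"
    unfolding M_def by (intro Rats_divide Rats_mult Rats_power prod_poly_conjugates_Rats z C) auto
  ultimately have "M \<in> \<int>" by (intro rational_in_all_val_rings)
  moreover have "M \<noteq> 0"
    using a(1) b(1) p0 C0 finite_conjugates[OF z] by (simp add: M_def)
  ultimately have M1: "1 \<le> cmod M"
    by (auto elim!: Ints_cases)
  define mA where "mA = (\<lambda>d. max 1 (cmod (poly A d)))"
  define mB where "mB = (\<lambda>d. max 1 (cmod (poly B d)))"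
  \<comment> \<open>The factor 2 is the only archimedean loss; it becomes
    \<open>ln 2\<close>.\<close>
  have bound: "cmod (poly C d) \<le> 2 * mA d ^ q * mB d ^ q" for d
  proof -
    have ge1: "1 \<le> mA d ^ q" "1 \<le> mB d ^ q" by (simp_all add: mA_def mB_def one_le_power)
    have "cmod (poly C d) \<le> cmod (poly A d) ^ q + cmod (poly B d) ^ q"
      using norm_triangle_ineq4[of "poly A d ^ q" "poly B d ^ q"] by (simp add: C_def norm_power)
    also have "\<dots> \<le> mA d ^ q + mB d ^ q"
      by (intro add_mono power_mono) (auto simp: mA_def mB_def)
    also have "\<dots> \<le> mA d ^ q * mB d ^ q + mA d ^ q * mB d ^ q"
      using ge1 mult_left_mono[of 1 "mB d ^ q" "mA d ^ q"] mult_right_mono[of 1 "mA d ^ q" "mB d ^ q"]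
      by (intro add_mono) auto
    finally show ?thesis by simp
  qed
  have "real p ^ (k * D) \<le> real p ^ (k * D) * cmod M" using M1 p0 by simp
  also have "\<dots> = (real a * real b) ^ q * (\<Prod>d\<in>conjugates z. cmod (poly C d))"
    using p0 by (simp add: M_def norm_mult norm_divide norm_power prod_norm)
  also have "\<dots> \<le> (real a * real b) ^ q * (\<Prod>d\<in>conjugates z. 2 * mA d ^ q * mB d ^ q)"
    using bound by (intro mult_left_mono prod_mono) auto
  finally have le: "real p ^ (k * D) \<le> (real a * real b) ^ q * (\<Prod>d\<in>conjugates z. 2 * mA d ^ q * mB d ^ q)" .
  have pos: "mA d > 0" "mB d > 0" for d by (simp_all add: mA_def mB_def)
  have nz: "mA d \<noteq> 0" "mB d \<noteq> 0" for d using pos[of d] by auto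
  have "k * D * ln p = ln (real p ^ (k * D))" using p0 by (simp add: ln_realpow)
  also have "\<dots> \<le> ln ((real a * real b) ^ q * (\<Prod>d\<in>conjugates z. 2 * mA d ^ q * mB d ^ q))"
    using le p0 by (intro ln_mono) auto
  also have "\<dots> = ln ((real a * real b) ^ q) + ln (\<Prod>d\<in>conjugates z. 2 * mA d ^ q * mB d ^ q)"
    using a(1) b(1) pos by (intro ln_mult_pos prod_pos mult_pos_pos zero_less_power) auto
  also have "ln ((real a * real b) ^ q) = q * (ln a + ln b)"
    using a(1) b(1) by (simp add: ln_realpow ln_mult_pos)
  also have "ln (\<Prod>d\<in>conjugates z. 2 * mA d ^ q * mB d ^ q) = (\<Sum>d\<in>conjugates z. ln (2 * mA d ^ q * mB d ^ q))"
    using finite_conjugates[OF z] by (intro ln_prod) (auto simp: pos nz)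
  also have "\<dots> = (\<Sum>d\<in>conjugates z. ln 2 + q * ln (mA d) + q * ln (mB d))"
    by (intro sum.cong refl) (simp add: ln_mult_pos ln_realpow pos nz)
  also have "\<dots> = D * ln 2 + q * (\<Sum>d\<in>conjugates z. ln (mA d)) + q * (\<Sum>d\<in>conjugates z. ln (mB d))"
    by (simp add: sum.distrib sum_distrib_left D_def)
  also have "q * (ln a + ln b) + \<dots> = D * ln 2 + q * (D * weil_height (poly A z)) + q * (D * weil_height (poly B z))"
    unfolding a(2) b(2) by (simp add: mA_def mB_def algebra_simps)
  finally have "D * (k * ln p - ln 2) \<le> D * (q * (weil_height (poly A z) + weil_height (poly B z)))"
    by (simp add: algebra_simps)
  moreover have "D > 0" using card_conjugates_pos[OF z] by (simp add: D_def)
  ultimately show ?thesis by simp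
qed

subsection \<open>Unramified primes and valuations\<close>

lemma complex_ring_simps:
  "carrier complex_ring = UNIV" "monoid.mult complex_ring = (\<lambda>x y. x * y)" "one complex_ring = 1"
  "ring.zero complex_ring = 0" "add complex_ring = (\<lambda>x y. x + y)"
  by (simp_all add: ring_of_type_algebra_def)

lemma field_complex_ring: "field complex_ring"
  by (rule field_from_type_algebra)

lemma ring_complex_ring: "ring complex_ring"
  by (rule ring_from_type_algebra)

lemma complex_ring_a_inv: "a_inv complex_ring x = - x"
proof -
  interpret ring complex_ring by (rule ring_complex_ring)
  have "a_inv complex_ring x = a_inv complex_ring x \<oplus>\<^bsub>complex_ring\<^esub> x \<oplus>\<^bsub>complex_ring\<^esub> (- x)"
    by (simp add: complex_ring_simps)
  also have "a_inv complex_ring x \<oplus>\<^bsub>complex_ring\<^esub> x = 0"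
    using l_neg[of x] by (simp add: complex_ring_simps)
  finally show ?thesis by (simp add: complex_ring_simps)
qed

lemma complex_ring_m_inv: "x \<noteq> 0 \<Longrightarrow> m_inv complex_ring x = inverse x"
proof -
  assume "x \<noteq> 0"
  interpret field complex_ring by (rule field_complex_ring)
  show ?thesis
    using \<open>x \<noteq> 0\<close> by (intro comm_inv_char) (auto simp: complex_ring_simps)
qed

lemma subring_complex_ring_iff: "subring R complex_ring \<longleftrightarrow> is_subring R"
proof
  assume "subring R complex_ring"
  from subringE[OF this] have "1 \<in> R" "\<And>x. x \<in> R \<Longrightarrow> - x \<in> R"
    "\<And>x y. x \<in> R \<Longrightarrow> y \<in> R \<Longrightarrow> x * y \<in> R" "\<And>x y. x \<in> R \<Longrightarrow> y \<in> R \<Longrightarrow> x + y \<in> R"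
    by (auto simp: complex_ring_simps complex_ring_a_inv)
  then show "is_subring R" unfolding is_subring_def by (metis diff_conv_add_uminus)
next
  assume R: "is_subring R"
  show "subring R complex_ring"
    using R by (intro ring.subringI[OF ring_complex_ring])
      (auto simp: complex_ring_simps complex_ring_a_inv intro: subring_one subring_uminus subring_mult subring_add)
qed

lemma subfield_complex_ring_iff: "subfield K complex_ring \<longleftrightarrow> is_subfield K"
proof
  assume K: "subfield K complex_ring"
  have R: "is_subring K" using subfieldE(1)[OF K] by (simp add: subring_complex_ring_iff)
  have "inverse x \<in> K" if "x \<in> K" for x
  proof (cases "x = 0")
    case False
    then show ?thesis
      using ring.subfield_m_inv(1)[OF ring_complex_ring K, of x] that
      by (simp add: complex_ring_simps complex_ring_m_inv)
  qed (use subring_zero[OF R] in simp)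
  with R show "is_subfield K" by (simp add: is_subfield_def)
next
  assume K: "is_subfield K"
  show "subfield K complex_ring"
  proof (rule field.subfieldI'[OF field_complex_ring])
    show "subring K complex_ring" using K by (auto simp: subring_complex_ring_iff)
    show "inv\<^bsub>complex_ring\<^esub> k \<in> K" if "k \<in> K - {\<zero>\<^bsub>complex_ring\<^esub>}" for k
      using that subfield_inverse[OF K, of k] by (simp add: complex_ring_simps complex_ring_m_inv)
  qed
qed

text \<open>Remainders modulo the monic polynomial \<open>M\<close> show that the powers of
  \<open>x\<close> below \<open>degree M\<close> span. The lemma makes the definition of
  \<open>unramified_at\<close> applicable to the field generated by a single element.\<close>

lemma number_field_simple_ext:
  assumes x: "algebraic x"
  shows "number_field (simple_ext \<rat> x)"
proof -
  define K where "K = simple_ext \<rat> x"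
  have K: "is_subfield K" unfolding K_def
    using x is_subfield_simple_ext[OF is_subfield_Rats algebraic_of_rat] by blast
  have RK: "is_subring K" using K by auto
  interpret R: ring complex_ring by (rule ring_complex_ring)
  have Q: "subfield \<rat> complex_ring" by (simp add: subfield_complex_ring_iff is_subfield_Rats)
  define M where "M = (\<Prod>y\<in>conjugates x. [:- y, 1:])"
  have M: "M \<in> polys_over \<rat>" "lead_coeff M = 1" "poly M x = 0"
    unfolding M_def using prod_conjugates_over_Rats[OF x] finite_conjugates[OF x] self_in_conjugates[OF x]
    by (auto simp: lead_coeff_prod poly_prod)
  define Us where "Us = map (\<lambda>i. x ^ i) [0..<degree M]"
  define T where "T = R.Span \<rat> Us"
  have Us: "set Us \<subseteq> carrier complex_ring" by (simp add: complex_ring_simps)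
  have T_add: "a + b \<in> T" if "a \<in> T" "b \<in> T" for a b
    using R.Span_subgroup_props(3)[OF Q Us] that by (simp add: T_def complex_ring_simps)
  have T_0: "0 \<in> T"
    using R.Span_subgroup_props(2)[OF Q Us] by (simp add: T_def complex_ring_simps)
  have T_smult: "k * v \<in> T" if "k \<in> \<rat>" "v \<in> T" for k v
    using R.Span_smult_closed[OF Q Us that(1)] that(2) by (simp add: T_def complex_ring_simps)
  have T_base: "x ^ i \<in> T" if "i < degree M" for i
    using R.Span_base_incl[OF Q Us] that by (auto simp: T_def Us_def)
  have T_sum: "sum f I \<in> T" if "\<And>i. i \<in> I \<Longrightarrow> f i \<in> T" for f and I :: "nat set"
    using that by (induction I rule: infinite_finite_induct) (auto intro: T_0 T_add)
  have "K \<subseteq> T"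
  proof
    fix v assume "v \<in> K"
    then obtain P where P: "P \<in> polys_over \<rat>" "v = poly P x" by (auto simp: K_def simple_ext_def)
    obtain Q R where QR: "R \<in> polys_over \<rat>" "P = M * Q + R" "R = 0 \<or> degree R < degree M"
      using poly_division_over[OF is_subring_Rats M(1,2) P(1)] by metis
    have v: "v = poly R x" using P(2) QR(2) M(3) by simp
    have "poly R x \<in> T"
    proof (cases "R = 0")
      case False
      then have "degree R < degree M" using QR(3) by simp
      then show ?thesis
        unfolding poly_altdef by (intro T_sum T_smult T_base polys_overD[OF QR(1)]) auto
    qed (simp add: T_0)
    then show "v \<in> T" by (simp add: v)
  qed
  moreover have "R.finite_dimension \<rat> T"
    unfolding T_def by (rule R.Span_finite_dimension[OF Q Us])
  moreover have "subalgebra \<rat> K complex_ring"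
  proof (rule subalgebra.intro)
    show "subgroup K (add_monoid complex_ring)"
      using subring.axioms(1)[of K complex_ring] RK by (simp add: subring_complex_ring_iff)
    show "subalgebra_axioms \<rat> K complex_ring"
      using subfield_Rats[OF K] subring_mult[OF RK] by unfold_locales (simp add: complex_ring_simps)
  qed
  ultimately have "R.finite_dimension \<rat> K"
    using R.subalbegra_incl_imp_finite_dimension[OF Q] by blast
  then show ?thesis
    using K by (simp add: number_field_def subfield_complex_ring_iff K_def)
qed

text \<open>One simultaneous induction for the three facts needed about products of ideals. The last
  one, with one element chosen from each factor, is how the squarefree factorisation of
  \<open>p\<close> will be used.\<close>

lemma finprod_ideals:
  assumes R: "cring R" and S: "finite S" "\<And>I. I \<in> S \<Longrightarrow> ideal I R"
  shows "ideal (\<Otimes>\<^bsub>ideals_set R\<^esub> I\<in>S. I) R"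
    and "I \<in> S \<Longrightarrow> (\<Otimes>\<^bsub>ideals_set R\<^esub> I\<in>S. I) \<subseteq> I"
    and "(\<And>I. I \<in> S \<Longrightarrow> s I \<in> I) \<Longrightarrow> (\<Otimes>\<^bsub>R\<^esub> I\<in>S. s I) \<in> (\<Otimes>\<^bsub>ideals_set R\<^esub> I\<in>S. I)"
proof -
  interpret R: cring R by (rule R)
  interpret J: comm_monoid "ideals_set R" by (rule R.ideals_set_is_comm_monoid)
  have carr: "carrier (ideals_set R) = {I. ideal I R}" and mult: "monoid.mult (ideals_set R) = ideal_prod R"
    and one: "one (ideals_set R) = carrier R"
    by (simp_all add: ideals_set_def)
  have "ideal (\<Otimes>\<^bsub>ideals_set R\<^esub> I\<in>S. I) R \<and> (\<forall>I\<in>S. (\<Otimes>\<^bsub>ideals_set R\<^esub> I\<in>S. I) \<subseteq> I) \<and>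
    ((\<forall>I\<in>S. s I \<in> I) \<longrightarrow> (\<Otimes>\<^bsub>R\<^esub> I\<in>S. s I) \<in> (\<Otimes>\<^bsub>ideals_set R\<^esub> I\<in>S. I))"
    using S
  proof (induction S rule: finite_induct)
    case empty
    then show ?case using R.oneideal by (simp add: one)
  next
    case (insert I S)
    define P where "P = (\<Otimes>\<^bsub>ideals_set R\<^esub> I\<in>S. I)"
    have I: "ideal I R" and S: "\<And>I. I \<in> S \<Longrightarrow> ideal I R" using insert.prems by auto
    note IH = insert.IH[OF S, folded P_def]
    have P: "(\<Otimes>\<^bsub>ideals_set R\<^esub> I\<in>insert I S. I) = ideal_prod R I P"
      unfolding P_def using insert.hyps I S
      by (subst J.finprod_insert) (simp_all add: carr mult Pi_def)
    have P_ideal: "ideal P R" and P_sub: "\<And>J. J \<in> S \<Longrightarrow> P \<subseteq> J"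
      and P_mem: "\<forall>J\<in>S. s J \<in> J \<Longrightarrow> (\<Otimes>\<^bsub>R\<^esub> J\<in>S. s J) \<in> P"
      using IH by auto
    have "(\<Otimes>\<^bsub>R\<^esub> I\<in>insert I S. s I) \<in> ideal_prod R I P" if s: "\<forall>J\<in>insert I S. s J \<in> J"
    proof -
      have "s J \<in> carrier R" if "J \<in> insert I S" for J
        by (rule ideal.Icarr[OF insert.prems[OF that] bspec[OF s that]])
      then have "(\<Otimes>\<^bsub>R\<^esub> I\<in>insert I S. s I) = s I \<otimes>\<^bsub>R\<^esub> (\<Otimes>\<^bsub>R\<^esub> I\<in>S. s I)"
        using insert.hyps by (intro R.finprod_insert) simp_all
      also have "\<dots> \<in> ideal_prod R I P" using s P_mem by (intro ideal_prod.prod) simp_all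
      finally show ?thesis .
    qed
    moreover have "ideal_prod R I P \<subseteq> J" if "J \<in> insert I S" for J
      using R.ideal_prod_inter[OF I P_ideal] P_sub[of J] that by auto
    ultimately show ?case
      unfolding P using R.ideal_prod_is_ideal[OF I P_ideal] by simp
  qed
  then show "ideal (\<Otimes>\<^bsub>ideals_set R\<^esub> I\<in>S. I) R"
    and "I \<in> S \<Longrightarrow> (\<Otimes>\<^bsub>ideals_set R\<^esub> I\<in>S. I) \<subseteq> I"
    and "(\<And>I. I \<in> S \<Longrightarrow> s I \<in> I) \<Longrightarrow> (\<Otimes>\<^bsub>R\<^esub> I\<in>S. s I) \<in> (\<Otimes>\<^bsub>ideals_set R\<^esub> I\<in>S. I)"
    by blast+
qed

section \<open>An unramified prime is a local uniformizer\<close>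

definition integers_of :: "complex set \<Rightarrow> complex set" where
  "integers_of K = {x \<in> K. algebraic_int x}"

lemma is_subring_integers_of: "is_subring K \<Longrightarrow> is_subring (integers_of K)"
  using is_subring_algebraic_int by (auto simp: is_subring_def integers_of_def)

definition prime_ideal_of :: "complex set \<Rightarrow> complex set \<Rightarrow> bool" where
  "prime_ideal_of \<O> Q \<longleftrightarrow> Q \<subseteq> \<O> \<and> 1 \<notin> Q \<and> (\<forall>a\<in>Q. \<forall>b\<in>Q. a + b \<in> Q) \<and>
     (\<forall>a\<in>\<O>. \<forall>b\<in>Q. a * b \<in> Q) \<and> (\<forall>a\<in>\<O>. \<forall>b\<in>\<O>. a * b \<in> Q \<longrightarrow> a \<in> Q \<or> b \<in> Q)"

lemma
  assumes "prime_ideal_of \<O> Q"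
  shows prime_ideal_of_subset: "Q \<subseteq> \<O>"
    and prime_ideal_of_one: "1 \<notin> Q"
    and prime_ideal_of_add: "a \<in> Q \<Longrightarrow> b \<in> Q \<Longrightarrow> a + b \<in> Q"
    and prime_ideal_of_mult: "c \<in> \<O> \<Longrightarrow> b \<in> Q \<Longrightarrow> c * b \<in> Q"
    and prime_ideal_of_prime: "c \<in> \<O> \<Longrightarrow> d \<in> \<O> \<Longrightarrow> c * d \<in> Q \<Longrightarrow> c \<notin> Q \<Longrightarrow> d \<in> Q"
  using assms by (auto simp: prime_ideal_of_def)

text \<open>The squarefree factorisation in terms of elements: as each prime enters the product
  once, a single element from each prime suffices for divisibility by \<open>p\<close>.\<close>

lemma unramified_prime_ideals:
  assumes K: "is_subring K" and p: "unramified_in_number_field K p"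
  obtains S where "finite S" "\<And>Q. Q \<in> S \<Longrightarrow> prime_ideal_of (integers_of K) Q \<and> of_nat p \<in> Q"
    "\<forall>s. (\<forall>Q\<in>S. s Q \<in> Q) \<longrightarrow> (\<exists>a\<in>integers_of K. prod s S = of_nat p * a)"
proof -
  define R where "R = ring_of_integers K"
  have sub: "is_subring (integers_of K)" by (rule is_subring_integers_of[OF K])
  have simps: "carrier R = integers_of K" "monoid.mult R = (\<lambda>x y. x * y)" "one R = 1" "add R = (\<lambda>x y. x + y)"
    by (simp_all add: R_def ring_of_integers_def complex_ring_simps integers_of_def)
  interpret C: field complex_ring by (rule field_complex_ring)
  interpret R: cring R
  proof -
    have "subcring (integers_of K) complex_ring"
      using sub by (intro C.subcringI') (simp add: subring_complex_ring_iff)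
    then show "cring R"
      using C.subcring_iff[of "integers_of K"] by (simp add: R_def ring_of_integers_def integers_of_def complex_ring_simps)
  qed
  obtain S where S: "finite S" "\<And>P. P \<in> S \<Longrightarrow> primeideal P R"
    "PIdl\<^bsub>R\<^esub> (of_nat p) = (\<Otimes>\<^bsub>ideals_set R\<^esub> P \<in> S. P)"
    using p by (auto simp: unramified_in_number_field_def Let_def R_def)
  have S_ideal: "ideal P R" if "P \<in> S" for P using S(2)[OF that] by (simp add: primeideal_def)
  have pidl: "PIdl\<^bsub>R\<^esub> (of_nat p) = {a * of_nat p | a. a \<in> integers_of K}"
    by (simp add: cgenideal_def simps)
  have "prime_ideal_of (integers_of K) Q \<and> of_nat p \<in> Q" if Q: "Q \<in> S" for Q
  proof
    interpret Q: primeideal Q R by (rule S(2)[OF Q])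
    have "1 \<notin> Q" using Q.one_imp_carrier Q.I_notcarr by (auto simp: simps)
    then show "prime_ideal_of (integers_of K) Q"
      unfolding prime_ideal_of_def
      using Q.Icarr Q.a_closed Q.I_l_closed Q.I_prime by (auto simp: simps)
    have "of_nat p = 1 * (of_nat p :: complex)" by simp
    then have "of_nat p \<in> PIdl\<^bsub>R\<^esub> (of_nat p)" unfolding pidl using subring_one[OF sub] by blast
    then show "of_nat p \<in> Q" using finprod_ideals(2)[OF R.cring_axioms S(1) S_ideal Q] S(3) by auto
  qed
  moreover have "\<exists>a\<in>integers_of K. prod s S = of_nat p * a" if s: "\<forall>Q\<in>S. s Q \<in> Q" for s
  proof -
    have "(\<Otimes>\<^bsub>R\<^esub> I\<in>S. s I) \<in> PIdl\<^bsub>R\<^esub> (of_nat p)"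
      unfolding S(3) by (rule finprod_ideals(3)[OF R.cring_axioms S(1) S_ideal bspec[OF s]])
    moreover have "(\<Otimes>\<^bsub>R\<^esub> I\<in>T. s I) = prod s T" if "T \<subseteq> S" for T
    proof -
      have "finite T" using that S(1) finite_subset by blast
      then show ?thesis using that
      proof (induction T rule: finite_induct)
        case (insert J T)
        have "s I \<in> carrier R" if "I \<in> insert J T" for I
          using that insert.prems by (intro ideal.Icarr[OF S_ideal bspec[OF s]]) auto
        then have "(\<Otimes>\<^bsub>R\<^esub> I\<in>insert J T. s I) = s J \<otimes>\<^bsub>R\<^esub> (\<Otimes>\<^bsub>R\<^esub> I\<in>T. s I)"
          using insert.hyps by (intro R.finprod_insert) simp_all
        then show ?case using insert.hyps insert.IH insert.prems by (simp add: simps)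
      qed (simp add: simps)
    qed
    ultimately have "prod s S \<in> PIdl\<^bsub>R\<^esub> (of_nat p)" using order.refl[of S] by metis
    then show ?thesis unfolding pidl by (auto simp: mult.commute)
  qed
  ultimately show ?thesis by (intro that[OF S(1)]) simp_all
qed

text \<open>Nonzero primes of a ring of algebraic integers are maximal: with \<open>g\<close> of least degree among
  the monic integer polynomials with \<open>g(x) \<in> Q\<close>, the constant coefficient of \<open>g\<close> lies in \<open>Q'\<close> but
  not in \<open>Q\<close>, so it is prime to \<open>p\<close> although \<open>p \<in> Q'\<close>.\<close>
lemma prime_ideal_maximal:
  assumes \<O>: "is_subring \<O>" "\<And>x. x \<in> \<O> \<Longrightarrow> algebraic_int x"
    and Q: "prime_ideal_of \<O> Q" and Q': "prime_ideal_of \<O> Q'" and sub: "Q \<subseteq> Q'"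
    and p: "Factorial_Ring.prime p" "of_nat p \<in> Q"
  shows "Q = Q'"
proof (rule ccontr)
  assume "Q \<noteq> Q'"
  then obtain x where x: "x \<in> Q'" "x \<notin> Q" using sub by blast
  have xO: "x \<in> \<O>" using x(1) prime_ideal_of_subset[OF Q'] by blast
  define G where "G = {g \<in> polys_over \<int>. lead_coeff g = 1 \<and> poly g x \<in> Q}"
  have Q0: "0 \<in> Q" using prime_ideal_of_mult[OF Q subring_zero[OF \<O>(1)] p(2)] by simp
  obtain P where "lead_coeff P = 1" "\<forall>i. coeff P i \<in> \<int>" "poly P x = 0"
    using \<O>(2)[OF xO] by (auto elim: algebraic_int.cases)
  then have "P \<in> G" using Q0 by (simp add: G_def polys_over_def)
  then obtain g where g: "g \<in> G" and g_min: "\<And>h. h \<in> G \<Longrightarrow> degree g \<le> degree h"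
    using ex_has_least_nat[of "\<lambda>g. g \<in> G" P degree] by blast
  obtain c h where gch: "g = pCons c h" by (cases g) auto
  have "h \<noteq> 0"
  proof
    assume "h = 0"
    then have "poly g x = 1" using g gch by (simp add: G_def)
    then show False using g prime_ideal_of_one[OF Q] by (simp add: G_def)
  qed
  then have h: "lead_coeff h = 1" "degree h < degree g" using g gch by (auto simp: G_def)
  have h_int: "h \<in> polys_over \<int>"
    using g polys_overD[of g \<int> "Suc _"] by (auto simp: G_def gch intro: polys_overI)
  have "c \<in> \<int>" using g polys_overD[of g \<int> 0] by (simp add: G_def gch)
  then obtain n where n: "c = of_int n" by (auto elim: Ints_cases)
  have hO: "poly h x \<in> \<O>"
    using subring_Ints[OF \<O>(1)]
    by (intro poly_in_subring[OF \<O>(1) _ xO] polys_over_mono[OF _ h_int]) auto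
  have gx: "c + x * poly h x \<in> Q" using g gch by (simp add: G_def)
  have neg: "- a \<in> T" if "a \<in> T" "prime_ideal_of \<O> T" for a T
  proof -
    have "- 1 * a \<in> T"
      by (intro prime_ideal_of_mult[OF that(2) _ that(1)] subring_uminus subring_one \<O>(1))
    then show ?thesis by simp
  qed
  show False
  proof (cases "int p dvd n")
    case True
    then obtain m where "n = int p * m" by (auto simp: dvd_def)
    then have "c = of_int m * of_nat p" using n by simp
    then have "c \<in> Q"
      using prime_ideal_of_mult[OF Q subring_of_int[OF \<O>(1), of m] p(2)] by simp
    then have "c + x * poly h x + - c \<in> Q"
      by (intro prime_ideal_of_add[OF Q gx] neg[OF _ Q])
    then have "x * poly h x \<in> Q" by simp
    then have "poly h x \<in> Q" using prime_ideal_of_prime[OF Q xO hO _ x(2)] by simp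
    then have "h \<in> G" using h h_int by (simp add: G_def)
    then show False using g_min h(2) by fastforce
  next
    case False
    have "poly h x * x \<in> Q'" by (rule prime_ideal_of_mult[OF Q' hO x(1)])
    then have "c + x * poly h x + - (poly h x * x) \<in> Q'"
      by (intro prime_ideal_of_add[OF Q' subsetD[OF sub gx]] neg[OF _ Q'])
    then have cQ': "c \<in> Q'" by (simp add: mult.commute)
    have "coprime (int p) n" using False p(1) by (intro prime_imp_coprime) auto
    then obtain u v where uv: "u * int p + v * n = 1" by (metis bezout_int coprime_iff_gcd_eq_1)
    have "of_int u * of_nat p + of_int v * c \<in> Q'"
      using p(2) sub
      by (intro prime_ideal_of_add[OF Q'] prime_ideal_of_mult[OF Q'] subring_of_int[OF \<O>(1)] cQ') auto
    moreover have "of_int u * of_nat p + of_int v * c = of_int (u * int p + v * n)" by (simp add: n)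
    ultimately show False using prime_ideal_of_one[OF Q'] uv by simp
  qed
qed

text \<open>\<open>x\<close> divides the nonzero constant coefficient \<open>c\<close> of its
  minimal polynomial, so in \<open>V\<close> it cannot contain more factors \<open>p\<close> than
  \<open>c\<close> does. The witness is one more than the multiplicity of \<open>p\<close> in
  \<open>c\<close>.\<close>

lemma algebraic_int_not_infinitely_divisible:
  assumes V: "val_ring p V" and x: "algebraic_int x" "x \<noteq> 0"
  obtains k where "x / of_nat p ^ k \<notin> V"
proof -
  define f where "f = int_min_poly x"
  have alg: "algebraic x" by (rule algebraic_int_imp_algebraic[OF x(1)])
  obtain c g where f: "f = pCons c g" by (cases f) auto
  have root: "of_int c + x * poly (map_poly of_int g) x = 0"
    using poly_int_min_poly[OF alg] f by (simp add: f_def map_poly_pCons)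
  have "c \<noteq> 0" using coeff_0_int_min_poly[OF alg x(2)] f by (simp add: f_def)
  have R: "is_subring V" by (rule val_ring_subring[OF V])
  have gV: "poly (map_poly of_int g) x \<in> V"
    using subring_Ints[OF R]
    by (intro poly_in_subring[OF R _ algebraic_int_in_val_ring[OF V x(1)]]
        polys_over_mono[OF _ polys_over_map_of_int]) auto
  have "\<not> int p dvd 1" using prime_gt_1_nat[OF val_ring_prime[OF V]] by simp
  then obtain d where d: "c = int p ^ multiplicity (int p) c * d" "\<not> int p dvd d"
    by (rule multiplicity_decompose'[OF \<open>c \<noteq> 0\<close>])
  define m where "m = multiplicity (int p) c"
  have md: "c = int p ^ m * d" "\<not> int p dvd d" unfolding m_def by (fact d)+
  have cm: "complex_of_int c = of_nat p ^ m * of_int d" by (subst md(1)) simp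
  have p0: "complex_of_nat p \<noteq> 0" by (rule val_ring_prime_nonzero[OF V])
  have "x / of_nat p ^ Suc m \<notin> V"
  proof
    assume "x / of_nat p ^ Suc m \<in> V"
    then have "- (x / of_nat p ^ Suc m * poly (map_poly of_int g) x) \<in> V"
      using gV R by (intro subring_uminus subring_mult)
    moreover have "- (x / of_nat p ^ Suc m * poly (map_poly of_int g) x) = of_int c / of_nat p ^ Suc m"
    proof -
      have "of_int c = - (x * poly (map_poly of_int g) x)"
        using root by (simp add: eq_neg_iff_add_eq_0)
      then show ?thesis by simp
    qed
    moreover have "of_int c / of_nat p ^ Suc m = of_int d / (of_nat p :: complex)"
      using p0 by (simp add: cm)
    ultimately have "of_int d / complex_of_nat p \<in> V" by simp
    moreover have "val_unit V (of_int d)" by (rule val_unit_of_int[OF V md(2)])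
    ultimately have "of_int d / complex_of_nat p * inverse (of_int d) \<in> V"
      using R by (intro subring_mult) (auto simp: val_unit_def)
    moreover have "of_int d / complex_of_nat p * inverse (of_int d) = inverse (of_nat p)"
      using val_unitD(3)[OF \<open>val_unit V (of_int d)\<close>] by (simp add: divide_inverse)
    ultimately show False using val_ring_inverse_prime[OF V] by simp
  qed
  then show ?thesis by (rule that)
qed

text \<open>\<open>V\<close> cuts out a prime \<open>P\<close> above \<open>p\<close> in the ring of
  integers. Multiplied by a \<open>V\<close>-unit \<open>T\<close> from the other primes above
  \<open>p\<close>, every element of \<open>P\<close> becomes divisible by \<open>p\<close>, so
  \<open>p\<close> is a uniformizer at \<open>P\<close>. Were no \<open>x / p^k\<close> a unit,
  factors \<open>p\<close> could be split off from \<open>x\<close> without end.\<close>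

lemma unramified_integer_valuation:
  assumes V: "val_ring p V" and K: "is_subring K" and unram: "unramified_in_number_field K p"
    and x: "x \<in> integers_of K" "x \<noteq> 0"
  obtains k where "val_unit V (x / of_nat p ^ k)"
proof -
  define \<O> where "\<O> = integers_of K"
  have \<O>: "is_subring \<O>" "\<And>x. x \<in> \<O> \<Longrightarrow> algebraic_int x"
    unfolding \<O>_def using is_subring_integers_of[OF K] by (auto simp: integers_of_def)
  have OV: "\<O> \<subseteq> V" using \<O>(2) algebraic_int_in_val_ring[OF V] by blast
  have p: "Factorial_Ring.prime p" by (rule val_ring_prime[OF V])
  define P where "P = {x \<in> \<O>. \<not> val_unit V x}"
  have P: "prime_ideal_of \<O> P"
    unfolding prime_ideal_of_def
  proof (intro conjI ballI impI)
    show "P \<subseteq> \<O>" by (auto simp: P_def)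
    show "1 \<notin> P" using val_unit_one[OF V] by (simp add: P_def)
    show "a + b \<in> P" if "a \<in> P" "b \<in> P" for a b
      using that val_nonunit_add[OF V, of a b] OV subring_add[OF \<O>(1)] by (auto simp: P_def)
    show "a * b \<in> P" if "a \<in> \<O>" "b \<in> P" for a b
      using that val_unit_factor[OF V, of b a] OV subring_mult[OF \<O>(1)] by (auto simp: P_def mult.commute)
    show "a \<in> P \<or> b \<in> P" if "a \<in> \<O>" "b \<in> \<O>" "a * b \<in> P" for a b
      using that val_unit_mult[OF V] by (auto simp: P_def)
  qed
  obtain S where S: "finite S" "\<And>Q. Q \<in> S \<Longrightarrow> prime_ideal_of \<O> Q \<and> of_nat p \<in> Q"
    "\<forall>s. (\<forall>Q\<in>S. s Q \<in> Q) \<longrightarrow> (\<exists>a\<in>\<O>. prod s S = of_nat p * a)"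
    using unramified_prime_ideals[OF K unram, folded \<O>_def] by blast
  have S_sub: "Q = P" if "Q \<in> S" "Q \<subseteq> P" for Q
    using prime_ideal_maximal[OF \<O> _ P that(2) p] S(2)[OF that(1)] by blast
  have outside: "\<exists>t\<in>Q. val_unit V t" if "Q \<in> S" "Q \<noteq> P" for Q
  proof (rule ccontr)
    assume "\<not> ?thesis"
    then have "Q \<subseteq> P" using S(2)[OF that(1)] by (auto simp: P_def prime_ideal_of_def)
    then show False using S_sub that by blast
  qed
  define t where "t = (\<lambda>Q. SOME t. t \<in> Q \<and> val_unit V t)"
  have t: "t Q \<in> Q" "val_unit V (t Q)" if "Q \<in> S" "Q \<noteq> P" for Q
    using someI_ex[of "\<lambda>t. t \<in> Q \<and> val_unit V t"] outside[OF that] by (auto simp: t_def)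
  \<comment> \<open>Otherwise every prime in \<open>S\<close> contains a \<open>V\<close>-unit, and
    the product of these units would be divisible by \<open>p\<close>.\<close>
  have "P \<in> S"
  proof (rule ccontr)
    assume "P \<notin> S"
    have t': "t Q \<in> Q" "val_unit V (t Q)" if "Q \<in> S" for Q
      using t[OF that] that \<open>P \<notin> S\<close> by auto
    then have "\<exists>a\<in>\<O>. prod t S = of_nat p * a" by (intro S(3)[rule_format])
    from this obtain a where "a \<in> \<O>" "prod t S = of_nat p * a" by blast
    moreover have "val_unit V (prod t S)" using t'(2) by (rule val_unit_prod[OF V])
    ultimately show False using not_val_unit_prime_mult[OF V] OV by auto
  qed
  define T where "T = prod t (S - {P})"
  have T: "val_unit V T" unfolding T_def using t(2) by (intro val_unit_prod[OF V]) auto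
  have divide: "\<exists>b\<in>\<O>. a * T = of_nat p * b" if "a \<in> \<O>" "\<not> val_unit V a" for a
  proof -
    have "\<exists>b\<in>\<O>. prod (t(P := a)) S = of_nat p * b"
      using that t(1) by (intro S(3)[rule_format]) (auto simp: P_def)
    moreover have "prod (t(P := a)) S = a * T"
    proof -
      have "prod (t(P := a)) S = a * prod (t(P := a)) (S - {P})"
        using prod.remove[OF S(1) \<open>P \<in> S\<close>, of "t(P := a)"] by simp
      also have "prod (t(P := a)) (S - {P}) = T" unfolding T_def by (intro prod.cong) auto
      finally show ?thesis .
    qed
    ultimately show ?thesis by simp
  qed
  have p0: "complex_of_nat p \<noteq> 0" by (rule val_ring_prime_nonzero[OF V])
  show ?thesis
  proof (rule ccontr)
    assume "\<not> thesis"
    then have none: "\<not> val_unit V (x / of_nat p ^ k)" for k using that by blast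
    \<comment> \<open>Each step gains one factor \<open>p\<close> at the price of one factor
      \<open>T\<close>, which is a unit in \<open>V\<close>.\<close>
    have "\<exists>a\<in>\<O>. x * T ^ k = of_nat p ^ k * a" for k
    proof (induction k)
      case 0
      then show ?case using x by (simp add: \<O>_def)
    next
      case (Suc k)
      then obtain a where a: "a \<in> \<O>" "x * T ^ k = of_nat p ^ k * a" by blast
      have "x / of_nat p ^ k = a * inverse T ^ k"
        using a(2) p0 val_unitD(3)[OF T] by (simp add: field_simps power_inverse)
      then have "\<not> val_unit V a"
        using none[of k] val_unit_mult[OF V _ val_unit_power[OF V val_unit_inverse[OF T]], of a k] by auto
      then obtain b where b: "b \<in> \<O>" "a * T = of_nat p * b" using divide a(1) by blast
      have "x * T ^ Suc k = x * T ^ k * T" by (simp add: mult_ac)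
      also have "\<dots> = of_nat p ^ k * (a * T)" unfolding a(2) by (simp add: mult_ac)
      also have "\<dots> = of_nat p ^ Suc k * b" unfolding b(2) by (simp add: mult_ac)
      finally show ?case using b(1) by blast
    qed
    moreover obtain k where "x / of_nat p ^ k \<notin> V"
      using algebraic_int_not_infinitely_divisible[OF V \<O>(2) x(2)] x(1) by (auto simp: \<O>_def)
    ultimately have "\<exists>a\<in>\<O>. x * T ^ k = of_nat p ^ k * a" "x / of_nat p ^ k \<notin> V" by simp_all
    then obtain a where a: "a \<in> \<O>" "x * T ^ k = of_nat p ^ k * a" by blast
    have "x / of_nat p ^ k = a * inverse T ^ k"
      using a(2) p0 val_unitD(3)[OF T] by (simp add: field_simps power_inverse)
    also have "\<dots> \<in> V"
      using a(1) OV val_unitD(2)[OF T] val_ring_subring[OF V] by (intro subring_mult subring_power) auto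
    finally show False using \<open>x / of_nat p ^ k \<notin> V\<close> by blast
  qed
qed

text \<open>\<open>x\<close> is the quotient of the algebraic integers \<open>n x\<close> and
  \<open>n\<close> of the number field that it generates. The exponents of the two are subtracted,
  so \<open>k\<close> may have either sign.\<close>

lemma unramified_valuation:
  assumes V: "val_ring p V" and F: "is_subfield F" "\<And>x. x \<in> F \<Longrightarrow> algebraic x"
    and unram: "unramified_at F p" and x: "x \<in> F" "x \<noteq> 0"
  obtains k :: int where "val_unit V (x * of_nat p powi k)"
proof -
  define K where "K = simple_ext \<rat> x"
  have alg: "algebraic x" using F x by blast
  have K: "is_subfield K" unfolding K_def
    using alg is_subfield_simple_ext[OF is_subfield_Rats algebraic_of_rat] by blast
  have RK: "is_subring K" using K by auto
  have "K \<subseteq> F"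
    unfolding K_def using F(1) x(1) subfield_Rats[OF F(1)] by (intro simple_ext_minimal) auto
  then have unramK: "unramified_in_number_field K p"
    using unram number_field_simple_ext[OF alg] by (simp add: unramified_at_def K_def)
  obtain n where n: "n > (0::nat)" "algebraic_int (of_nat n * x)"
    using algebraic_int_multiple[OF alg] .
  have xK: "x \<in> K" unfolding K_def by (rule simple_ext_gen[OF is_subring_Rats])
  have "of_nat n * x \<in> integers_of K" "of_nat n \<in> integers_of K"
    using n(2) xK RK by (auto simp: integers_of_def intro: subring_mult subring_of_nat)
  then have nx: "of_nat n * x \<in> integers_of K" "of_nat n * x \<noteq> 0"
    and n': "of_nat n \<in> integers_of K" "complex_of_nat n \<noteq> 0"
    using n(1) x(2) by simp_all
  obtain i where i: "val_unit V (of_nat n * x / of_nat p ^ i)"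
    by (rule unramified_integer_valuation[OF V RK unramK nx])
  obtain j where j: "val_unit V (of_nat n / of_nat p ^ j)"
    by (rule unramified_integer_valuation[OF V RK unramK n'])
  have p0: "complex_of_nat p \<noteq> 0" by (rule val_ring_prime_nonzero[OF V])
  have "val_unit V (of_nat n * x / of_nat p ^ i * inverse (of_nat n / of_nat p ^ j))"
    by (rule val_unit_mult[OF V i val_unit_inverse[OF j]])
  also have "of_nat n * x / of_nat p ^ i * inverse (of_nat n / of_nat p ^ j) = x * of_nat p powi (int j - int i)"
    using n(1) p0 by (simp add: power_int_diff field_simps)
  finally show ?thesis by (rule that)
qed

subsection \<open>Congruences in a valuation ring\<close>

text \<open>Here and below, \<open>(a - b) / c \<in> V\<close> is the encoding of a congruence
  modulo \<open>c\<close>.\<close>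

lemma val_ring_cong_mult:
  assumes "is_subring V" "a \<in> V" "b' \<in> V" "(a - a') / c \<in> V" "(b - b') / c \<in> V"
  shows "(a * b - a' * b') / c \<in> V"
proof -
  have "(a * b - a' * b') / c = a * ((b - b') / c) + (a - a') / c * b'"
    by (simp add: algebra_simps add_divide_distrib diff_divide_distrib)
  also have "\<dots> \<in> V" using assms by (intro subring_add subring_mult)
  finally show ?thesis .
qed

lemma val_ring_cong_power:
  assumes V: "is_subring V" and ab: "a \<in> V" "b \<in> V" "(a - b) / c \<in> V"
  shows "(a ^ n - b ^ n) / c \<in> V"
proof (induction n)
  case (Suc n)
  then show ?case
    using val_ring_cong_mult[OF V ab(1) subring_power[OF V ab(2)] ab(3)] by simp
qed (simp add: subring_zero[OF V])

lemma val_ring_cong_trans: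
  assumes "is_subring V" "(a - b) / c \<in> V" "(b - d) / c \<in> V"
  shows "(a - d) / c \<in> V"
proof -
  have "(a - d) / c = (a - b) / c + (b - d) / c" by (simp add: diff_divide_distrib)
  then show ?thesis using assms by (simp add: subring_add)
qed

lemma val_ring_cong_sym:
  assumes "is_subring V" "(a - b) / c \<in> V"
  shows "(b - a) / c \<in> V"
  using subring_uminus[OF assms] by (simp add: minus_divide_left)

text \<open>In \<open>a^p - b^p = (a - b) S\<close> the cofactor \<open>S\<close> is congruent to
  \<open>p b^(p-1)\<close> modulo \<open>p\<close>, so it supplies the additional factor
  \<open>p\<close>.\<close>

lemma val_ring_cong_prime_power:
  assumes V: "is_subring V" and p: "(of_nat p :: complex) \<noteq> 0" and ab: "a \<in> V" "b \<in> V"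
    and cong: "(a - b) / of_nat p ^ Suc j \<in> V"
  shows "(a ^ p - b ^ p) / of_nat p ^ Suc (Suc j) \<in> V"
proof -
  define d where "d = (a - b) / of_nat p ^ Suc j"
  have ab_p: "(a - b) / of_nat p \<in> V"
  proof -
    have "(a - b) / of_nat p = d * of_nat p ^ j" using p by (simp add: d_def)
    also have "\<dots> \<in> V"
      using cong unfolding d_def by (intro subring_mult subring_power subring_of_nat V)
    finally show ?thesis .
  qed
  define S where "S = (\<Sum>i<p. b ^ (p - Suc i) * a ^ i)"
  have "S / of_nat p \<in> V"
  proof -
    have "S = (\<Sum>i<p. b ^ (p - 1) + b ^ (p - Suc i) * (a ^ i - b ^ i))"
      unfolding S_def
    proof (intro sum.cong refl)
      fix i assume "i \<in> {..<p}"
      then have "b ^ (p - 1) = b ^ (p - Suc i) * b ^ i" by (simp flip: power_add)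
      then show "b ^ (p - Suc i) * a ^ i = b ^ (p - 1) + b ^ (p - Suc i) * (a ^ i - b ^ i)"
        by (simp add: algebra_simps)
    qed
    then have "S / of_nat p = b ^ (p - 1) + (\<Sum>i<p. b ^ (p - Suc i) * ((a ^ i - b ^ i) / of_nat p))"
      using p by (simp add: sum.distrib add_divide_distrib sum_divide_distrib)
    also have "\<dots> \<in> V"
      by (intro subring_add V subring_sum[where I = "{..<p}"] subring_mult subring_power ab
          val_ring_cong_power ab_p)
    finally show ?thesis .
  qed
  then have "d * (S / of_nat p) \<in> V" using cong unfolding d_def by (intro subring_mult V)
  moreover have "(a ^ p - b ^ p) / of_nat p ^ Suc (Suc j) = d * (S / of_nat p)"
    using p unfolding power_diff_sumr2[of a p b] S_def d_def by simp
  ultimately show ?thesis by metis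
qed

lemma frobenius_add:
  assumes V: "is_subring V" and p: "Factorial_Ring.prime p" and xy: "x \<in> V" "y \<in> V"
  shows "((x + y) ^ p - (x ^ p + y ^ p)) / of_nat p \<in> V"
proof -
  have p0: "p > 0" using prime_gt_0_nat[OF p] .
  define f where "f = (\<lambda>i. of_nat (p choose i) * x ^ i * y ^ (p - i))"
  have "(x + y) ^ p = sum f {..p}" unfolding f_def by (rule binomial_ring)
  also have "{..p} = insert 0 (insert p {1..<p})" using p0 by auto
  also have "sum f \<dots> = y ^ p + x ^ p + sum f {1..<p}" using p0 by (simp add: f_def)
  finally have "((x + y) ^ p - (x ^ p + y ^ p)) / of_nat p = (\<Sum>i\<in>{1..<p}. f i / of_nat p)"
    by (simp add: sum_divide_distrib)
  also have "\<dots> \<in> V"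
  proof (rule subring_sum[OF V])
    fix i assume i: "i \<in> {1..<p}"
    then have "p dvd p choose i" using p by (intro dvd_choose_prime) auto
    then obtain m where "p choose i = p * m" by (auto simp: dvd_def)
    then have "f i / of_nat p = of_nat m * x ^ i * y ^ (p - i)" using p0 by (simp add: f_def)
    also have "\<dots> \<in> V" by (intro subring_mult subring_power subring_of_nat V xy)
    finally show "f i / of_nat p \<in> V" .
  qed
  finally show ?thesis .
qed

lemma frobenius_sum:
  assumes V: "is_subring V" and p: "Factorial_Ring.prime p" and "finite I" "\<And>i. i \<in> I \<Longrightarrow> f i \<in> V"
  shows "((\<Sum>i\<in>I. f i) ^ (p ^ k) - (\<Sum>i\<in>I. f i ^ (p ^ k))) / of_nat p \<in> V"
proof (induction k)
  case 0
  show ?case by (simp add: subring_zero[OF V])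
next
  case (Suc k)
  have one: "((\<Sum>i\<in>I. g i) ^ p - (\<Sum>i\<in>I. g i ^ p)) / of_nat p \<in> V"
    if g: "\<And>i. i \<in> I \<Longrightarrow> g i \<in> V" for g
    using assms(3) g
  proof (induction I rule: finite_induct)
    case empty
    then show ?case using prime_gt_0_nat[OF p] by (simp add: subring_zero[OF V] power_0_left)
  next
    case (insert i I)
    have sum: "sum g I \<in> V" using insert.prems by (intro subring_sum[OF V]) simp
    have "((g i + sum g I) ^ p - (g i ^ p + sum g I ^ p)) / of_nat p \<in> V"
      using insert.prems sum by (intro frobenius_add[OF V p]) simp_all
    moreover have "(g i ^ p + sum g I ^ p - (g i ^ p + (\<Sum>i\<in>I. g i ^ p))) / of_nat p \<in> V"
      using insert.IH insert.prems by simp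
    ultimately have "((g i + sum g I) ^ p - (g i ^ p + (\<Sum>i\<in>I. g i ^ p))) / of_nat p \<in> V"
      by (rule val_ring_cong_trans[OF V])
    then show ?case using insert.hyps by simp
  qed
  have "(((\<Sum>i\<in>I. f i) ^ (p ^ k)) ^ p - (\<Sum>i\<in>I. f i ^ (p ^ k)) ^ p) / of_nat p \<in> V"
    using Suc assms(4) by (intro val_ring_cong_power V subring_power subring_sum[where I = I]) simp_all
  moreover have "((\<Sum>i\<in>I. f i ^ (p ^ k)) ^ p - (\<Sum>i\<in>I. (f i ^ (p ^ k)) ^ p)) / of_nat p \<in> V"
    using assms(4) by (intro one subring_power V)
  ultimately have "(((\<Sum>i\<in>I. f i) ^ (p ^ k)) ^ p - (\<Sum>i\<in>I. (f i ^ (p ^ k)) ^ p)) / of_nat p \<in> V"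
    by (rule val_ring_cong_trans[OF V])
  then show ?case by (simp add: mult.commute flip: power_mult)
qed

text \<open>Modulo \<open>p\<close>, the power \<open>P(w)^(p^k)\<close> depends on \<open>w\<close>
  only through \<open>w^(p^k)\<close>, which is the same for \<open>z\<close> and
  \<open>z^s\<close>. The one further \<open>p\<close>-th power lifts the congruence to modulus
  \<open>p^2\<close>.\<close>

lemma poly_root_of_unity_cong:
  assumes V: "is_subring V" and p: "Factorial_Ring.prime p" and P: "P \<in> polys_over V"
    and z: "z \<in> V" "z ^ (s * p ^ k) = z ^ (p ^ k)"
  shows "(poly P z ^ (p ^ Suc k) - poly P (z ^ s) ^ (p ^ Suc k)) / of_nat p ^ 2 \<in> V"
proof -
  have p0: "complex_of_nat p \<noteq> 0" using prime_gt_0_nat[OF p] by simp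
  have zs: "z ^ s \<in> V" by (rule subring_power[OF V z(1)])
  have frob: "(poly P w ^ (p ^ k) - (\<Sum>i\<le>degree P. (coeff P i * w ^ i) ^ (p ^ k))) / of_nat p \<in> V"
    if "w \<in> V" for w
    unfolding poly_altdef using that P
    by (intro frobenius_sum V p subring_mult subring_power polys_overD) simp_all
  have "(w ^ i) ^ (p ^ k) = (w ^ (p ^ k)) ^ i" for w :: complex and i
    by (metis power_mult mult.commute)
  moreover have "(z ^ s) ^ (p ^ k) = z ^ (p ^ k)" using z(2) by (simp add: power_mult)
  ultimately have "(\<Sum>i\<le>degree P. (coeff P i * (z ^ s) ^ i) ^ (p ^ k)) = (\<Sum>i\<le>degree P. (coeff P i * z ^ i) ^ (p ^ k))"
    by (simp add: power_mult_distrib)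
  then have "((\<Sum>i\<le>degree P. (coeff P i * z ^ i) ^ (p ^ k)) - poly P (z ^ s) ^ (p ^ k)) / of_nat p \<in> V"
    using val_ring_cong_sym[OF V frob[OF zs]] by simp
  with frob[OF z(1)] have "(poly P z ^ (p ^ k) - poly P (z ^ s) ^ (p ^ k)) / of_nat p \<in> V"
    by (rule val_ring_cong_trans[OF V])
  then have "((poly P z ^ (p ^ k)) ^ p - (poly P (z ^ s) ^ (p ^ k)) ^ p) / of_nat p ^ Suc (Suc 0) \<in> V"
    using P z(1) zs by (intro val_ring_cong_prime_power V p0 subring_power poly_in_subring) simp_all
  then show ?thesis by (simp add: power2_eq_square mult.commute flip: power_mult)
qed

subsection \<open>Prime power roots of unity over an unramified field\<close>

text \<open>For prime \<open>p\<close> this means order exactly \<open>p^n\<close>, since excluding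
  the exponent \<open>p^(n-1)\<close> excludes all smaller powers. The condition
  \<open>n > 0\<close> guards the truncated subtraction.\<close>

definition prime_power_primitive :: "nat \<Rightarrow> nat \<Rightarrow> complex \<Rightarrow> bool" where
  "prime_power_primitive p n z \<longleftrightarrow> n > 0 \<and> z ^ (p ^ n) = 1 \<and> z ^ (p ^ (n - 1)) \<noteq> 1"

lemma prime_power_primitive_eq_1_iff:
  assumes p: "Factorial_Ring.prime p" and z: "prime_power_primitive p n z"
  shows "z ^ k = 1 \<longleftrightarrow> p ^ n dvd k"
proof
  have n: "n > 0" "z ^ (p ^ n) = 1" "z ^ (p ^ (n - 1)) \<noteq> 1"
    using z by (auto simp: prime_power_primitive_def)
  assume k: "z ^ k = 1"
  obtain j where j: "j \<le> n" "gcd k (p ^ n) = p ^ j"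
    using divides_primepow_nat[OF p, of "gcd k (p ^ n)" n] by auto
  have "z ^ (p ^ j) = 1"
  proof (cases "k = 0")
    case True
    then show ?thesis using j n by simp
  next
    case False
    then obtain x y where "k * x = p ^ n * y + gcd k (p ^ n)" using bezout_nat[of k "p ^ n"] by blast
    then have "z ^ (k * x) = z ^ (p ^ n * y) * z ^ (p ^ j)" by (simp add: j(2) power_add)
    then show ?thesis using k n by (simp add: power_mult)
  qed
  have "j = n"
  proof (rule ccontr)
    assume "j \<noteq> n"
    then have "p ^ (n - 1) = p ^ j * p ^ (n - 1 - j)" using j(1) by (simp flip: power_add)
    then show False using n(3) \<open>z ^ (p ^ j) = 1\<close> by (simp add: power_mult)
  qed
  then show "p ^ n dvd k" using j(2) by (metis gcd_dvd1)
next
  assume "p ^ n dvd k"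
  then show "z ^ k = 1" using z by (auto simp: prime_power_primitive_def dvd_def power_mult)
qed

lemma prime_power_primitive_power:
  assumes p: "Factorial_Ring.prime p" and z: "prime_power_primitive p n z" and s: "\<not> p dvd s"
  shows "prime_power_primitive p n (z ^ s)"
proof -
  have n: "n > 0" "z ^ (p ^ n) = 1" using z by (auto simp: prime_power_primitive_def)
  have "\<not> p ^ n dvd s * p ^ (n - 1)"
  proof
    assume dvd: "p ^ n dvd s * p ^ (n - 1)"
    have "p ^ n = p * p ^ (n - 1)" using n(1) by (cases n) auto
    then show False using dvd s prime_gt_0_nat[OF p] by simp
  qed
  then have "(z ^ s) ^ (p ^ (n - 1)) \<noteq> 1"
    using prime_power_primitive_eq_1_iff[OF p z, of "s * p ^ (n - 1)"] by (simp add: power_mult)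
  moreover have "(z ^ s) ^ (p ^ n) = 1" using n by (metis power_commutes power_mult mult.commute power_one)
  ultimately show ?thesis using n by (simp add: prime_power_primitive_def)
qed

text \<open>The cyclotomic polynomial of order \<open>p^n\<close>, namely
  \<open>1 + Y + ... + Y^(p-1)\<close> at \<open>Y = X^(p^(n-1))\<close>.\<close>

definition prime_power_cyclotomic :: "nat \<Rightarrow> nat \<Rightarrow> complex poly" where
  "prime_power_cyclotomic p n = (\<Sum>i<p. Polynomial.monom 1 (i * p ^ (n - 1)))"

definition coprime_residues :: "nat \<Rightarrow> nat \<Rightarrow> nat set" where
  "coprime_residues p n = {s. s < p ^ n \<and> \<not> p dvd s}"

lemma card_coprime_residues:
  assumes "p > 0" "n > 0"
  shows "card (coprime_residues p n) = (p - 1) * p ^ (n - 1)"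
proof -
  have pn: "p ^ n = p * p ^ (n - 1)" using assms(2) by (cases n) auto
  have "coprime_residues p n = {..<p ^ n} - (\<lambda>i. p * i) ` {..<p ^ (n - 1)}"
    using assms by (auto simp: coprime_residues_def pn)
  moreover have "card ((\<lambda>i. p * i) ` {..<p ^ (n - 1)}) = p ^ (n - 1)"
    using assms by (subst card_image) (auto simp: inj_on_def)
  moreover have "(\<lambda>i. p * i) ` {..<p ^ (n - 1)} \<subseteq> {..<p ^ n}" using assms by (auto simp: pn)
  ultimately show ?thesis by (simp add: card_Diff_subset pn diff_mult_distrib)
qed

lemma prime_power_cyclotomic_root:
  assumes z: "prime_power_primitive p n z"
  shows "poly (prime_power_cyclotomic p n) z = 0"
proof -
  define w where "w = z ^ (p ^ (n - 1))"
  have "p ^ n = p ^ (n - 1) * p" using z by (cases n) (auto simp: prime_power_primitive_def)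
  then have "w \<noteq> 1" "w ^ p = 1" using z by (auto simp: prime_power_primitive_def w_def simp flip: power_mult)
  moreover have "poly (prime_power_cyclotomic p n) z = (\<Sum>i<p. w ^ i)"
    by (simp add: prime_power_cyclotomic_def poly_sum poly_monom w_def mult.commute flip: power_mult)
  ultimately show ?thesis by (simp add: sum_gp_strict)
qed

context
  fixes p n z
  assumes p: "Factorial_Ring.prime p" and z: "prime_power_primitive p n z"
begin

lemma degree_prime_power_cyclotomic:
  "lead_coeff (prime_power_cyclotomic p n) = 1"
  "degree (prime_power_cyclotomic p n) = (p - 1) * p ^ (n - 1)"
proof -
  define q where "q = p ^ (n - 1)"
  have q: "q > 0" using prime_gt_0_nat[OF p] by (simp add: q_def)
  have p0: "p > 0" using prime_gt_0_nat[OF p] .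
  have coeff: "coeff (prime_power_cyclotomic p n) k = (\<Sum>i<p. if i * q = k then 1 else 0)" for k
    by (simp add: prime_power_cyclotomic_def coeff_sum q_def)
  have "degree (prime_power_cyclotomic p n) \<le> (p - 1) * q"
    unfolding prime_power_cyclotomic_def q_def
    by (intro degree_sum_le) (auto intro!: order.trans[OF degree_monom_le] mult_right_mono)
  moreover have top: "coeff (prime_power_cyclotomic p n) ((p - 1) * q) = 1"
  proof -
    have "(\<Sum>i<p. if i * q = (p - 1) * q then 1 else 0) = (\<Sum>i<p. if p - 1 = i then 1 else (0::complex))"
      using q by (intro sum.cong) auto
    also have "\<dots> = 1" using p0 by simp
    finally show ?thesis by (simp only: coeff)
  qed
  then have "(p - 1) * q \<le> degree (prime_power_cyclotomic p n)" by (intro le_degree) simp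
  ultimately show "degree (prime_power_cyclotomic p n) = (p - 1) * p ^ (n - 1)" by (simp add: q_def)
  then show "lead_coeff (prime_power_cyclotomic p n) = 1" using top by (simp add: q_def)
qed

lemma prime_power_cyclotomic_over: "is_subring R \<Longrightarrow> prime_power_cyclotomic p n \<in> polys_over R"
  unfolding prime_power_cyclotomic_def by (intro polys_over_sum polys_over_monom subring_one)

lemma inj_on_root_powers: "inj_on (\<lambda>s. z ^ s) {..<p ^ n}"
proof (rule linorder_inj_onI)
  have z0: "z \<noteq> 0"
    using z prime_gt_0_nat[OF p] by (auto simp: prime_power_primitive_def power_0_left split: if_splits)
  fix s t :: nat assume st: "s < t" "s \<in> {..<p ^ n}" "t \<in> {..<p ^ n}"
  show "z ^ s \<noteq> z ^ t"
  proof
    assume "z ^ s = z ^ t"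
    moreover have "z ^ t = z ^ s * z ^ (t - s)" using st(1) by (simp flip: power_add)
    ultimately have "z ^ (t - s) = 1" using z0 by simp
    then have "p ^ n dvd t - s" using prime_power_primitive_eq_1_iff[OF p z] by blast
    then have "p ^ n \<le> t - s" using st(1) by (intro dvd_imp_le) auto
    then show False using st by simp
  qed
qed auto

lemma inj_on_root_powers_coprime: "inj_on (\<lambda>s. z ^ s) (coprime_residues p n)"
  by (rule inj_on_subset[OF inj_on_root_powers]) (auto simp: coprime_residues_def)

lemma algebraic_int_prime_power_primitive: "algebraic_int z"
  using z prime_gt_0_nat[OF p] algebraic_int_root_of_unity[of "p ^ n" z]
  by (simp add: prime_power_primitive_def)

lemma finite_coprime_residues: "finite (coprime_residues p n)"
  by (simp add: coprime_residues_def)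

text \<open>Both sides are monic of the same degree, so their difference has lower degree, yet it
  vanishes at as many distinct \<open>z^s\<close> as that degree counts.\<close>

lemma prime_power_cyclotomic_eq_prod:
  "prime_power_cyclotomic p n = (\<Prod>s\<in>coprime_residues p n. [:- (z ^ s), 1:])"
proof -
  define \<Phi> where "\<Phi> = prime_power_cyclotomic p n"
  define T where "T = (\<Prod>s\<in>coprime_residues p n. [:- (z ^ s), 1:])"
  have n: "n > 0" using z by (simp add: prime_power_primitive_def)
  have card: "card (coprime_residues p n) = (p - 1) * p ^ (n - 1)"
    using card_coprime_residues prime_gt_0_nat[OF p] n by blast
  have degT: "degree T = degree \<Phi>"
    unfolding T_def \<Phi>_def degree_prime_power_cyclotomic(2) card[symmetric]
    by (subst degree_prod_eq_sum_degree) auto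
  have lcT: "lead_coeff T = 1" by (simp add: T_def lead_coeff_prod)
  have "\<Phi> - T = 0"
  proof (rule ccontr)
    assume nz: "\<Phi> - T \<noteq> 0"
    have "degree (\<Phi> - T) \<le> degree \<Phi>" using degT by (intro degree_diff_le) auto
    moreover have "coeff (\<Phi> - T) (degree \<Phi>) = 0"
      using lcT degT degree_prime_power_cyclotomic(1) by (simp add: \<Phi>_def)
    then have "degree (\<Phi> - T) \<noteq> degree \<Phi>" using nz leading_coeff_0_iff by metis
    ultimately have lt: "degree (\<Phi> - T) < degree \<Phi>" by simp
    have "(\<lambda>s. z ^ s) ` coprime_residues p n \<subseteq> {x. poly (\<Phi> - T) x = 0}"
    proof clarify
      fix s assume s: "s \<in> coprime_residues p n"
      then have "\<not> p dvd s" by (simp add: coprime_residues_def)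
      from prime_power_primitive_power[OF p z this] have "poly \<Phi> (z ^ s) = 0"
        unfolding \<Phi>_def by (rule prime_power_cyclotomic_root)
      moreover have "poly T (z ^ s) = 0"
        using s finite_coprime_residues by (auto simp: T_def poly_prod)
      ultimately show "poly (\<Phi> - T) (z ^ s) = 0" by simp
    qed
    then have "card ((\<lambda>s. z ^ s) ` coprime_residues p n) \<le> card {x. poly (\<Phi> - T) x = 0}"
      by (intro card_mono poly_roots_finite nz)
    also have "\<dots> \<le> degree (\<Phi> - T)" by (rule card_poly_roots_bound[OF nz])
    finally have "(p - 1) * p ^ (n - 1) \<le> degree (\<Phi> - T)"
      by (simp only: card_image[OF inj_on_root_powers_coprime] card)
    then show False using lt by (simp add: \<Phi>_def degree_prime_power_cyclotomic(2))
  qed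
  then show ?thesis by (simp add: \<Phi>_def T_def)
qed

lemma root_power_mod:
  assumes "\<not> p dvd s"
  obtains t where "z = (z ^ s) ^ t"
proof -
  have n: "n > 0" "z ^ (p ^ n) = 1" using z by (auto simp: prime_power_primitive_def)
  have "coprime s (p ^ n)"
    using assms p by (simp add: prime_imp_coprime coprime_commute)
  moreover have "s \<noteq> 0" by (metis assms dvd_0_right)
  ultimately obtain x y where xy: "s * x = p ^ n * y + 1"
    using bezout_nat[of s "p ^ n"] by (auto simp: coprime_iff_gcd_eq_1)
  have "(z ^ s) ^ x = z ^ (s * x)" by (rule power_mult[symmetric])
  also have "\<dots> = (z ^ (p ^ n)) ^ y * z" by (simp only: xy power_add power_mult power_one_right)
  also have "\<dots> = z" by (simp add: n(2))
  finally show ?thesis by (intro that[of x]) (rule sym)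
qed

text \<open>Total ramification: \<open>p\<close> is the value at 1 of the cyclotomic polynomial, a
  product of numbers \<open>1 - z^s\<close>. The quotient of \<open>1 - z^s\<close> by
  \<open>1 - z\<close> is a geometric sum, and so is its inverse, because \<open>z\<close> is in
  turn a power of \<open>z^s\<close>.\<close>

lemma prime_eq_unit_mult_power:
  assumes V: "val_ring p V"
  obtains u where "val_unit V u" "of_nat p = u * (1 - z) ^ ((p - 1) * p ^ (n - 1))"
proof -
  have R: "is_subring V" by (rule val_ring_subring[OF V])
  have n: "n > 0" "z ^ (p ^ n) = 1" using z by (auto simp: prime_power_primitive_def)
  have p0: "p > 0" using prime_gt_0_nat[OF p] .
  have zV: "z \<in> V" by (rule algebraic_int_in_val_ring[OF V algebraic_int_prime_power_primitive])
  have z1: "z \<noteq> 1" using z by (auto simp: prime_power_primitive_def)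
  define w where "w = (\<lambda>s. (1 - z ^ s) / (1 - z))"
  have unit: "val_unit V (w s)" if s: "s \<in> coprime_residues p n" for s
  proof -
    have ps: "\<not> p dvd s" using s by (simp add: coprime_residues_def)
    have w1: "w s = (\<Sum>i<s. z ^ i)" using z1 by (simp add: w_def sum_gp_strict)
    obtain t where t: "z = (z ^ s) ^ t" using root_power_mod[OF ps] .
    have zs1: "z ^ s \<noteq> 1"
    proof
      assume "z ^ s = 1"
      then have "(z ^ s) ^ t = 1" by simp
      then have "z = 1" by (rule trans[OF t])
      then show False using z1 by simp
    qed
    then have "(1 - (z ^ s) ^ t) / (1 - z ^ s) = (\<Sum>i<t. (z ^ s) ^ i)" by (simp add: sum_gp_strict)
    then have w2: "inverse (w s) = (\<Sum>i<t. (z ^ s) ^ i)" unfolding t[symmetric] by (simp add: w_def)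
    have "w s \<noteq> 0" using zs1 z1 by (simp add: w_def)
    moreover have "w s \<in> V" unfolding w1
      by (intro subring_sum[where I = "{..<s}"] R subring_power zV)
    moreover have "inverse (w s) \<in> V" unfolding w2
      by (intro subring_sum[where I = "{..<t}"] R subring_power zV)
    ultimately show ?thesis by (simp add: val_unit_def)
  qed
  have "complex_of_nat p = poly (prime_power_cyclotomic p n) 1"
    by (simp add: prime_power_cyclotomic_def poly_sum poly_monom)
  also have "\<dots> = (\<Prod>s\<in>coprime_residues p n. 1 - z ^ s)"
    by (simp add: prime_power_cyclotomic_eq_prod poly_prod)
  also have "\<dots> = (\<Prod>s\<in>coprime_residues p n. w s * (1 - z))"
    using z1 by (intro prod.cong refl) (simp add: w_def)
  also have "\<dots> = prod w (coprime_residues p n) * (1 - z) ^ ((p - 1) * p ^ (n - 1))"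
    using card_coprime_residues[OF p0 n(1)] by (simp add: prod.distrib)
  finally have eq: "of_nat p = prod w (coprime_residues p n) * (1 - z) ^ ((p - 1) * p ^ (n - 1))" .
  have "val_unit V (prod w (coprime_residues p n))" using unit by (intro val_unit_prod[OF V])
  then show ?thesis using eq by (rule that)
qed

end

section \<open>Total ramification of F(z) over F above p\<close>

context
  fixes F :: "complex set" and p n :: nat and z :: complex and V :: "complex set"
  assumes F: "is_subfield F"
    and p: "Factorial_Ring.prime p" and z: "prime_power_primitive p n z"
    and V: "val_ring p V"
    and uniformizer: "\<And>x. x \<in> F \<Longrightarrow> x \<noteq> 0 \<Longrightarrow> \<exists>k. val_unit V (x * of_nat p powi k)"
begin

text \<open>The argument that Eisenstein polynomials are irreducible, in terms of valuations: the terms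
  \<open>c\<^sub>i (1 - z)\<^sup>i\<close> of the sum have pairwise distinct valuations.\<close>
lemma eisenstein_not_divisible:
  assumes P: "P \<in> polys_over (F \<inter> V)" "degree P < (p - 1) * p ^ (n - 1)" and unit: "val_unit V (coeff P i)"
  shows "poly P (1 - z) / of_nat p \<notin> V"
proof
  assume div: "poly P (1 - z) / of_nat p \<in> V"
  define L where "L = 1 - z"
  define e where "e = (p - 1) * p ^ (n - 1)"
  have R: "is_subring V" by (rule val_ring_subring[OF V])
  have p0: "complex_of_nat p \<noteq> 0" by (rule val_ring_prime_nonzero[OF V])
  obtain u where u: "val_unit V u" "of_nat p = u * L ^ e"
    using prime_eq_unit_mult_power[OF p z V] unfolding L_def e_def .
  have L0: "L \<noteq> 0" using z by (auto simp: prime_power_primitive_def L_def)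
  have zV: "z \<in> V"
    by (rule algebraic_int_in_val_ring[OF V algebraic_int_prime_power_primitive[OF p z]])
  have LV: "L \<in> V" unfolding L_def by (intro subring_diff subring_one R zV)
  have Lnonunit: "\<not> val_unit V L"
  proof
    assume "val_unit V L"
    then have "val_unit V (u * L ^ e)" by (intro val_unit_mult[OF V u(1)] val_unit_power[OF V])
    then have "val_unit V (of_nat p)" unfolding u(2) .
    with not_val_unit_prime[OF V] show False by (rule notE)
  qed
  define m where "m = (LEAST i. val_unit V (coeff P i))"
  have m: "val_unit V (coeff P m)" unfolding m_def using unit by (rule LeastI)
  have m_min: "\<not> val_unit V (coeff P j)" if "j < m" for j
    using that not_less_Least unfolding m_def by blast
  have cV: "coeff P j \<in> V" for j using polys_overD[OF P(1), of j] by simp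
  \<comment> \<open>Here the unramifiedness of \<open>F\<close> enters: a nonzero nonunit
    coefficient is a unit times a positive power of \<open>p\<close>, hence divisible by
    \<open>p\<close> itself and not merely by \<open>1 - z\<close>.\<close>
  have low: "coeff P j / of_nat p \<in> V" if j: "j < m" for j
  proof (cases "coeff P j = 0")
    case True
    then show ?thesis by (simp add: subring_zero[OF R])
  next
    case False
    then obtain k where k: "val_unit V (coeff P j * of_nat p powi k)"
      using uniformizer polys_overD[OF P(1), of j] by blast
    have "k < 0"
    proof (rule ccontr)
      assume "\<not> k < 0"
      then have "of_nat p powi k = (of_nat p :: complex) ^ nat k" by (simp add: power_int_def)
      then have "of_nat p powi k \<in> V" using subring_power[OF R subring_of_nat[OF R]] by simp
      then show False using val_unit_factor[OF V cV _ k] m_min[OF j] by blast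
    qed
    then obtain r where r: "k = - int (Suc r)" by (cases k) auto
    have "of_nat p powi k * of_nat p ^ r = inverse (complex_of_nat p)"
      using p0 unfolding r by (simp add: power_int_minus del: of_nat_Suc)
    then have "coeff P j / of_nat p = coeff P j * of_nat p powi k * of_nat p ^ r"
      by (simp add: divide_inverse mult.assoc)
    also have "\<dots> \<in> V"
      by (rule subring_mult[OF R val_unitD(1)[OF k] subring_power[OF R subring_of_nat[OF R]]])
    finally show ?thesis .
  qed
  have "coeff P m \<noteq> 0" using m by (auto simp: val_unit_def)
  then have "m \<le> degree P" by (rule le_degree)
  then have me: "m < e" using P(2) by (simp add: e_def)
  \<comment> \<open>As \<open>m < e\<close>, \<open>p\<close> is a multiple of
    \<open>L^(m+1)\<close>. So all terms except the one of index \<open>m\<close> are divisible by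
    \<open>L^(m+1)\<close>, and cancelling \<open>L^m\<close> makes the unit coefficient a multiple
    of \<open>L\<close>.\<close>
  have pL: "of_nat p = L ^ m * (L * (u * L ^ (e - Suc m)))"
  proof -
    have "L ^ m * (L * L ^ (e - Suc m)) = L ^ (m + Suc (e - Suc m))" by (simp only: power_add power_Suc)
    also have "m + Suc (e - Suc m) = e" using me by simp
    finally have "L ^ m * (L * L ^ (e - Suc m)) = L ^ e" .
    then show ?thesis unfolding u(2) by (metis mult.left_commute)
  qed
  define d where "d = degree P"
  have split: "{..d} = {..<m} \<union> insert m {m<..d}" using \<open>m \<le> degree P\<close> by (auto simp: d_def)
  have sum: "poly P L = (\<Sum>j<m. coeff P j * L ^ j) + (coeff P m * L ^ m + (\<Sum>j\<in>{m<..d}. coeff P j * L ^ j))"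
    unfolding poly_altdef d_def[symmetric] split by (subst sum.union_disjoint) auto
  define A where "A = (\<Sum>j<m. coeff P j / of_nat p * L ^ j)"
  define B where "B = (\<Sum>j\<in>{m<..d}. coeff P j * L ^ (j - Suc m))"
  have AV: "A \<in> V" unfolding A_def
    by (intro subring_sum[where I = "{..<m}"] R subring_mult subring_power LV low) simp
  have BV: "B \<in> V" unfolding B_def
    by (intro subring_sum[where I = "{m<..d}"] R subring_mult subring_power LV cV)
  have sumA: "(\<Sum>j<m. coeff P j * L ^ j) = of_nat p * A"
    using p0 by (simp add: A_def sum_distrib_left)
  have sumB: "(\<Sum>j\<in>{m<..d}. coeff P j * L ^ j) = L ^ m * (L * B)"
    unfolding B_def sum_distrib_left
  proof (intro sum.cong refl)
    fix j assume "j \<in> {m<..d}"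
    then have "m + Suc (j - Suc m) = j" by simp
    then have "L ^ j = L ^ m * (L * L ^ (j - Suc m))" by (metis power_add power_Suc)
    then show "coeff P j * L ^ j = L ^ m * (L * (coeff P j * L ^ (j - Suc m)))" by simp
  qed
  define v where "v = poly P L / of_nat p"
  have vV: "v \<in> V" using div by (simp add: v_def L_def)
  have "poly P L = of_nat p * v" using p0 by (simp add: v_def)
  then have "coeff P m * L ^ m = of_nat p * (v - A) - L ^ m * (L * B)"
    using sum unfolding sumA sumB by (simp add: algebra_simps)
  also have "\<dots> = L ^ m * (L * (u * L ^ (e - Suc m) * (v - A) - B))"
    by (subst pL) (simp add: algebra_simps)
  finally have "coeff P m = L * (u * L ^ (e - Suc m) * (v - A) - B)" using L0 by simp
  moreover have "u * L ^ (e - Suc m) * (v - A) - B \<in> V"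
    using val_unitD(1)[OF u(1)] by (intro subring_diff subring_mult subring_power R LV vV AV BV)
  ultimately show False using val_unit_factor[OF V LV] m Lnonunit by metis
qed

text \<open>\<open>\<kappa> i\<close> is minus the valuation of the coefficient of index
  \<open>i\<close>, so scaling by \<open>p\<close> to the largest \<open>\<kappa> i\<close> divides
  out the content of \<open>P\<close>.\<close>

lemma polys_over_unit_scaling:
  assumes P: "P \<in> polys_over F" "P \<noteq> 0"
  obtains k i where "Polynomial.smult (of_nat p powi k) P \<in> polys_over (F \<inter> V)"
    "val_unit V (coeff (Polynomial.smult (of_nat p powi k) P) i)"
proof -
  have R: "is_subring V" by (rule val_ring_subring[OF V])
  have FR: "is_subring F" using F by auto
  have p0: "complex_of_nat p \<noteq> 0" by (rule val_ring_prime_nonzero[OF V])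
  define N where "N = {i. coeff P i \<noteq> 0}"
  have "N \<subseteq> {..degree P}" by (auto simp: N_def intro: le_degree)
  then have finN: "finite N" by (rule finite_subset) simp
  have "N \<noteq> {}" using P(2) by (auto simp: N_def poly_eq_iff)
  define \<kappa> where "\<kappa> = (\<lambda>i. SOME k. val_unit V (coeff P i * of_nat p powi k))"
  have \<kappa>: "val_unit V (coeff P i * of_nat p powi \<kappa> i)" if "i \<in> N" for i
    using someI_ex[OF uniformizer[OF polys_overD[OF P(1)], of i]] that by (simp add: N_def \<kappa>_def)
  define k where "k = Max (\<kappa> ` N)"
  have "k \<in> \<kappa> ` N" unfolding k_def using finN \<open>N \<noteq> {}\<close> by (intro Max_in) auto
  then obtain i where i: "i \<in> N" "k = \<kappa> i" by blast
  have "of_nat p powi k * coeff P j \<in> F \<inter> V" for j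
  proof (cases "j \<in> N")
    case False
    then show ?thesis using subring_zero[OF R] subring_zero[OF FR] by (simp add: N_def)
  next
    case True
    then have "\<kappa> j \<le> k" using finN by (simp add: k_def)
    then have "(of_nat p :: complex) powi k = of_nat p powi \<kappa> j * of_nat p ^ nat (k - \<kappa> j)"
      using p0 by (simp flip: power_int_of_nat power_int_add)
    then have eq: "of_nat p powi k * coeff P j = coeff P j * of_nat p powi \<kappa> j * of_nat p ^ nat (k - \<kappa> j)"
      by simp
    have "of_nat p powi k * coeff P j \<in> V"
      unfolding eq
      by (rule subring_mult[OF R val_unitD(1)[OF \<kappa>[OF True]] subring_power[OF R subring_of_nat[OF R]]])
    moreover have "of_nat p powi k \<in> F"
      using subring_power[OF FR subring_of_nat[OF FR]] subfield_inverse[OF F subring_of_nat[OF FR]]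
        subring_power[OF FR] by (simp add: power_int_def)
    then have "of_nat p powi k * coeff P j \<in> F" by (intro subring_mult FR polys_overD P(1))
    ultimately show ?thesis by simp
  qed
  then have "Polynomial.smult (of_nat p powi k) P \<in> polys_over (F \<inter> V)" by (simp add: polys_over_def)
  moreover have "val_unit V (coeff (Polynomial.smult (of_nat p powi k) P) i)"
    using \<kappa>[OF i(1)] i(2) by (simp add: mult.commute)
  ultimately show ?thesis using that by blast
qed

text \<open>In effect the irreducibility of the cyclotomic polynomial over \<open>F\<close>: after
  scaling to content 1 the value would still be 0, which is divisible by \<open>p\<close>.\<close>

lemma eisenstein_nonzero:
  assumes P: "P \<in> polys_over F" "degree P < (p - 1) * p ^ (n - 1)" "poly P (1 - z) = 0"
  shows "P = 0"
proof (rule ccontr)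
  assume "P \<noteq> 0"
  then obtain k i where k: "Polynomial.smult (of_nat p powi k) P \<in> polys_over (F \<inter> V)"
    "val_unit V (coeff (Polynomial.smult (of_nat p powi k) P) i)"
    using polys_over_unit_scaling[OF P(1)] by blast
  have "degree (Polynomial.smult (of_nat p powi k) P) < (p - 1) * p ^ (n - 1)"
    using P(2) degree_smult_le order.strict_trans1 by blast
  from eisenstein_not_divisible[OF k(1) this k(2)] show False
    using P(3) subring_zero[OF val_ring_subring[OF V]] by simp
qed

text \<open>If reaching content 1 required a positive power of \<open>p\<close>, the value of the
  scaled polynomial would be divisible by \<open>p\<close>, against
  \<open>eisenstein_not_divisible\<close>. So the powers of \<open>1 - z\<close> form a local
  integral basis.\<close>

lemma eisenstein_integral:
  assumes P: "P \<in> polys_over F" "degree P < (p - 1) * p ^ (n - 1)" "poly P (1 - z) \<in> V"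
  shows "P \<in> polys_over (F \<inter> V)"
proof (cases "P = 0")
  case True
  then show ?thesis
    using subring_zero[OF val_ring_subring[OF V]] subring_zero[of F] F by (auto simp: polys_over_def)
next
  case False
  have R: "is_subring V" by (rule val_ring_subring[OF V])
  have p0: "complex_of_nat p \<noteq> 0" by (rule val_ring_prime_nonzero[OF V])
  obtain k i where k: "Polynomial.smult (of_nat p powi k) P \<in> polys_over (F \<inter> V)"
    "val_unit V (coeff (Polynomial.smult (of_nat p powi k) P) i)"
    using polys_over_unit_scaling[OF P(1) False] by blast
  have deg: "degree (Polynomial.smult (of_nat p powi k) P) < (p - 1) * p ^ (n - 1)"
    using P(2) degree_smult_le order.strict_trans1 by blast
  have "k \<le> 0"
  proof (rule ccontr)
    assume "\<not> k \<le> 0"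
    then have "(of_nat p :: complex) powi k = of_nat p * of_nat p ^ nat (k - 1)"
      
    proof -
      obtain r where r: "k = int (Suc r)" "nat (k - 1) = r"
        using \<open>\<not> k \<le> 0\<close> by (cases k) (auto simp: gr0_conv_Suc)
      show ?thesis unfolding r(2) unfolding r(1) power_int_of_nat by simp
    qed
    then have "poly (Polynomial.smult (of_nat p powi k) P) (1 - z) / of_nat p = of_nat p ^ nat (k - 1) * poly P (1 - z)"
      using p0 by simp
    also have "\<dots> \<in> V" by (intro subring_mult subring_power subring_of_nat R P(3))
    finally show False using eisenstein_not_divisible[OF k(1) deg k(2)] by blast
  qed
  show ?thesis
  proof (rule polys_overI)
    fix j
    have "(of_nat p :: complex) powi k * of_nat p ^ nat (- k) = 1"
      using \<open>k \<le> 0\<close> p0 by (simp flip: power_int_of_nat power_int_add)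
    then have "coeff P j = coeff (Polynomial.smult (of_nat p powi k) P) j * of_nat p ^ nat (- k)" by simp
    also have "\<dots> \<in> V"
      using polys_overD[OF k(1), of j] by (intro subring_mult subring_power subring_of_nat R) simp
    finally show "coeff P j \<in> F \<inter> V" using polys_overD[OF P(1)] by simp
  qed
qed

text \<open>Substituting \<open>1 - X\<close> for \<open>X\<close> is an involution, so remainders
  can be written as polynomials in \<open>1 - X\<close>, ready for the Eisenstein lemmas at
  \<open>1 - z\<close>.\<close>

lemma cyclotomic_remainder:
  assumes P: "P \<in> polys_over F"
  obtains Q S where "S \<in> polys_over F" "P = prime_power_cyclotomic p n * Q + S \<circ>\<^sub>p [:1, -1:]"
    "degree S < (p - 1) * p ^ (n - 1)"
proof -
  have FR: "is_subring F" using F by auto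
  define \<Phi> where "\<Phi> = prime_power_cyclotomic p n"
  have \<Phi>: "\<Phi> \<in> polys_over F" "lead_coeff \<Phi> = 1" "degree \<Phi> = (p - 1) * p ^ (n - 1)"
    unfolding \<Phi>_def using prime_power_cyclotomic_over[OF p z FR] degree_prime_power_cyclotomic[OF p z] by auto
  have e: "degree \<Phi> > 0" using prime_gt_1_nat[OF p] by (simp add: \<Phi>(3))
  obtain Q T where T: "T \<in> polys_over F" "P = \<Phi> * Q + T" "T = 0 \<or> degree T < degree \<Phi>"
    using poly_division_over[OF FR \<Phi>(1,2) P] by metis
  define S where "S = T \<circ>\<^sub>p [:1, -1:]"
  have "S \<in> polys_over F" unfolding S_def
    by (intro polys_over_pcompose polys_over_pCons polys_over_zero subring_one subring_uminus FR T(1))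
  moreover have "S \<circ>\<^sub>p [:1, -1:] = T \<circ>\<^sub>p ([:1, -1:] \<circ>\<^sub>p [:1, -1:])"
    by (simp add: S_def pcompose_assoc)
  then have ST: "S \<circ>\<^sub>p [:1, -1:] = T" by (simp add: pcompose_pCons pcompose_idR)
  moreover have "degree S < degree \<Phi>"
    using T(3) e by (auto simp: S_def degree_pcompose)
  ultimately show ?thesis
    using T(2) by (intro that[of S Q]) (simp_all only: ST \<Phi>(3) \<Phi>_def[symmetric])
qed

text \<open>This makes \<open>P(z) \<mapsto> P(z^s)\<close> well defined and so replaces the
  automorphism over \<open>F\<close> that sends \<open>z\<close> to \<open>z^s\<close>.\<close>

lemma poly_root_power_zero:
  assumes P: "P \<in> polys_over F" "poly P z = 0" and s: "\<not> p dvd s"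
  shows "poly P (z ^ s) = 0"
proof -
  obtain Q S where S: "S \<in> polys_over F" "P = prime_power_cyclotomic p n * Q + S \<circ>\<^sub>p [:1, -1:]"
    "degree S < (p - 1) * p ^ (n - 1)"
    using cyclotomic_remainder[OF P(1)] .
  have "poly S (1 - z) = 0"
    using P(2) prime_power_cyclotomic_root[OF z] unfolding S(2) by (simp add: poly_pcompose)
  then have "S = 0" using eisenstein_nonzero S by blast
  then show ?thesis
    unfolding S(2) using prime_power_cyclotomic_root[OF prime_power_primitive_power[OF p z s]] by simp
qed

lemma poly_integral_coeffs:
  assumes P: "P \<in> polys_over F" "poly P z \<in> V"
  obtains Q where "Q \<in> polys_over (F \<inter> V)" "poly Q z = poly P z"
proof -
  have R: "is_subring (F \<inter> V)" using F val_ring_subring[OF V] by (auto simp: is_subfield_def is_subring_def)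
  obtain Q S where S: "S \<in> polys_over F" "P = prime_power_cyclotomic p n * Q + S \<circ>\<^sub>p [:1, -1:]"
    "degree S < (p - 1) * p ^ (n - 1)"
    using cyclotomic_remainder[OF P(1)] .
  have eq: "poly P z = poly S (1 - z)"
    using prime_power_cyclotomic_root[OF z] unfolding S(2) by (simp add: poly_pcompose)
  then have "S \<in> polys_over (F \<inter> V)" using eisenstein_integral S(1,3) P(2) by simp
  then have "S \<circ>\<^sub>p [:1, -1:] \<in> polys_over (F \<inter> V)"
    by (intro polys_over_pcompose polys_over_pCons polys_over_zero subring_one subring_uminus R)
  then show ?thesis using that eq by (simp add: poly_pcompose)
qed

text \<open>An integral representative \<open>Q\<close> takes the same values as \<open>P\<close> at
  \<open>z\<close> and, by \<open>poly_root_power_zero\<close>, at \<open>z^s\<close>; the Frobenius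
  congruence applies to \<open>Q\<close>.\<close>

lemma poly_root_power_cong:
  assumes P: "P \<in> polys_over F" "poly P z \<in> V" and s: "\<not> p dvd s" "z ^ (s * p ^ k) = z ^ (p ^ k)"
  shows "(poly P z ^ (p ^ Suc k) - poly P (z ^ s) ^ (p ^ Suc k)) / of_nat p ^ 2 \<in> V"
    and "poly P (z ^ s) \<in> V"
proof -
  have R: "is_subring V" by (rule val_ring_subring[OF V])
  have FR: "is_subring F" using F by auto
  obtain Q where Q: "Q \<in> polys_over (F \<inter> V)" "poly Q z = poly P z"
    using poly_integral_coeffs[OF P] .
  have QV: "Q \<in> polys_over V" and QF: "Q \<in> polys_over F"
    using Q(1) by (auto simp: polys_over_def)
  have "poly (P - Q) (z ^ s) = 0"
    using Q(2) by (intro poly_root_power_zero s(1) polys_over_diff FR P(1) QF) simp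
  then have eq: "poly P (z ^ s) = poly Q (z ^ s)" by simp
  have zV: "z \<in> V"
    by (rule algebraic_int_in_val_ring[OF V algebraic_int_prime_power_primitive[OF p z]])
  show "poly P (z ^ s) \<in> V" unfolding eq by (intro poly_in_subring R QV subring_power zV)
  show "(poly P z ^ (p ^ Suc k) - poly P (z ^ s) ^ (p ^ Suc k)) / of_nat p ^ 2 \<in> V"
    unfolding eq Q(2)[symmetric] by (rule poly_root_of_unity_cong[OF R p QV zV s(2)])
qed

text \<open>The form consumed by \<open>height_sum_lower_bound\<close>. If \<open>P(z)\<close> is
  not integral, its inverse is; the congruence for the inverses, multiplied by the local
  denominators, gives the claim.\<close>

lemma poly_root_power_cong_den:
  assumes alg: "\<And>x. x \<in> F \<Longrightarrow> algebraic x" and P: "P \<in> polys_over F"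
    and s: "\<not> p dvd s" "z ^ (s * p ^ k) = z ^ (p ^ k)"
  shows "(poly P z ^ (p ^ Suc k) - poly P (z ^ s) ^ (p ^ Suc k)) *
    val_den V (poly P z) ^ (p ^ Suc k) * val_den V (poly P (z ^ s)) ^ (p ^ Suc k) / of_nat p ^ 2 \<in> V"
proof (cases "poly P z \<in> V")
  case True
  then show ?thesis
    using poly_root_power_cong[OF P True s] by (simp add: val_den_def)
next
  case False
  define x where "x = poly P z"
  define y where "y = poly P (z ^ s)"
  define q where "q = p ^ Suc k"
  have R: "is_subring V" by (rule val_ring_subring[OF V])
  have FR: "is_subring F" using F by auto
  have algz: "algebraic z"
    by (rule algebraic_int_imp_algebraic[OF algebraic_int_prime_power_primitive[OF p z]])
  have xV: "x \<notin> V" using False by (simp add: x_def)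
  have x0: "x \<noteq> 0" using xV subring_zero[OF R] by auto
  have "x \<in> simple_ext F z" using P by (simp add: x_def simple_ext_def)
  moreover have "is_subfield (simple_ext F z)"
    using is_subfield_simple_ext[OF F alg algz] by blast
  ultimately have "inverse x \<in> simple_ext F z" by (intro subfield_inverse)
  then obtain Q where Q: "Q \<in> polys_over F" "poly Q z = inverse x" by (auto simp: simple_ext_def)
  have "poly (P * Q - 1) (z ^ s) = 0"
    using x0 Q(2) by (intro poly_root_power_zero s(1) polys_over_diff polys_over_mult polys_over_one FR P Q(1))
      (simp add: x_def)
  then have yQ: "y * poly Q (z ^ s) = 1" by (simp add: y_def)
  then have y0: "y \<noteq> 0" and inv_y: "poly Q (z ^ s) = inverse y" by (auto simp: inverse_unique)
  have QV: "poly Q z \<in> V" unfolding Q(2) by (rule val_ring_inverse[OF V xV])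
  have "(inverse x ^ q - inverse y ^ q) / of_nat p ^ 2 \<in> V"
    using poly_root_power_cong(1)[OF Q(1) QV s] by (simp only: q_def Q(2) inv_y)
  from subring_uminus[OF R this] have cong: "(inverse y ^ q - inverse x ^ q) / of_nat p ^ 2 \<in> V"
    by (simp add: minus_divide_left)
  have den_x: "val_den V x = inverse x" using xV by (simp add: val_den_def)
  have "(x ^ q - y ^ q) * val_den V x ^ q * val_den V y ^ q / of_nat p ^ 2 \<in> V"
  proof (cases "y \<in> V")
    case True
    have "(x ^ q - y ^ q) * val_den V x ^ q * val_den V y ^ q / of_nat p ^ 2 =
      (inverse y ^ q - inverse x ^ q) / of_nat p ^ 2 * y ^ q"
    proof -
      have "(a - b) * inverse a = (inverse b - inverse a) * b" if "a \<noteq> 0" "b \<noteq> 0" for a b :: complex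
        using that by (simp add: field_simps)
      from this[of "x ^ q" "y ^ q"] show ?thesis
        using True x0 y0 by (simp add: den_x val_den_def[of V y] power_inverse)
    qed
    also have "\<dots> \<in> V" by (intro subring_mult R cong subring_power True)
    finally show ?thesis .
  next
    case False
    have "(x ^ q - y ^ q) * val_den V x ^ q * val_den V y ^ q / of_nat p ^ 2 =
      (inverse y ^ q - inverse x ^ q) / of_nat p ^ 2"
      using False x0 y0 by (simp add: den_x val_den_def[of V y] power_inverse field_simps)
    then show ?thesis using cong by (simp only:)
  qed
  then show ?thesis by (simp only: x_def y_def q_def)
qed

end

subsection \<open>Normality and the height gap\<close>

lemma map_poly_of_rat_mult:
  "map_poly of_rat (f * g) = (map_poly of_rat f * map_poly of_rat g :: complex poly)"
  by (intro poly_eqI) (simp add: coeff_map_poly coeff_mult of_rat_sum of_rat_mult)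

text \<open>Normality speaks of irreducible rational polynomials, so an irreducible factor over the
  rationals vanishing at \<open>x\<close> is chosen from the minimal polynomial; every conjugate is
  a root of it.\<close>

lemma galois_conjugates_subset:
  assumes F: "galois_over_rats F" and x: "x \<in> F"
  shows "conjugates x \<subseteq> F"
proof -
  have alg: "algebraic x" using assms by (auto simp: galois_over_rats_def)
  define ev where "ev = (\<lambda>f :: rat poly. poly (map_poly of_rat f) x)"
  have ev_mult: "ev (f * g) = ev f * ev g" for f g by (simp add: ev_def map_poly_of_rat_mult)
  have ev_1: "ev 1 = 1" by (simp add: ev_def)
  define h :: "rat poly" where "h = map_poly of_int (int_min_poly x)"
  have "h \<noteq> 0" using int_min_poly_nonzero[OF alg] by (simp add: h_def map_poly_eq_0_iff)
  have "map_poly of_rat h = (map_poly of_int (int_min_poly x) :: complex poly)"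
    by (intro poly_eqI) (simp add: h_def coeff_map_poly)
  then have "ev h = 0" using poly_int_min_poly[OF alg] by (simp add: ev_def)
  then obtain f where prime: "prime_elem f" and f: "ev f = 0"
    using irreducible_factor_root[of ev h, OF ev_mult ev_1 \<open>h \<noteq> 0\<close>] by metis
  from prime have "Factorial_Ring.irreducible f" by (rule prime_elem_imp_irreducible)
  then have roots: "{y. poly (map_poly of_rat f) y = 0} \<subseteq> F"
    using F x f unfolding galois_over_rats_def ev_def by blast
  have "map_poly of_rat f \<in> polys_over \<rat>" by (simp add: polys_over_def coeff_map_poly)
  then have "poly (map_poly of_rat f) y = 0" if "y \<in> conjugates x" for y
    using poly_conjugate_zero[OF alg that] f by (simp add: ev_def)
  then show ?thesis using roots by blast
qed

lemma prime_power_primitive_roots: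
  assumes p: "Factorial_Ring.prime p" and w: "prime_power_primitive p n w" and x: "x ^ (p ^ n) = 1"
  obtains m where "m < p ^ n" "x = w ^ m"
proof -
  have w1: "w ^ (p ^ n) = 1" using w by (simp add: prime_power_primitive_def)
  have pn: "p ^ n > 0" using prime_gt_0_nat[OF p] by simp
  have "(w ^ m) ^ (p ^ n) = 1" for m
    using w1 by (metis power_commutes power_mult mult.commute power_one)
  then have "(\<lambda>m. w ^ m) ` {..<p ^ n} \<subseteq> {y. y ^ (p ^ n) = 1}" by auto
  moreover have "card ((\<lambda>m. w ^ m) ` {..<p ^ n}) = card {y :: complex. y ^ (p ^ n) = 1}"
    using card_roots_unity_eq[OF pn] card_image[OF inj_on_root_powers[OF p w]] by simp
  moreover have "finite {y :: complex. y ^ (p ^ n) = 1}"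
    using card_roots_unity_eq[OF pn] pn card_ge_0_finite[of "{y :: complex. y ^ (p ^ n) = 1}"] by linarith
  ultimately have "(\<lambda>m. w ^ m) ` {..<p ^ n} = {y. y ^ (p ^ n) = 1}" by (intro card_subset_eq)
  then have "x \<in> (\<lambda>m. w ^ m) ` {..<p ^ n}" using x by simp
  then show ?thesis using that by blast
qed

text \<open>By counting: \<open>X^(p^n) - 1\<close> has more roots than
  \<open>X^(p^(n-1)) - 1\<close>.\<close>

lemma prime_power_primitive_exists:
  assumes p: "Factorial_Ring.prime p" and n: "n > 0"
  obtains w where "prime_power_primitive p n w"
proof -
  have lt: "p ^ (n - 1) < p ^ n" using prime_gt_1_nat[OF p] n by (intro power_strict_increasing) auto
  have pos: "p ^ (n - 1) > 0" "p ^ n > 0" using prime_gt_0_nat[OF p] by simp_all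
  have fin: "finite {y :: complex. y ^ (p ^ (n - 1)) = 1}"
    using card_roots_unity_eq[OF pos(1)] pos card_ge_0_finite[of "{y :: complex. y ^ (p ^ (n - 1)) = 1}"] by linarith
  have "\<not> {y :: complex. y ^ (p ^ n) = 1} \<subseteq> {y. y ^ (p ^ (n - 1)) = 1}"
  proof
    assume "{y :: complex. y ^ (p ^ n) = 1} \<subseteq> {y. y ^ (p ^ (n - 1)) = 1}"
    from card_mono[OF fin this] show False
      unfolding card_roots_unity_eq[OF pos(1)] card_roots_unity_eq[OF pos(2)] using lt by simp
  qed
  then obtain w :: complex where "w ^ (p ^ n) = 1" "w ^ (p ^ (n - 1)) \<noteq> 1" by blast
  then show ?thesis using that n by (simp add: prime_power_primitive_def)
qed

lemma prime_power_primitive_pow_prime: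
  assumes "prime_power_primitive p n w" "j < n"
  shows "prime_power_primitive p (n - j) (w ^ (p ^ j))"
proof -
  have "p ^ j * p ^ (n - j) = p ^ n" "p ^ j * p ^ (n - j - 1) = p ^ (n - 1)"
    using assms(2) by (simp_all flip: power_add)
  then have "(w ^ (p ^ j)) ^ (p ^ (n - j)) = w ^ (p ^ n)" "(w ^ (p ^ j)) ^ (p ^ (n - j - 1)) = w ^ (p ^ (n - 1))"
    by (simp_all only: power_mult[symmetric])
  then show ?thesis using assms by (simp add: prime_power_primitive_def)
qed

section \<open>The height gap, the descent and the induction on the level\<close>

context
  fixes F :: "complex set" and p :: nat
  assumes p: "Factorial_Ring.prime p" and galois: "galois_over_rats F" and unram: "unramified_at F p"
begin

lemma galois_subfield: "is_subfield F"
  using galois by (simp add: galois_over_rats_def subfield_complex_ring_iff)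

lemma galois_subring: "is_subring F"
  using galois_subfield by auto

lemma galois_algebraic: "x \<in> F \<Longrightarrow> algebraic x"
  using galois by (simp add: galois_over_rats_def)

lemma galois_uniformizer:
  assumes "val_ring p V" "x \<in> F" "x \<noteq> 0"
  shows "\<exists>k. val_unit V (x * of_nat p powi k)"
  using unramified_valuation[OF assms(1) galois_subfield galois_algebraic unram assms(2,3)] by blast

text \<open>The conclusion is free of \<open>V\<close>; any one valuation ring above
  \<open>p\<close> certifies it.\<close>

lemma root_power_zero:
  assumes z: "prime_power_primitive p n z" and P: "P \<in> polys_over F" "poly P z = 0" and s: "\<not> p dvd s"
  shows "poly P (z ^ s) = 0"
proof -
  obtain V where V: "val_ring p V" using val_ring_exists[OF p] .
  show ?thesis
    by (rule poly_root_power_zero[OF galois_subfield p z V galois_uniformizer[OF V] P s])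
qed

lemma algebraic_prime_power_primitive: "prime_power_primitive p n z \<Longrightarrow> algebraic z"
  by (rule algebraic_int_imp_algebraic[OF algebraic_int_prime_power_primitive[OF p]])

lemma is_subfield_adjoin_root: "prime_power_primitive p n z \<Longrightarrow> is_subfield (simple_ext F z)"
  using is_subfield_simple_ext[OF galois_subfield] galois_algebraic algebraic_prime_power_primitive by blast

lemma algebraic_adjoin_root:
  assumes "prime_power_primitive p n z" "x \<in> simple_ext F z"
  shows "algebraic x"
proof -
  have "simple_ext F z \<subseteq> {x. algebraic x}"
    using galois_algebraic algebraic_prime_power_primitive[OF assms(1)]
    by (intro simple_ext_minimal is_subring_algebraic) auto
  then show ?thesis using assms(2) by blast
qed

text \<open>The congruence is needed at every conjugate \<open>d\<close> of a generator
  \<open>\<delta>\<close> for \<open>z\<close> and the coefficients of \<open>P\<close>. Conjugation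
  turns \<open>z\<close> into another primitive root \<open>w\<close> and, by normality, the
  coefficients into elements of \<open>F\<close>, so the local lemma applies to \<open>Pd\<close>
  and \<open>w\<close>. The factor 2 in the denominator appears because \<open>P(z)\<close> and
  \<open>P(z^s)\<close> have equal height.\<close>

lemma height_gap:
  assumes z: "prime_power_primitive p n z" and P: "P \<in> polys_over F"
    and s: "\<not> p dvd s" "z ^ (s * p ^ k) = z ^ (p ^ k)"
    and neq: "poly P z ^ (p ^ Suc k) \<noteq> poly P (z ^ s) ^ (p ^ Suc k)"
  shows "(2 * ln p - ln 2) / (2 * p ^ Suc k) \<le> weil_height (poly P z)"
proof -
  define q where "q = p ^ Suc k"
  have q0: "q > 0" using prime_gt_0_nat[OF p] by (simp add: q_def)
  define S where "S = insert z (coeff P ` {..degree P})"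
  have "algebraic x" if "x \<in> S" for x
    using that galois_algebraic polys_overD[OF P] algebraic_prime_power_primitive[OF z] by (auto simp: S_def)
  moreover have "finite S" by (simp add: S_def)
  ultimately obtain \<delta> where \<delta>: "algebraic \<delta>" "S \<subseteq> simple_ext \<rat> \<delta>"
    using primitive_element_finite[of S] by metis
  have "\<forall>x\<in>S. \<exists>A. A \<in> polys_over \<rat> \<and> x = poly A \<delta>" using \<delta>(2) by (auto simp: simple_ext_def)
  then obtain rep where rep: "\<And>x. x \<in> S \<Longrightarrow> rep x \<in> polys_over \<rat> \<and> x = poly (rep x) \<delta>"
    by (metis (no_types))
  define Z where "Z = rep z"
  define c where "c = (\<lambda>i. rep (coeff P i))"
  have Z: "Z \<in> polys_over \<rat>" "poly Z \<delta> = z" using rep[of z] by (simp_all add: S_def Z_def)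
  have c: "c i \<in> polys_over \<rat>" "poly (c i) \<delta> = coeff P i" if "i \<le> degree P" for i
    using rep[of "coeff P i"] that by (simp_all add: S_def c_def)
  define A where "A = (\<Sum>i\<le>degree P. c i * Z ^ i)"
  define B where "B = (\<Sum>i\<le>degree P. c i * (Z ^ s) ^ i)"
  have AB: "A \<in> polys_over \<rat>" "B \<in> polys_over \<rat>"
    unfolding A_def B_def using c(1) Z(1)
    by (auto intro!: polys_over_sum polys_over_mult polys_over_power is_subring_Rats)
  have A\<delta>: "poly A \<delta> = poly P z" and B\<delta>: "poly B \<delta> = poly P (z ^ s)"
    using c(2) by (simp_all add: A_def B_def poly_sum Z(2) poly_altdef[of P])
  have "(2 * ln p - ln 2) \<le> q * (weil_height (poly A \<delta>) + weil_height (poly B \<delta>))"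
  proof (rule height_sum_lower_bound[OF \<delta>(1) AB p, where k = 2, simplified])
    show "poly A \<delta> ^ q \<noteq> poly B \<delta> ^ q" using neq by (simp add: A\<delta> B\<delta> q_def)
  next
    fix V d assume V: "val_ring p V" and d: "d \<in> conjugates \<delta>"
    define w where "w = poly Z d"
    define Pd where "Pd = (\<Sum>i\<le>degree P. Polynomial.monom (poly (c i) d) i)"
    have Ad: "poly A d = poly Pd w" and Bd: "poly B d = poly Pd (w ^ s)"
      by (simp_all add: A_def B_def Pd_def w_def poly_sum poly_monom)
    have "poly (c i) d \<in> F" if "i \<le> degree P" for i
    proof -
      have "poly (c i) d \<in> conjugates (poly (c i) \<delta>)"
        using conjugates_poly[OF \<delta>(1) c(1)[OF that]] d by blast
      then show ?thesis
        using galois_conjugates_subset[OF galois polys_overD[OF P, of i]] c(2)[OF that] by auto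
    qed
    then have Pd: "Pd \<in> polys_over F"
      unfolding Pd_def by (auto intro!: polys_over_sum polys_over_monom galois_subring)
    have pow: "w ^ m = 1 \<longleftrightarrow> z ^ m = 1" for m
    proof -
      have "Z ^ m - 1 \<in> polys_over \<rat>"
        by (intro polys_over_diff polys_over_power polys_over_one is_subring_Rats Z(1))
      from poly_conjugate_zero_iff[OF \<delta>(1) d this] show ?thesis by (simp add: w_def Z(2))
    qed
    have "Z ^ (s * p ^ k) - Z ^ (p ^ k) \<in> polys_over \<rat>"
      by (intro polys_over_diff polys_over_power is_subring_Rats Z(1))
    from poly_conjugate_zero[OF \<delta>(1) d this] have sk: "w ^ (s * p ^ k) = w ^ (p ^ k)"
      using s(2) by (simp add: w_def Z(2))
    have w: "prime_power_primitive p n w" using z by (simp add: prime_power_primitive_def pow)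
    show "(poly A d ^ q - poly B d ^ q) * val_den V (poly A d) ^ q * val_den V (poly B d) ^ q / (of_nat p)\<^sup>2 \<in> V"
      unfolding Ad Bd q_def
      by (rule poly_root_power_cong_den[OF galois_subfield p w V galois_uniformizer[OF V] galois_algebraic Pd s(1) sk])
  qed
  also have "weil_height (poly B \<delta>) = weil_height (poly P z)"
  proof -
    define x where "x = poly P z"
    have "x \<in> simple_ext F z" using P by (simp add: x_def simple_ext_def)
    then have x: "algebraic x" by (rule algebraic_adjoin_root[OF z])
    \<comment> \<open>The minimal polynomial of \<open>x\<close> composed with \<open>P\<close> is a
      relation over \<open>F\<close> satisfied by \<open>z\<close>, so it passes to
      \<open>z^s\<close> and shows that \<open>P(z^s)\<close> is conjugate to
      \<open>x\<close>.\<close>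
    define G where "G = map_poly of_int (int_min_poly x) \<circ>\<^sub>p P"
    have "G \<in> polys_over F"
      unfolding G_def using subring_Ints[OF galois_subring]
      by (intro polys_over_pcompose galois_subring P polys_over_mono[OF _ polys_over_map_of_int]) auto
    moreover have "poly G z = 0" using poly_int_min_poly[OF x] by (simp add: G_def poly_pcompose x_def)
    ultimately have "poly G (z ^ s) = 0" by (rule root_power_zero[OF z _ _ s(1)])
    then have "poly P (z ^ s) \<in> conjugates x" by (simp add: G_def poly_pcompose conjugates_def)
    then show ?thesis using weil_height_conjugate[OF x] by (simp add: B\<delta> x_def)
  qed
  finally have "2 * ln p - ln 2 \<le> 2 * q * weil_height (poly P z)" by (simp add: A\<delta>)
  then show ?thesis using q0 unfolding q_def[symmetric] by (simp add: field_simps)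
qed

text \<open>The automorphism \<open>z \<mapsto> z\<^sup>s\<close>, \<open>s = 1 + p\<^sup>n\<^sup>-\<^sup>1\<close>, over \<open>F(z\<^sup>p)\<close> maps \<open>z\<close> to \<open>z w\<close> with \<open>w\<close> of order \<open>p\<close>. If
  it multiplies \<open>P(z)\<close> by a root of unity \<open>\<eta>\<close>, then \<open>\<eta>\<close> is fixed by it, so \<open>\<eta>\<^sup>p = 1\<close> and \<open>\<eta>\<close> is the
  factor by which some power of \<open>z\<close> is multiplied.\<close>
lemma descent:
  assumes z: "prime_power_primitive p n z" and n: "n \<ge> 3" and P: "P \<in> polys_over F" "poly P z \<noteq> 0"
    and eq: "poly P (z ^ (1 + p ^ (n - 1))) ^ (p\<^sup>2) = poly P z ^ (p\<^sup>2)"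
  obtains r where "z ^ r * poly P z \<in> simple_ext F (z ^ p)"
proof -
  define w where "w = z ^ (p ^ (n - 1))"
  define s where "s = 1 + p ^ (n - 1)"
  define x where "x = poly P z"
  have FR: "is_subring F" by (rule galois_subring)
  have p0: "p > 0" using prime_gt_0_nat[OF p] .
  have w: "prime_power_primitive p 1 w"
    using prime_power_primitive_pow_prime[OF z, of "n - 1"] n by (simp add: w_def)
  have wp: "w ^ p = 1" using w by (simp add: prime_power_primitive_def)
  have zs: "z ^ s = z * w" by (simp add: s_def w_def)
  define \<eta> where "\<eta> = poly P (z ^ s) / x"
  have x0: "x \<noteq> 0" using P(2) by (simp add: x_def)
  have "\<eta> ^ (p\<^sup>2) = 1" using eq x0 by (simp add: \<eta>_def s_def x_def power_divide)
  moreover have "prime_power_primitive p 2 (z ^ (p ^ (n - 2)))"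
    using prime_power_primitive_pow_prime[OF z, of "n - 2"] n by simp
  ultimately obtain m where m: "\<eta> = (z ^ (p ^ (n - 2))) ^ m"
    using prime_power_primitive_roots[OF p] by metis
  define l where "l = p ^ (n - 2) * m"
  have \<eta>: "\<eta> = z ^ l" unfolding m l_def by (rule power_mult[symmetric])
  \<comment> \<open>This is where \<open>n \<ge> 3\<close> matters: \<open>p\<close> divides
    \<open>l\<close>, so \<open>\<eta> = z^l\<close> is fixed by
    \<open>z \<mapsto> z w\<close>.\<close>
  have wl: "w ^ l = 1"
  proof -
    have "n - 2 = Suc (n - 3)" using n by simp
    then have "p ^ (n - 2) = p * p ^ (n - 3)" by simp
    then have "l = p * (p ^ (n - 3) * m)" by (simp add: l_def)
    then show ?thesis using wp by (simp add: power_mult)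
  qed
  have ps: "\<not> p dvd 1 + j * p ^ (n - 1)" for j
  proof
    assume "p dvd 1 + j * p ^ (n - 1)"
    moreover have "p dvd j * p ^ (n - 1)" using n by (intro dvd_mult dvd_power) auto
    ultimately have "p dvd 1" using dvd_add_left_iff by blast
    then show False using prime_gt_1_nat[OF p] by simp
  qed
  have zw: "z ^ (1 + j * p ^ (n - 1)) = z * w ^ j" for j
    by (simp add: w_def mult.commute flip: power_mult)
  have step: "poly P (z * w ^ Suc j) = \<eta> * poly P (z * w ^ j)" for j
  proof -
    \<comment> \<open>The equation \<open>\<sigma>(x) = \<eta> x\<close> as a polynomial relation at
      \<open>z\<close>; it is inherited by every \<open>z w^j\<close>.\<close>
    define T where "T = P \<circ>\<^sub>p Polynomial.monom 1 s - Polynomial.monom 1 l * P"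
    have T: "T \<in> polys_over F" unfolding T_def
      by (intro polys_over_diff polys_over_mult polys_over_pcompose polys_over_monom subring_one FR P(1))
    have "poly T z = 0"
      using x0 by (simp add: T_def poly_pcompose poly_monom \<eta>_def x_def flip: \<eta>)
    from root_power_zero[OF z T this ps, of j] have "poly T (z * w ^ j) = 0" by (simp only: zw)
    then have "poly P ((z * w ^ j) ^ s) = (z * w ^ j) ^ l * poly P (z * w ^ j)"
      by (simp add: T_def poly_pcompose poly_monom)
    moreover have "(z * w ^ j) ^ s = z * w ^ Suc j"
    proof -
      have "w ^ s = w"
      proof -
        have "p dvd p ^ (n - 1)" using n by (intro dvd_power) auto
        then obtain r where "p ^ (n - 1) = p * r" by (rule dvdE)
        then show ?thesis using wp by (simp add: s_def power_mult)
      qed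
      then have "(w ^ j) ^ s = w ^ j" by (metis power_mult mult.commute)
      then show ?thesis by (simp add: power_mult_distrib zs)
    qed
    moreover have "(z * w ^ j) ^ l = \<eta>"
    proof -
      have "(w ^ j) ^ l = 1" using wl by (metis power_mult mult.commute power_one)
      then show ?thesis by (simp add: power_mult_distrib \<eta>)
    qed
    ultimately show ?thesis by simp
  qed
  have iter: "poly P (z * w ^ j) = \<eta> ^ j * x" for j
  proof (induction j)
    case (Suc j)
    then show ?case unfolding step by simp
  qed (simp add: x_def)
  \<comment> \<open>After \<open>p\<close> applications the automorphism has returned to the
    identity.\<close>
  have "\<eta> ^ p = 1" using iter[of p] wp x0 by (simp add: x_def)
  then have "\<eta> ^ (p ^ 1) = 1" by simp
  from prime_power_primitive_roots[OF p w this] obtain r' where r': "r' < p ^ 1" "\<eta> = w ^ r'" .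
  \<comment> \<open>The automorphism multiplies \<open>z^r\<close> by \<open>w^r\<close>, which
    cancels \<open>\<eta> = w^r'\<close>, so \<open>z^r x\<close> is invariant.\<close>
  define r where "r = p - r'"
  have w_r: "w ^ r * \<eta> = 1" using r' wp by (simp add: r_def flip: power_add)
  define T where "T = Polynomial.monom 1 r * P"
  have T: "T \<in> polys_over F" unfolding T_def
    by (intro polys_over_mult polys_over_monom subring_one FR P(1))
  define y where "y = z ^ r * x"
  have Ty: "poly T (z * w ^ j) = y" for j
  proof -
    have "poly T (z * w ^ j) = z ^ r * (w ^ j) ^ r * (\<eta> ^ j * x)"
      by (simp add: T_def poly_monom iter power_mult_distrib)
    also have "(w ^ j) ^ r = (w ^ r) ^ j" by (metis power_mult mult.commute)
    also have "z ^ r * (w ^ r) ^ j * (\<eta> ^ j * x) = (w ^ r * \<eta>) ^ j * y"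
      by (simp add: y_def power_mult_distrib mult_ac)
    finally show ?thesis by (simp add: w_r)
  qed
  have geo: "(\<Sum>j<p. (w ^ i) ^ j) = (if p dvd i then of_nat p else 0)" for i
  proof (cases "p dvd i")
    case True
    then have "w ^ i = 1" using wp by (auto simp: dvd_def power_mult)
    then show ?thesis using True by simp
  next
    case False
    then have "w ^ i \<noteq> 1" using prime_power_primitive_eq_1_iff[OF p w] by simp
    moreover have "(w ^ i) ^ p = 1" using wp by (metis power_mult mult.commute power_one)
    ultimately show ?thesis using False by (simp add: sum_gp_strict)
  qed
  \<comment> \<open>Averaging over the automorphisms: the sum over \<open>j\<close> annihilates the
    monomials whose exponent is not divisible by \<open>p\<close>, and the surviving ones lie in
    \<open>F(z^p)\<close>.\<close>
  have "of_nat p * y = (\<Sum>j<p. poly T (z * w ^ j))" by (simp add: Ty)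
  also have "\<dots> = (\<Sum>j<p. \<Sum>i\<le>degree T. coeff T i * z ^ i * (w ^ i) ^ j)"
  proof (intro sum.cong refl)
    fix j
    have "(w ^ j) ^ i = (w ^ i) ^ j" for i by (metis power_mult mult.commute)
    then show "poly T (z * w ^ j) = (\<Sum>i\<le>degree T. coeff T i * z ^ i * (w ^ i) ^ j)"
      by (simp add: poly_altdef power_mult_distrib mult.assoc)
  qed
  also have "\<dots> = (\<Sum>i\<le>degree T. \<Sum>j<p. coeff T i * z ^ i * (w ^ i) ^ j)" by (rule sum.swap)
  also have "\<dots> = (\<Sum>i\<le>degree T. coeff T i * z ^ i * (if p dvd i then of_nat p else 0))"
    by (simp only: sum_distrib_left[symmetric] geo)
  also have "\<dots> = of_nat p * (\<Sum>i\<le>degree T. if p dvd i then coeff T i * z ^ i else 0)"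
    unfolding sum_distrib_left by (intro sum.cong refl) simp
  finally have "y = (\<Sum>i\<le>degree T. if p dvd i then coeff T i * z ^ i else 0)" using p0 by simp
  also have "\<dots> \<in> simple_ext F (z ^ p)"
  proof (rule subring_sum)
    have R: "is_subring (simple_ext F (z ^ p))" by (rule is_subring_simple_ext[OF FR])
    then show "is_subring (simple_ext F (z ^ p))" .
    fix i
    show "(if p dvd i then coeff T i * z ^ i else 0) \<in> simple_ext F (z ^ p)"
    proof (cases "p dvd i")
      case True
      then obtain j where "i = p * j" by (rule dvdE)
      then have "coeff T i * z ^ i = coeff T i * (z ^ p) ^ j" by (simp add: power_mult)
      also have "\<dots> \<in> simple_ext F (z ^ p)"
        by (intro subring_mult subring_power R simple_ext_gen FR simple_ext_base polys_overD[OF T])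
      finally show ?thesis using True by simp
    qed (simp add: subring_zero[OF R])
  qed
  finally show ?thesis using that[of r] by (simp add: y_def x_def)
qed

text \<open>A polynomial of degree less than \<open>\<phi>(p\<^sup>n)\<close> that takes the same value at all primitive
  \<open>p\<^sup>n\<close>-th roots of unity is constant.\<close>
lemma fixed_by_galois_group:
  assumes z: "prime_power_primitive p n z" and P: "P \<in> polys_over F"
    and fixed: "\<And>s. \<not> p dvd s \<Longrightarrow> poly P (z ^ s) = poly P z"
  shows "poly P z \<in> F"
proof -
  define e where "e = (p - 1) * p ^ (n - 1)"
  have n: "n > 0" using z by (simp add: prime_power_primitive_def)
  obtain V where V: "val_ring p V" using val_ring_exists[OF p] .
  obtain Q S where S: "S \<in> polys_over F" "P = prime_power_cyclotomic p n * Q + S \<circ>\<^sub>p [:1, -1:]" "degree S < e"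
    using cyclotomic_remainder[OF galois_subfield p z V galois_uniformizer[OF V] P] unfolding e_def by blast
  define T where "T = S \<circ>\<^sub>p [:1, -1:]"
  have T: "T \<in> polys_over F" unfolding T_def
    by (intro polys_over_pcompose polys_over_pCons polys_over_zero subring_one subring_uminus galois_subring S(1))
  have val: "poly T (z ^ s) = poly P z" if s: "\<not> p dvd s" for s
    using fixed[OF s] prime_power_cyclotomic_root[OF prime_power_primitive_power[OF p z s]]
    by (simp add: S(2) T_def)
  define U where "U = T - [:poly P z:]"
  have "degree T < e" using S(3) by (simp add: T_def degree_pcompose)
  then have degU: "degree U < e" unfolding U_def by (intro degree_diff_less) auto
  have "U = 0"
  proof (rule ccontr)
    assume "U \<noteq> 0"
    have "(\<lambda>s. z ^ s) ` coprime_residues p n \<subseteq> {y. poly U y = 0}"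
      using val by (auto simp: U_def coprime_residues_def)
    then have "card ((\<lambda>s. z ^ s) ` coprime_residues p n) \<le> card {y. poly U y = 0}"
      by (intro card_mono poly_roots_finite \<open>U \<noteq> 0\<close>)
    also have "\<dots> \<le> degree U" by (rule card_poly_roots_bound[OF \<open>U \<noteq> 0\<close>])
    finally have "card (coprime_residues p n) \<le> degree U"
      by (simp only: card_image[OF inj_on_root_powers_coprime[OF p z]])
    then show False
      using degU card_coprime_residues[OF prime_gt_0_nat[OF p] n] by (simp add: e_def)
  qed
  then have "coeff T 0 = poly P z" by (simp add: U_def)
  then show ?thesis using polys_overD[OF T, of 0] by simp
qed

text \<open>Level 2 loses the factor \<open>p^3\<close> in both alternatives, the gap and the appeal
  to property (B). A higher level loses \<open>p^2\<close> in the gap case and nothing in the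
  descent, so the bound is independent of \<open>n\<close>.\<close>

lemma height_bound_adjoin:
  assumes c: "c > 0" "\<And>x. x \<in> F \<Longrightarrow> x \<noteq> 0 \<Longrightarrow> \<not> root_of_unity x \<Longrightarrow> c \<le> weil_height x"
    and n: "n \<ge> 2" and z: "prime_power_primitive p n z"
    and x: "x \<in> simple_ext F z" "x \<noteq> 0" "\<not> root_of_unity x"
  shows "min c ((2 * ln p - ln 2) / 2) / p ^ 3 \<le> weil_height x"
  using n z x
proof (induction n arbitrary: z x rule: dec_induct)
  define C where "C = min c ((2 * ln p - ln 2) / 2)"
  have p1: "real p \<ge> 2" using prime_ge_2_nat[OF p] by simp
  have "ln 2 \<le> ln (real p)" using p1 by (intro ln_mono) auto
  then have gap: "2 * ln (real p) - ln 2 > 0" by (smt (verit) ln_gt_zero)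
  have C: "C \<le> c" "C \<le> (2 * ln p - ln 2) / 2"
    unfolding C_def by (rule min.cobounded1, rule min.cobounded2)
  {
    case (base z x)
    have algx: "algebraic x" by (rule algebraic_adjoin_root[OF base(1,2)])
    obtain P where P: "P \<in> polys_over F" "x = poly P z" using base(2) by (auto simp: simple_ext_def)
    have z1: "z ^ (p ^ 2) = 1" using base(1) by (simp add: prime_power_primitive_def)
    show ?case
    proof (cases "\<exists>s. \<not> p dvd s \<and> poly P z ^ (p ^ 3) \<noteq> poly P (z ^ s) ^ (p ^ 3)")
      case True
      then obtain s where s: "\<not> p dvd s" "poly P z ^ (p ^ Suc 2) \<noteq> poly P (z ^ s) ^ (p ^ Suc 2)" by auto
      \<comment> \<open>At level 2 both sides are 1, so \<open>k = 2\<close> is admissible for every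
        \<open>s\<close>.\<close>
      have "z ^ (s * p ^ 2) = z ^ (p ^ 2)" using z1 by (metis mult.commute power_mult power_one)
      from height_gap[OF base(1) P(1) s(1) this s(2)]
      have "(2 * ln p - ln 2) / 2 / p ^ 3 \<le> weil_height x" by (simp add: P(2) numeral_3_eq_3)
      moreover have "C / p ^ 3 \<le> (2 * ln p - ln 2) / 2 / p ^ 3" using C(2) by (intro divide_right_mono) auto
      ultimately show ?thesis by (simp add: C_def)
    next
      case False
      define T where "T = P ^ (p ^ 3)"
      have T: "T \<in> polys_over F" unfolding T_def by (intro polys_over_power galois_subring P(1))
      have "poly T z \<in> F"
        using False by (intro fixed_by_galois_group[OF base(1) T]) (auto simp: T_def)
      then have xF: "x ^ (p ^ 3) \<in> F" by (simp add: T_def P(2))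
      have "\<not> root_of_unity (x ^ (p ^ 3))"
      proof
        assume "root_of_unity (x ^ (p ^ 3))"
        then obtain N where "N > 0" "(x ^ (p ^ 3)) ^ N = 1" by (auto simp: root_of_unity_def)
        then have "p ^ 3 * N > 0" "x ^ (p ^ 3 * N) = 1"
          using prime_gt_0_nat[OF p] by (simp_all add: power_mult)
        then show False using base(4) unfolding root_of_unity_def by blast
      qed
      then have "c \<le> weil_height (x ^ (p ^ 3))" using c(2)[OF xF] base(3) by simp
      also have "\<dots> \<le> real (p ^ 3) * weil_height x" by (rule height_power_le[OF algx])
      finally have "C \<le> weil_height x * real p ^ 3" using C(1) by (simp add: mult.commute)
      then have "C / real p ^ 3 \<le> weil_height x" using p1 by (subst pos_divide_le_eq) auto
      then show ?thesis by (simp add: C_def)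
    qed
  next
    case (step n z x)
    have algx: "algebraic x" by (rule algebraic_adjoin_root[OF step(4,5)])
    obtain P where P: "P \<in> polys_over F" "x = poly P z" using step(5) by (auto simp: simple_ext_def)
    have z1: "z ^ (p ^ Suc n) = 1" using step(4) by (simp add: prime_power_primitive_def)
    \<comment> \<open>The level is \<open>Suc n\<close>, so this is the exponent of
      \<open>descent\<close>. Because \<open>s p = p + p^(n+1)\<close>, it fixes \<open>z^p\<close>,
      and \<open>k = 1\<close> is admissible.\<close>
    define s where "s = 1 + p ^ n"
    show ?case
    proof (cases "poly P (z ^ s) ^ (p\<^sup>2) = poly P z ^ (p\<^sup>2)")
      case False
      have "\<not> p dvd s"
      proof
        assume "p dvd s"
        moreover have "p dvd p ^ n" using step(1) by (intro dvd_power) auto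
        ultimately have "p dvd 1" unfolding s_def using dvd_add_left_iff by blast
        then show False using prime_gt_1_nat[OF p] by simp
      qed
      moreover have "z ^ (s * p ^ 1) = z ^ (p ^ 1)"
      proof -
        have "s * p ^ 1 = p ^ 1 + p ^ Suc n" by (simp add: s_def)
        then show ?thesis using z1 by (simp only: power_add) simp
      qed
      moreover have "poly P z ^ (p ^ Suc 1) \<noteq> poly P (z ^ s) ^ (p ^ Suc 1)"
        using False by (simp add: numeral_2_eq_2)
      ultimately have "(2 * ln p - ln 2) / (2 * p ^ Suc 1) \<le> weil_height x"
        unfolding P(2) by (rule height_gap[OF step(4) P(1)])
      moreover have "C / p ^ 3 \<le> (2 * ln p - ln 2) / (2 * p ^ Suc 1)"
      proof -
        have "C / p ^ 3 \<le> (2 * ln p - ln 2) / 2 / p ^ 3" using C(2) by (intro divide_right_mono) auto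
        also have "\<dots> \<le> (2 * ln p - ln 2) / 2 / p ^ 2"
          using gap p1 by (intro divide_left_mono power_increasing) auto
        finally show ?thesis by (simp add: numeral_2_eq_2)
      qed
      ultimately show ?thesis by (simp add: C_def)
    next
      case True
      have "poly P z \<noteq> 0" using step(6) P(2) by simp
      moreover have "Suc n \<ge> 3" using step(1) by simp
      ultimately obtain r where r: "z ^ r * poly P z \<in> simple_ext F (z ^ p)"
        using descent[OF step(4) _ P(1)] True unfolding s_def by auto
      define y where "y = x * z ^ r"
      have y: "y \<in> simple_ext F (z ^ p)" using r by (simp add: y_def P(2) mult.commute)
      have z0: "z \<noteq> 0" using z1 prime_gt_0_nat[OF p] by (auto simp: power_0_left split: if_splits)
      have y0: "y \<noteq> 0" using step(6) z0 by (simp add: y_def)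
      have zr: "(z ^ r) ^ (p ^ Suc n) = 1" using z1 by (metis power_mult mult.commute power_one)
      have pos: "p ^ Suc n > 0" using prime_gt_0_nat[OF p] by simp
      have "\<not> root_of_unity y"
      proof
        assume "root_of_unity y"
        then obtain N where N: "N > 0" "y ^ N = 1" by (auto simp: root_of_unity_def)
        have "y ^ (N * p ^ Suc n) = x ^ (N * p ^ Suc n) * ((z ^ r) ^ (p ^ Suc n)) ^ N"
          unfolding y_def power_mult_distrib by (metis power_mult mult.commute)
        moreover have "y ^ (N * p ^ Suc n) = 1" by (simp only: power_mult N(2) power_one)
        ultimately have "x ^ (N * p ^ Suc n) = 1" by (simp only: zr power_one mult_1_right)
        moreover have "N * p ^ Suc n > 0" using N(1) pos by simp
        ultimately show False using step(7) unfolding root_of_unity_def by blast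
      qed
      moreover have "prime_power_primitive p n (z ^ p)"
        using prime_power_primitive_pow_prime[OF step(4), of 1] step(1) by simp
      ultimately have "min c ((2 * ln p - ln 2) / 2) / p ^ 3 \<le> weil_height y"
        using step.IH y y0 by blast
      also have "\<dots> \<le> weil_height x"
        unfolding y_def by (rule height_mult_root_of_unity_le[OF algx pos zr])
      finally show ?thesis .
    qed
  }
qed

text \<open>The fields \<open>F(z)\<close> increase with the level, so any two elements lie in a
  common one, and their union is closed under all field operations.\<close>

lemma adjoin_roots_subset:
  assumes "x \<in> adjoin F (prime_power_roots_of_unity p)"
  shows "\<exists>n z. n \<ge> 2 \<and> prime_power_primitive p n z \<and> x \<in> simple_ext F z"
proof -
  have mono: "simple_ext F w \<subseteq> simple_ext F z"
    if w: "prime_power_primitive p m w" and z: "prime_power_primitive p n z" and "m \<le> n" for m n w z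
  proof -
    have "p ^ n = p ^ m * p ^ (n - m)" using \<open>m \<le> n\<close> by (simp flip: power_add)
    then have "w ^ (p ^ n) = 1" using w by (simp add: prime_power_primitive_def power_mult)
    then obtain k where "w = z ^ k" using prime_power_primitive_roots[OF p z] by metis
    then have "w \<in> simple_ext F z"
      using simple_ext_gen[OF galois_subring] subring_power[OF is_subring_simple_ext[OF galois_subring]] by simp
    then show ?thesis
      using simple_ext_base[OF galois_subring]
      by (intro simple_ext_minimal is_subring_simple_ext galois_subring) auto
  qed
  have common: "\<exists>n z. n \<ge> 2 \<and> prime_power_primitive p n z \<and> a \<in> simple_ext F z \<and> b \<in> simple_ext F z"
    if a: "\<exists>n z. n \<ge> 2 \<and> prime_power_primitive p n z \<and> a \<in> simple_ext F z"
      and b: "\<exists>n z. n \<ge> 2 \<and> prime_power_primitive p n z \<and> b \<in> simple_ext F z" for a b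
  proof -
    obtain m w where m: "m \<ge> 2" "prime_power_primitive p m w" "a \<in> simple_ext F w" using a by blast
    obtain n z where n: "n \<ge> 2" "prime_power_primitive p n z" "b \<in> simple_ext F z" using b by blast
    show ?thesis
    proof (cases "m \<le> n")
      case True
      then show ?thesis using mono[OF m(2) n(2)] m n by blast
    next
      case False
      then have "n \<le> m" by simp
      then show ?thesis using mono[OF n(2) m(2)] m n by blast
    qed
  qed
  show ?thesis
    using assms unfolding adjoin_def
  proof (induction rule: generate_field.induct)
    case one
    obtain z where z: "prime_power_primitive p 2 z" using prime_power_primitive_exists[OF p, of 2] by auto
    then show ?case
      using subring_one[OF is_subring_simple_ext[OF galois_subring]] by (auto simp: complex_ring_simps)
  next
    case (incl h)
    then show ?case
    proof
      assume h: "h \<in> F"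
      obtain z where z: "prime_power_primitive p 2 z" using prime_power_primitive_exists[OF p, of 2] by auto
      then show ?thesis using simple_ext_base[OF galois_subring h] by auto
    next
      assume "h \<in> prime_power_roots_of_unity p"
      then obtain k where k: "h ^ (p ^ k) = 1" by (auto simp: prime_power_roots_of_unity_def)
      \<comment> \<open>The shift by 2 guarantees \<open>n \<ge> 2\<close>, where the induction for
        heights starts.\<close>
      obtain z where z: "prime_power_primitive p (k + 2) z"
        using prime_power_primitive_exists[OF p, of "k + 2"] by auto
      have "h ^ (p ^ (k + 2)) = (h ^ (p ^ k)) ^ (p ^ 2)" by (simp only: power_add power_mult)
      then have "h ^ (p ^ (k + 2)) = 1" by (simp only: k power_one)
      then obtain j where "h = z ^ j" using prime_power_primitive_roots[OF p z] by metis
      then have "h \<in> simple_ext F z"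
        using simple_ext_gen[OF galois_subring] subring_power[OF is_subring_simple_ext[OF galois_subring]] by simp
      then show ?thesis using z by (intro exI[of _ "k + 2"] exI[of _ z]) simp
    qed
  next
    case (a_inv h)
    then show ?case
      using subring_uminus[OF is_subring_simple_ext[OF galois_subring]] by (auto simp: complex_ring_a_inv)
  next
    case (m_inv h)
    obtain n z where nz: "n \<ge> 2" "prime_power_primitive p n z" "h \<in> simple_ext F z" using m_inv.IH by blast
    then have "inverse h \<in> simple_ext F z" by (intro subfield_inverse is_subfield_adjoin_root)
    moreover have "inv\<^bsub>complex_ring\<^esub> h = inverse h"
      using m_inv.hyps by (intro complex_ring_m_inv) (simp add: complex_ring_simps)
    ultimately show ?case using nz by auto
  next
    case (eng_add h1 h2)
    obtain n z where nz: "n \<ge> 2" "prime_power_primitive p n z" "h1 \<in> simple_ext F z" "h2 \<in> simple_ext F z"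
      using common[OF eng_add.IH] by blast
    then have "h1 + h2 \<in> simple_ext F z" by (intro subring_add is_subring_simple_ext galois_subring)
    then show ?case using nz by (auto simp: complex_ring_simps)
  next
    case (eng_mult h1 h2)
    obtain n z where nz: "n \<ge> 2" "prime_power_primitive p n z" "h1 \<in> simple_ext F z" "h2 \<in> simple_ext F z"
      using common[OF eng_mult.IH] by blast
    then have "h1 * h2 \<in> simple_ext F z" by (intro subring_mult is_subring_simple_ext galois_subring)
    then show ?case using nz by (auto simp: complex_ring_simps)
  qed
qed

end

theorem theorem3p5:
  fixes p :: nat and F :: "complex set"
  assumes "Factorial_Ring.prime p"
    and "galois_over_rats F"
    and "unramified_at F p"
    and "property_B F"
  shows "property_B (adjoin F (prime_power_roots_of_unity p))"
proof -
  obtain c where c: "c > 0" "\<And>x. x \<in> F \<Longrightarrow> x \<noteq> 0 \<Longrightarrow> \<not> root_of_unity x \<Longrightarrow> c \<le> weil_height x"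
    using assms(4) unfolding property_B_def by blast
  have p1: "real p \<ge> 2" using prime_ge_2_nat[OF assms(1)] by simp
  have "ln 2 \<le> ln (real p)" using p1 by (intro ln_mono) auto
  \<comment> \<open>Positive even for \<open>p = 2\<close>, since
    \<open>2 ln p - ln 2 \<ge> ln 2\<close>.\<close>
  then have "2 * ln (real p) - ln 2 > 0" by (smt (verit) ln_gt_zero)
  then have pos: "min c ((2 * ln p - ln 2) / 2) / p ^ 3 > 0"
    using c(1) p1 by (intro divide_pos_pos) auto
  have "min c ((2 * ln p - ln 2) / 2) / p ^ 3 \<le> weil_height x"
    if x: "x \<in> adjoin F (prime_power_roots_of_unity p)" "x \<noteq> 0" "\<not> root_of_unity x" for x
  proof -
    obtain n z where nz: "n \<ge> 2" "prime_power_primitive p n z" "x \<in> simple_ext F z"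
      using adjoin_roots_subset[OF assms(1-3) x(1)] by blast
    show ?thesis by (rule height_bound_adjoin[OF assms(1-3) c nz x(2,3)])
  qed
  then show ?thesis using pos unfolding property_B_def by blast
qed

end
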